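(* Let $J$ be the ideal of $\mathbf{k}[a,x]$ generated by $f_1,\dots,f_q$, let $\mathcal{Q}\subset\mathbf{k}[a]$ be a prime ideal, and let $\prec$ be a monomial order on the terms $x^\alpha$ which is not a well order. Let $H(J)\subset\mathbf{k}[a,x,z]$ be the ideal generated by the homogenizations $H(f_1),\dots,H(f_q)$, and let $G$ be a (finite) $<^z$-standard basis of $$J'=H(J)+\mathbf{k}[a,x,z]\cdot\mathcal{Q}$$ made of homogeneous elements. Put $\mathcal{G}=\{f_{|z=1}: f\in G\smallsetminus\mathcal{Q}\}$ and let $h\in\mathbf{k}[a]$ be the product of the $\mathrm{lc}_\prec(g)$, $g\in\mathcal{G}$. Then there exists $h'\in\mathbf{k}[a]\smallsetminus\mathcal{Q}$ such that for any prime ideal $\mathcal{P}\in V(\mathcal{Q})\smallsetminus V(hh')$, $(\mathcal{G})_{\mathcal{P}}$ is a $\prec$-standard basis of $(J)_{\mathcal{P}}$.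
   Context: $\mathbf{k}$ is a field, $a=(a^1,\dots,a^m)$ are parameters, $x=(x_1,\dots,x_n)$ are the main variables, and $z$ is a further variable. A monomial order is a total order on terms compatible with products. For $0\neq f\in A[x]$ ($A$ a commutative ring), written $f=\sum_\alpha c_\alpha x^\alpha$: $\exp_\prec(f)=\max_\prec\{\alpha:c_\alpha\ne0\}$ and $\mathrm{lc}_\prec(f)=c_{\exp_\prec(f)}\in A$; here for $f\in\mathbf{k}[a,x]=\mathbf{k}[a][x]$ one takes $A=\mathbf{k}[a]$. For an ideal $I\subset K[x]$ ($K$ a field), a finite set $G\subset I$ is a $\prec$-standard basis of $I$ if every $f\in I$, $f\ne0$, has a standard representation $f=\sum_{g\in G}q_g g$ with $q_g\in K[x]$ and, for each $g$, $q_gg=0$ or $\exp_\prec(f)\succeq\exp_\prec(q_gg)$. For a well order this is the usual notion of Gröbner basis. Fix a monomial order $<_0$ on the terms $a^\gamma$ ($\gamma\in\mathbb{N}^m$) that is a well order. The order $\prec^z$ on the terms $x^\alpha z^k$ is: $x^\alpha z^k\prec^z x^{\alpha'}z^{k'}$ iff $|\alpha|+k<|\alpha'|+k'$, or equality and $x^\alpha\prec x^{\alpha'}$. The order $<^z$ on the terms $a^\gamma x^\alpha z^k$ is: $a^\gamma x^\alpha z^k<^z a^{\gamma'}x^{\alpha'}z^{k'}$ iff $x^\alpha z^k\prec^z x^{\alpha'}z^{k'}$, or $x^\alpha z^k=x^{\alpha'}z^{k'}$ and $a^\gamma<_0a^{\gamma'}$. Both are well orders. A $<^z$-standard basis is a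 Gröbner basis in $\mathbf{k}[a,x,z]$ with respect to $<^z$. The homogenization of $f=\sum_\alpha c_\alpha x^\alpha\in\mathbf{k}[a][x]$ is $H(f)=\sum_\alpha c_\alpha x^\alpha z^{d-|\alpha|}$ with $d$ the total degree of $f$ in $x$. An element $\sum c_{\alpha,k}x^\alpha z^k\in\mathbf{k}[a][x,z]$ is homogeneous of degree $d$ if $c_{\alpha,k}=0$ whenever $|\alpha|+k\ne d$. $V(\mathcal{I})$ is the set of prime ideals of $\mathbf{k}[a]$ containing $\mathcal{I}$, and $V(c)=V(c\,\mathbf{k}[a])$. For $\mathcal{P}\in\mathrm{Spec}(\mathbf{k}[a])$, $\mathcal{F}(\mathcal{P})=\mathrm{Frac}(\mathbf{k}[a]/\mathcal{P})$, and $f\mapsto(f)_{\mathcal{P}}$ is the coefficientwise map $\mathbf{k}[a][x]\to\mathcal{F}(\mathcal{P})[x]$; $(\mathcal{G})_{\mathcal{P}}=\{(g)_{\mathcal{P}}:g\in\mathcal{G}\}$, and $(J)_{\mathcal{P}}$ is the ideal of $\mathcal{F}(\mathcal{P})[x]$ generated by all $(f)_{\mathcal{P}}$, $f\in J$. *)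

theory Defs
  imports
    "HOL-Algebra.QuotRing"
    "HOL-Analysis.Finite_Cartesian_Product"
    "HOL-Library.Product_Plus"
begin

section \<open>Polynomials over a ring record\<close>

text \<open>
  Terms are elements of an additive commutative monoid \<open>'t\<close>: a term $x^\alpha$ with
  $\alpha \in N^n$ is its exponent \<open>\<alpha> :: nat ^ 'n\<close>, and a term $x^\alpha z^k$ is the pair
  \<open>(\<alpha>, k)\<close>. A polynomial is its coefficient function; both have finite support in the carrier.
  Thus \<open>A = mpoly K\<close> with exponents \<open>nat ^ 'm\<close> is $k[a]$, and \<open>mpoly A\<close> is $k[a][x]$ or
  $k[a][x,z]$, depending on the type of the exponents.
\<close>

definition supp :: "('c, 'd) ring_scheme \<Rightarrow> ('t \<Rightarrow> 'c) \<Rightarrow> 't set" where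
  "supp R f = {t. f t \<noteq> \<zero>\<^bsub>R\<^esub>}"

definition mpoly :: "('c, 'd) ring_scheme \<Rightarrow> ('t::comm_monoid_add \<Rightarrow> 'c) ring" where
  "mpoly R =
    \<lparr>carrier = {f. range f \<subseteq> carrier R \<and> finite (supp R f)},
     mult = (\<lambda>f g t. \<Oplus>\<^bsub>R\<^esub>p\<in>{p \<in> supp R f \<times> supp R g. fst p + snd p = t}.
                        f (fst p) \<otimes>\<^bsub>R\<^esub> g (snd p)),
     one = (\<lambda>t. if t = 0 then \<one>\<^bsub>R\<^esub> else \<zero>\<^bsub>R\<^esub>),
     zero = (\<lambda>t. \<zero>\<^bsub>R\<^esub>),
     add = (\<lambda>f g t. f t \<oplus>\<^bsub>R\<^esub> g t)\<rparr>"

definition const :: "('c, 'd) ring_scheme \<Rightarrow> 'c \<Rightarrow> ('t::comm_monoid_add \<Rightarrow> 'c)" where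
  "const R c = (\<lambda>t. if t = 0 then c else \<zero>\<^bsub>R\<^esub>)"

text \<open>
  The identification of $k[a][x,z]$ with $k[a,x,z]$: the coefficient of
  $x^\alpha z^k a^\gamma$ is the coefficient of $a^\gamma$ in the coefficient of $x^\alpha z^k$.
\<close>

definition flatten :: "('t \<Rightarrow> 's \<Rightarrow> 'c) \<Rightarrow> ('t \<times> 's \<Rightarrow> 'c)" where
  "flatten f = (\<lambda>(t, s). f t s)"


section \<open>Monomial orders and standard bases\<close>

text \<open>Orders are given by their strict part.\<close>

definition monomial_order :: "('t::comm_monoid_add \<Rightarrow> 't \<Rightarrow> bool) \<Rightarrow> bool" where
  "monomial_order lt \<longleftrightarrow> irreflp lt \<and> transp lt \<and> totalp lt \<and>
     (\<forall>s t u. lt s t \<longrightarrow> lt (s + u) (t + u))"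

text \<open>Leading exponent and leading coefficient, meaningful for nonzero polynomials only.\<close>

definition lexp :: "('c, 'd) ring_scheme \<Rightarrow> ('t \<Rightarrow> 't \<Rightarrow> bool) \<Rightarrow> ('t \<Rightarrow> 'c) \<Rightarrow> 't" where
  "lexp R lt f = (THE t. t \<in> supp R f \<and> (\<forall>s\<in>supp R f. lt s t \<or> s = t))"

definition lc :: "('c, 'd) ring_scheme \<Rightarrow> ('t \<Rightarrow> 't \<Rightarrow> bool) \<Rightarrow> ('t \<Rightarrow> 'c) \<Rightarrow> 'c" where
  "lc R lt f = f (lexp R lt f)"

text \<open>To be used for a field \<open>K\<close> and an ideal \<open>I\<close> of \<open>mpoly K\<close>.\<close>

definition standard_basis ::
  "('c, 'd) ring_scheme \<Rightarrow> ('t::comm_monoid_add \<Rightarrow> 't \<Rightarrow> bool) \<Rightarrow>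
   ('t \<Rightarrow> 'c) set \<Rightarrow> ('t \<Rightarrow> 'c) set \<Rightarrow> bool" where
  "standard_basis K lt I G \<longleftrightarrow>
     finite G \<and> G \<subseteq> I \<and>
     (\<forall>f\<in>I. f \<noteq> \<zero>\<^bsub>mpoly K\<^esub> \<longrightarrow>
        (\<exists>q. (\<forall>g\<in>G. q g \<in> carrier (mpoly K)) \<and>
             f = (\<Oplus>\<^bsub>mpoly K\<^esub>g\<in>G. q g \<otimes>\<^bsub>mpoly K\<^esub> g) \<and>
             (\<forall>g\<in>G. q g \<otimes>\<^bsub>mpoly K\<^esub> g = \<zero>\<^bsub>mpoly K\<^esub> \<or>
                lt (lexp K lt (q g \<otimes>\<^bsub>mpoly K\<^esub> g)) (lexp K lt f) \<or>
                lexp K lt (q g \<otimes>\<^bsub>mpoly K\<^esub> g) = lexp K lt f)))"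

definition tdeg :: "nat ^ 'n \<Rightarrow> nat" where
  "tdeg \<alpha> = (\<Sum>i\<in>UNIV. \<alpha> $ i)"

definition lt_xz ::
  "(nat ^ 'n \<Rightarrow> nat ^ 'n \<Rightarrow> bool) \<Rightarrow> (nat ^ 'n) \<times> nat \<Rightarrow> (nat ^ 'n) \<times> nat \<Rightarrow> bool" where
  "lt_xz lt = (\<lambda>(\<alpha>, k) (\<alpha>', k'). tdeg \<alpha> + k < tdeg \<alpha>' + k' \<or>
                 tdeg \<alpha> + k = tdeg \<alpha>' + k' \<and> lt \<alpha> \<alpha>')"

definition lt_axz ::
  "(nat ^ 'm \<Rightarrow> nat ^ 'm \<Rightarrow> bool) \<Rightarrow> (nat ^ 'n \<Rightarrow> nat ^ 'n \<Rightarrow> bool) \<Rightarrow>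
   ((nat ^ 'n) \<times> nat) \<times> (nat ^ 'm) \<Rightarrow> ((nat ^ 'n) \<times> nat) \<times> (nat ^ 'm) \<Rightarrow> bool" where
  "lt_axz lt0 lt = (\<lambda>(t, \<gamma>) (t', \<gamma>'). lt_xz lt t t' \<or> t = t' \<and> lt0 \<gamma> \<gamma>')"


section \<open>Homogenization\<close>

text \<open>The zero polynomial is sent to zero (whatever the value of \<open>Max {}\<close>).\<close>

definition homogenize ::
  "('c, 'd) ring_scheme \<Rightarrow> (nat ^ 'n \<Rightarrow> 'c) \<Rightarrow> ((nat ^ 'n) \<times> nat \<Rightarrow> 'c)" where
  "homogenize R f =
     (\<lambda>(\<alpha>, k). if tdeg \<alpha> + k = Max (tdeg ` supp R f) then f \<alpha> else \<zero>\<^bsub>R\<^esub>)"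

definition homogeneous :: "('c, 'd) ring_scheme \<Rightarrow> ((nat ^ 'n) \<times> nat \<Rightarrow> 'c) \<Rightarrow> bool" where
  "homogeneous R f \<longleftrightarrow> (\<exists>d. \<forall>\<alpha> k. tdeg \<alpha> + k \<noteq> d \<longrightarrow> f (\<alpha>, k) = \<zero>\<^bsub>R\<^esub>)"

text \<open>The substitution $z = 1$.\<close>

definition dehomogenize ::
  "('c, 'd) ring_scheme \<Rightarrow> ((nat ^ 'n) \<times> nat \<Rightarrow> 'c) \<Rightarrow> (nat ^ 'n \<Rightarrow> 'c)" where
  "dehomogenize R f = (\<lambda>\<alpha>. \<Oplus>\<^bsub>R\<^esub>k\<in>{k. (\<alpha>, k) \<in> supp R f}. f (\<alpha>, k))"


section \<open>Prime spectrum, residue fields and specialization\<close>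

definition V :: "('a, 'b) ring_scheme \<Rightarrow> 'a set \<Rightarrow> 'a set set" where
  "V R I = {P. primeideal P R \<and> I \<subseteq> P}"

definition frac_rel :: "('a, 'b) ring_scheme \<Rightarrow> (('a \<times> 'a) \<times> ('a \<times> 'a)) set" where
  "frac_rel D = {((a, b), (c, d)).
     a \<in> carrier D \<and> b \<in> carrier D - {\<zero>\<^bsub>D\<^esub>} \<and> c \<in> carrier D \<and> d \<in> carrier D - {\<zero>\<^bsub>D\<^esub>} \<and>
     a \<otimes>\<^bsub>D\<^esub> d = c \<otimes>\<^bsub>D\<^esub> b}"

text \<open>The field of fractions of a domain \<open>D\<close>; \<open>frac_rel D `` {(a, b)}\<close> is the fraction $a/b$.\<close>

definition Frac :: "('a, 'b) ring_scheme \<Rightarrow> ('a \<times> 'a) set ring" where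
  "Frac D =
    \<lparr>carrier = (carrier D \<times> (carrier D - {\<zero>\<^bsub>D\<^esub>})) // frac_rel D,
     mult = (\<lambda>X Y. frac_rel D `` {(a \<otimes>\<^bsub>D\<^esub> c, b \<otimes>\<^bsub>D\<^esub> d) | a b c d. (a, b) \<in> X \<and> (c, d) \<in> Y}),
     one = frac_rel D `` {(\<one>\<^bsub>D\<^esub>, \<one>\<^bsub>D\<^esub>)},
     zero = frac_rel D `` {(\<zero>\<^bsub>D\<^esub>, \<one>\<^bsub>D\<^esub>)},
     add = (\<lambda>X Y. frac_rel D `` {(a \<otimes>\<^bsub>D\<^esub> d \<oplus>\<^bsub>D\<^esub> c \<otimes>\<^bsub>D\<^esub> b, b \<otimes>\<^bsub>D\<^esub> d) | a b c d.
                                   (a, b) \<in> X \<and> (c, d) \<in> Y})\<rparr>"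

definition residue_field :: "('a, 'b) ring_scheme \<Rightarrow> 'a set \<Rightarrow> ('a set \<times> 'a set) set ring" where
  "residue_field R P = Frac (R Quot P)"

definition residue :: "('a, 'b) ring_scheme \<Rightarrow> 'a set \<Rightarrow> 'a \<Rightarrow> ('a set \<times> 'a set) set" where
  "residue R P c = frac_rel (R Quot P) `` {(P +>\<^bsub>R\<^esub> c, \<one>\<^bsub>R Quot P\<^esub>)}"

definition specialize ::
  "('a, 'b) ring_scheme \<Rightarrow> 'a set \<Rightarrow> ('t \<Rightarrow> 'a) \<Rightarrow> ('t \<Rightarrow> ('a set \<times> 'a set) set)" where
  "specialize R P f = (\<lambda>t. residue R P (f t))"

definition specialize_ideal ::
  "('a, 'b) ring_scheme \<Rightarrow> 'a set \<Rightarrow> ('t::comm_monoid_add \<Rightarrow> 'a) set \<Rightarrow>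
   ('t \<Rightarrow> ('a set \<times> 'a set) set) set" where
  "specialize_ideal R P J = Idl\<^bsub>mpoly (residue_field R P)\<^esub> (specialize R P ` J)"

end

theory Submission
  imports Defs
begin

text \<open>
  The choice $h' = 1$ works. Let $P \supseteq Q$ be a prime with $h \notin P$, and let $E$ be the set of
  exponents divisible by some $\exp(g)$, $g \in G \setminus Q$. No $\mathrm{lc}(g)$ lies in $P$, so every
  $F \in k[a][x,z]$ has a pseudo-division $cF = p + r$ with $c \notin P$, $p$ a combination of
  $G \setminus Q$ bounded by $\exp(F)$, and $r$ without exponents in $E$; if the coefficients of $F$ lie
  in $P$, so do those of $r$. A remainder $r \in J'$ has all its coefficients in $Q$: delete those in $Q$,
  which does not leave $J'$; what is left would have leading coefficient outside $Q$, and its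
  standard representation in $k[a,x,z]$ would put its leading exponent into $E$.

  Given $X \in (J)_P$, clear denominators and homogenize to get a homogeneous $R \in H(J)$ that
  specializes to a unit multiple of $X$ at $z = 1$. Split $R = R_1 + R_2$, where $R_2$ collects the
  coefficients in $P$. Dividing $R_1$ and $R_2$ separately, the remainders add up, after scaling, to an
  element of $J'$, hence vanish modulo $Q \subseteq P$. The remainder of $R_2$ vanishes modulo $P$, so that
  of $R_1$ does as well, and specializing the division of $R_1$ gives a standard representation of $X$,
  because $\exp(R_1)$ survives modulo $P$. Homogeneity turns the bound for $\prec^z$ into one for $\prec$.
\<close>

section \<open>The ring of polynomials\<close>

text \<open>Since \<open>lt\<close> need not be well-founded, division in k[a][x] may run forever.
  The order \<open>lt_xz lt\<close> compares total degrees before it consults \<open>lt\<close>, and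
  only finitely many exponents have bounded degree, so it is well-founded whatever \<open>lt\<close>
  is; this is why every division takes place after homogenization. The obstacle is that exp(R) may
  be lost modulo P: a division of R as a whole is bounded by exp(R) only, which can exceed exp(X).
  The coefficients outside P are those that survive in a unit multiple of X, so R_1 carries the
  right bound. But R_1 alone need not lie in J', and its remainder can be controlled only together
  with that of R_2. The multipliers of the divisions vary with X, yet nothing beyond h has to be
  avoided: each of them is a product of leading coefficients of elements of G outside Q, hence
  outside the prime P as soon as h is.\<close>

definition monom :: "('c, 'd) ring_scheme \<Rightarrow> 'c \<Rightarrow> 't \<Rightarrow> 't \<Rightarrow> 'c" where
  "monom R c s = (\<lambda>t. if t = s then c else \<zero>\<^bsub>R\<^esub>)"

lemma const_eq_monom: "const R c = monom R c 0"
  by (simp add: const_def monom_def)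

lemma mpoly_simps:
  "\<one>\<^bsub>mpoly R\<^esub> = const R \<one>\<^bsub>R\<^esub>" "\<zero>\<^bsub>mpoly R\<^esub> = (\<lambda>t. \<zero>\<^bsub>R\<^esub>)"
  "f \<oplus>\<^bsub>mpoly R\<^esub> g = (\<lambda>t. f t \<oplus>\<^bsub>R\<^esub> g t)"
  by (simp_all add: mpoly_def const_def)

lemma mpoly_carrier_iff:
  "f \<in> carrier (mpoly R) \<longleftrightarrow> (\<forall>t. f t \<in> carrier R) \<and> finite (supp R f)"
  by (auto simp: mpoly_def)

lemma finite_supp: "f \<in> carrier (mpoly R) \<Longrightarrow> finite (supp R f)"
  by (simp add: mpoly_carrier_iff)

lemma coeff_closed: "f \<in> carrier (mpoly R) \<Longrightarrow> f t \<in> carrier R"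
  by (simp add: mpoly_carrier_iff)

lemma in_supp_iff: "t \<in> supp R f \<longleftrightarrow> f t \<noteq> \<zero>\<^bsub>R\<^esub>"
  by (simp add: supp_def)

lemma mpoly_carrierI:
  assumes "\<And>t. f t \<in> carrier R" "finite S" "supp R f \<subseteq> S"
  shows "f \<in> carrier (mpoly R)"
  using assms by (auto simp: mpoly_carrier_iff intro: finite_subset)

lemma supp_monom_subset: "supp R (monom R c s) \<subseteq> {s}"
  by (auto simp: supp_def monom_def)

context cring
begin

text \<open>The product in \<open>mpoly\<close> sums over the supports of the factors, which change
  from one polynomial to another. With the constraint moved into the summand, any finite box
  containing the supports serves as index set, and products of different polynomials can be compared
  term by term.\<close>

lemma mpoly_mult_eq:
  assumes fg: "f \<in> carrier (mpoly R)" "g \<in> carrier (mpoly R)"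
    and fin: "finite S" "finite T"
    and sub: "supp R f \<subseteq> S" "supp R g \<subseteq> T"
  shows "(f \<otimes>\<^bsub>mpoly R\<^esub> g) t = (\<Oplus>p\<in>S\<times>T. if fst p + snd p = t then f (fst p) \<otimes> g (snd p) else \<zero>)"
proof -
  have "(f \<otimes>\<^bsub>mpoly R\<^esub> g) t = (\<Oplus>p\<in>{p \<in> supp R f \<times> supp R g. fst p + snd p = t}.
                        f (fst p) \<otimes> g (snd p))"
    by (simp add: mpoly_def)
  also have "\<dots> = (\<Oplus>p\<in>S\<times>T. if fst p + snd p = t then f (fst p) \<otimes> g (snd p) else \<zero>)"
    using fin sub fg
    by (intro add.finprod_mono_neutral_cong_left)
      (auto simp: mpoly_carrier_iff in_supp_iff Pi_iff)
  finally show ?thesis .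
qed

lemma monom_closed [simp]: "c \<in> carrier R \<Longrightarrow> monom R c s \<in> carrier (mpoly R)"
  by (rule mpoly_carrierI[of _ _ "{s}"]) (auto simp: monom_def supp_def)

lemma supp_mult:
  assumes "f \<in> carrier (mpoly R)" "g \<in> carrier (mpoly R)" "t \<in> supp R (f \<otimes>\<^bsub>mpoly R\<^esub> g)"
  shows "\<exists>s\<in>supp R f. \<exists>u\<in>supp R g. t = s + u"
proof (rule ccontr)
  assume *: "\<not> ?thesis"
  have "(f \<otimes>\<^bsub>mpoly R\<^esub> g) t = (\<Oplus>p\<in>supp R f\<times>supp R g. if fst p + snd p = t then f (fst p) \<otimes> g (snd p) else \<zero>)"
    using assms by (intro mpoly_mult_eq) (auto simp: finite_supp)
  also have "\<dots> = \<zero>"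
    using * by (intro add.finprod_one_eqI) (metis (full_types) SigmaD1 SigmaD2 prod.collapse)
  finally show False
    using assms by (simp add: in_supp_iff)
qed

lemma mpoly_mult_closed:
  assumes "f \<in> carrier (mpoly R)" "g \<in> carrier (mpoly R)"
  shows "f \<otimes>\<^bsub>mpoly R\<^esub> g \<in> carrier (mpoly R)"
proof (rule mpoly_carrierI)
  show "finite ((\<lambda>(s, u). s + u) ` (supp R f \<times> supp R g))"
    using assms by (auto simp: finite_supp)
  show "supp R (f \<otimes>\<^bsub>mpoly R\<^esub> g) \<subseteq> (\<lambda>(s, u). s + u) ` (supp R f \<times> supp R g)"
    using supp_mult[OF assms] by fastforce
  fix t
  have "(f \<otimes>\<^bsub>mpoly R\<^esub> g) t = (\<Oplus>p\<in>supp R f\<times>supp R g. if fst p + snd p = t then f (fst p) \<otimes> g (snd p) else \<zero>)"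
    using assms by (intro mpoly_mult_eq) (auto simp: finite_supp)
  also have "\<dots> \<in> carrier R"
    using assms by (intro finsum_closed) (auto simp: coeff_closed)
  finally show "(f \<otimes>\<^bsub>mpoly R\<^esub> g) t \<in> carrier R" .
qed

lemma mpoly_add_closed:
  assumes "f \<in> carrier (mpoly R)" "g \<in> carrier (mpoly R)"
  shows "f \<oplus>\<^bsub>mpoly R\<^esub> g \<in> carrier (mpoly R)"
  using assms
  by (intro mpoly_carrierI[of _ _ "supp R f \<union> supp R g"])
    (auto simp: mpoly_simps finite_supp coeff_closed in_supp_iff)

lemma mpoly_zero_closed: "\<zero>\<^bsub>mpoly R\<^esub> \<in> carrier (mpoly R)"
  by (auto simp: mpoly_simps mpoly_carrier_iff supp_def)

lemma mpoly_abelian_group: "abelian_group (mpoly R)"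
proof (rule abelian_groupI)
  fix f assume f: "f \<in> carrier (mpoly R)"
  have "(\<lambda>t. \<ominus> f t) \<in> carrier (mpoly R)"
    using f by (intro mpoly_carrierI[of _ _ "supp R f"])
      (auto simp: finite_supp coeff_closed in_supp_iff)
  moreover have "(\<lambda>t. \<ominus> f t) \<oplus>\<^bsub>mpoly R\<^esub> f = \<zero>\<^bsub>mpoly R\<^esub>"
    using f by (auto simp: mpoly_simps coeff_closed l_neg)
  ultimately show "\<exists>y\<in>carrier (mpoly R). y \<oplus>\<^bsub>mpoly R\<^esub> f = \<zero>\<^bsub>mpoly R\<^esub>" by blast
qed (auto simp: mpoly_add_closed mpoly_zero_closed, auto simp: mpoly_simps coeff_closed a_ac)

text \<open>The support is exhausted one exponent at a time. The side condition
  \<open>f s = \<zero>\<close> keeps the new monomial away from the terms already present, so every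
  coefficient of the sum is a coefficient of one of the two parts; arguments about where
  coefficients lie rely on this.\<close>

lemma mpoly_induct [consumes 1, case_names zero add]:
  assumes "f \<in> carrier (mpoly R)" and "P (\<lambda>t. \<zero>)"
    and step: "\<And>c s f. c \<in> carrier R \<Longrightarrow> f \<in> carrier (mpoly R) \<Longrightarrow> f s = \<zero> \<Longrightarrow>
      P f \<Longrightarrow> P (monom R c s \<oplus>\<^bsub>mpoly R\<^esub> f)"
  shows "P f"
proof -
  have "\<forall>f \<in> carrier (mpoly R). supp R f \<subseteq> S \<longrightarrow> P f" if "finite S" for S
    using that
  proof (induction S)
    case empty
    have "f = (\<lambda>t. \<zero>)" if "supp R f = {}" for f
      using that by (auto simp: supp_def)
    then show ?case using assms(2) by auto
  next
    case (insert s S)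
    show ?case
    proof (intro ballI impI)
      fix f assume f: "f \<in> carrier (mpoly R)" "supp R f \<subseteq> insert s S"
      let ?g = "f(s := \<zero>)"
      have g: "supp R ?g \<subseteq> S" using f insert.hyps by (auto simp: supp_def)
      moreover have "?g \<in> carrier (mpoly R)"
        using f g insert.hyps by (intro mpoly_carrierI[of _ _ S]) (auto simp: coeff_closed)
      moreover have "f = monom R (f s) s \<oplus>\<^bsub>mpoly R\<^esub> ?g"
        using f by (auto simp: mpoly_simps monom_def coeff_closed)
      ultimately show "P f"
        using insert.IH step[of "f s" ?g s] f(1) by (metis coeff_closed fun_upd_same)
    qed
  qed
  from this[OF finite_supp[OF assms(1)]] show ?thesis using assms(1) by blast
qed

lemma mpoly_mult_comm:
  assumes "f \<in> carrier (mpoly R)" "g \<in> carrier (mpoly R)"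
  shows "f \<otimes>\<^bsub>mpoly R\<^esub> g = g \<otimes>\<^bsub>mpoly R\<^esub> f"
proof
  fix t
  let ?S = "supp R f" and ?T = "supp R g"
  have fin: "finite ?S" "finite ?T" using assms by (auto simp: finite_supp)
  have "(f \<otimes>\<^bsub>mpoly R\<^esub> g) t = (\<Oplus>p\<in>?S\<times>?T. if fst p + snd p = t then f (fst p) \<otimes> g (snd p) else \<zero>)"
    using assms fin by (intro mpoly_mult_eq) auto
  also have "?S\<times>?T = prod.swap ` (?T\<times>?S)" by (auto simp: image_iff)
  also have "(\<Oplus>p\<in>\<dots>. if fst p + snd p = t then f (fst p) \<otimes> g (snd p) else \<zero>) =
     (\<Oplus>p\<in>?T\<times>?S. if fst (prod.swap p) + snd (prod.swap p) = t then f (fst (prod.swap p)) \<otimes> g (snd (prod.swap p)) else \<zero>)"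
    using assms by (intro finsum_reindex) (auto simp: coeff_closed)
  also have "\<dots> = (\<Oplus>p\<in>?T\<times>?S. if fst p + snd p = t then g (fst p) \<otimes> f (snd p) else \<zero>)"
    using assms by (intro finsum_cong') (auto simp: coeff_closed m_comm add.commute)
  also have "\<dots> = (g \<otimes>\<^bsub>mpoly R\<^esub> f) t"
    using assms fin by (intro mpoly_mult_eq[symmetric]) auto
  finally show "(f \<otimes>\<^bsub>mpoly R\<^esub> g) t = (g \<otimes>\<^bsub>mpoly R\<^esub> f) t" .
qed

lemma mpoly_l_distr:
  assumes "f \<in> carrier (mpoly R)" "g \<in> carrier (mpoly R)" "h \<in> carrier (mpoly R)"
  shows "(f \<oplus>\<^bsub>mpoly R\<^esub> g) \<otimes>\<^bsub>mpoly R\<^esub> h = f \<otimes>\<^bsub>mpoly R\<^esub> h \<oplus>\<^bsub>mpoly R\<^esub> g \<otimes>\<^bsub>mpoly R\<^esub> h"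
proof
  fix t
  let ?S = "supp R f \<union> supp R g" and ?T = "supp R h"
  have fin: "finite ?S" "finite ?T" using assms by (auto simp: finite_supp)
  have c: "f \<oplus>\<^bsub>mpoly R\<^esub> g \<in> carrier (mpoly R)" using assms by (simp add: mpoly_add_closed)
  have s: "supp R (f \<oplus>\<^bsub>mpoly R\<^esub> g) \<subseteq> ?S" by (auto simp: in_supp_iff mpoly_simps)
  have "(f \<otimes>\<^bsub>mpoly R\<^esub> h \<oplus>\<^bsub>mpoly R\<^esub> g \<otimes>\<^bsub>mpoly R\<^esub> h) t =
    (f \<otimes>\<^bsub>mpoly R\<^esub> h) t \<oplus> (g \<otimes>\<^bsub>mpoly R\<^esub> h) t" by (simp add: mpoly_simps)
  also have "\<dots> = (\<Oplus>p\<in>?S\<times>?T. if fst p + snd p = t then f (fst p) \<otimes> h (snd p) else \<zero>) \<oplus>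
     (\<Oplus>p\<in>?S\<times>?T. if fst p + snd p = t then g (fst p) \<otimes> h (snd p) else \<zero>)"
    using assms fin mpoly_mult_eq[of f h ?S ?T] mpoly_mult_eq[of g h ?S ?T] by simp
  also have "\<dots> = (\<Oplus>p\<in>?S\<times>?T. (if fst p + snd p = t then f (fst p) \<otimes> h (snd p) else \<zero>) \<oplus>
       (if fst p + snd p = t then g (fst p) \<otimes> h (snd p) else \<zero>))"
    using assms by (intro finsum_addf[symmetric]) (auto simp: coeff_closed)
  also have "\<dots> = (\<Oplus>p\<in>?S\<times>?T. if fst p + snd p = t then (f \<oplus>\<^bsub>mpoly R\<^esub> g) (fst p) \<otimes> h (snd p) else \<zero>)"
    using assms by (intro finsum_cong') (auto simp: coeff_closed mpoly_simps l_distr)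
  also have "\<dots> = ((f \<oplus>\<^bsub>mpoly R\<^esub> g) \<otimes>\<^bsub>mpoly R\<^esub> h) t"
    using assms fin c s by (intro mpoly_mult_eq[symmetric]) auto
  finally show "((f \<oplus>\<^bsub>mpoly R\<^esub> g) \<otimes>\<^bsub>mpoly R\<^esub> h) t = (f \<otimes>\<^bsub>mpoly R\<^esub> h \<oplus>\<^bsub>mpoly R\<^esub> g \<otimes>\<^bsub>mpoly R\<^esub> h) t" by simp
qed

lemma mpoly_r_distr:
  assumes "f \<in> carrier (mpoly R)" "g \<in> carrier (mpoly R)" "h \<in> carrier (mpoly R)"
  shows "h \<otimes>\<^bsub>mpoly R\<^esub> (f \<oplus>\<^bsub>mpoly R\<^esub> g) = h \<otimes>\<^bsub>mpoly R\<^esub> f \<oplus>\<^bsub>mpoly R\<^esub> h \<otimes>\<^bsub>mpoly R\<^esub> g"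
  using assms mpoly_l_distr[OF assms]
  by (metis mpoly_mult_comm mpoly_add_closed)

lemma mpoly_mult_zero:
  assumes "f \<in> carrier (mpoly R)"
  shows "f \<otimes>\<^bsub>mpoly R\<^esub> (\<lambda>t. \<zero>) = (\<lambda>t. \<zero>)" "(\<lambda>t. \<zero>) \<otimes>\<^bsub>mpoly R\<^esub> f = (\<lambda>t. \<zero>)"
  using assms supp_mult[OF assms] supp_mult[OF _ assms] mpoly_zero_closed
  by (fastforce simp: in_supp_iff mpoly_simps)+

lemma monom_mult_monom:
  assumes "a \<in> carrier R" "b \<in> carrier R"
  shows "monom R a s \<otimes>\<^bsub>mpoly R\<^esub> monom R b u = monom R (a \<otimes> b) (s + u)"
proof
  fix t
  have "(monom R a s \<otimes>\<^bsub>mpoly R\<^esub> monom R b u) t = (\<Oplus>p\<in>{s}\<times>{u}. if fst p + snd p = t then monom R a s (fst p) \<otimes> monom R b u (snd p) else \<zero>)"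
    using assms by (intro mpoly_mult_eq) (auto simp: supp_monom_subset)
  also have "\<dots> = monom R (a \<otimes> b) (s + u) t"
    using assms by (auto simp: monom_def)
  finally show "(monom R a s \<otimes>\<^bsub>mpoly R\<^esub> monom R b u) t = monom R (a \<otimes> b) (s + u) t" .
qed

lemma mpoly_one_mult:
  assumes "f \<in> carrier (mpoly R)"
  shows "\<one>\<^bsub>mpoly R\<^esub> \<otimes>\<^bsub>mpoly R\<^esub> f = f"
  using assms
proof (induction rule: mpoly_induct)
  case zero
  then show ?case by (simp add: mpoly_simps const_eq_monom mpoly_mult_zero)
next
  case (add c s f)
  then show ?case
    by (simp add: mpoly_r_distr mpoly_simps(1) const_eq_monom monom_mult_monom)
qed

text \<open>Associativity is extended from monomials by linearity, one factor per lemma: the last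
  factor here, then the middle one, then the first. No triple convolution sum has to be
  reindexed.\<close>

lemma monom_mult_assoc:
  assumes "a \<in> carrier R" "b \<in> carrier R" "f \<in> carrier (mpoly R)"
  shows "monom R a s \<otimes>\<^bsub>mpoly R\<^esub> (monom R b t \<otimes>\<^bsub>mpoly R\<^esub> f) =
    monom R a s \<otimes>\<^bsub>mpoly R\<^esub> monom R b t \<otimes>\<^bsub>mpoly R\<^esub> f"
  using assms(3)
proof (induction rule: mpoly_induct)
  case zero
  then show ?case using assms by (simp add: mpoly_mult_zero mpoly_mult_closed)
next
  case (add c u f)
  then show ?case
    using assms by (simp add: mpoly_r_distr monom_mult_monom mpoly_mult_closed m_assoc add.assoc)
qed

lemma monom_mult_assoc':
  assumes "a \<in> carrier R" "f \<in> carrier (mpoly R)" "g \<in> carrier (mpoly R)"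
  shows "monom R a s \<otimes>\<^bsub>mpoly R\<^esub> (f \<otimes>\<^bsub>mpoly R\<^esub> g) = monom R a s \<otimes>\<^bsub>mpoly R\<^esub> f \<otimes>\<^bsub>mpoly R\<^esub> g"
  using assms(2)
proof (induction rule: mpoly_induct)
  case zero
  then show ?case using assms by (simp add: mpoly_mult_zero)
next
  case (add c u f)
  then show ?case
    using assms by (simp add: mpoly_r_distr mpoly_l_distr mpoly_mult_closed monom_mult_assoc)
qed

lemma mpoly_mult_assoc:
  assumes "e \<in> carrier (mpoly R)" "f \<in> carrier (mpoly R)" "g \<in> carrier (mpoly R)"
  shows "e \<otimes>\<^bsub>mpoly R\<^esub> f \<otimes>\<^bsub>mpoly R\<^esub> g = e \<otimes>\<^bsub>mpoly R\<^esub> (f \<otimes>\<^bsub>mpoly R\<^esub> g)"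
  using assms(1)
proof (induction rule: mpoly_induct)
  case zero
  then show ?case using assms by (simp add: mpoly_mult_zero mpoly_mult_closed)
next
  case (add c u f)
  then show ?case
    using assms by (simp add: mpoly_l_distr mpoly_mult_closed monom_mult_assoc')
qed

lemma mpoly_cring: "cring (mpoly R)"
proof (rule cringI)
  have "\<one>\<^bsub>mpoly R\<^esub> \<in> carrier (mpoly R)" by (simp add: mpoly_simps const_eq_monom)
  then show "comm_monoid (mpoly R)"
    by (intro comm_monoidI)
      (auto simp: mpoly_mult_closed mpoly_mult_assoc mpoly_one_mult intro: mpoly_mult_comm)
qed (auto simp: mpoly_abelian_group mpoly_l_distr)

lemma const_closed [simp]: "c \<in> carrier R \<Longrightarrow> const R c \<in> carrier (mpoly R)"
  by (simp add: const_eq_monom)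

lemma coeff_const_mult:
  assumes "c \<in> carrier R" "f \<in> carrier (mpoly R)"
  shows "(const R c \<otimes>\<^bsub>mpoly R\<^esub> f) t = c \<otimes> f t"
  using assms(2)
proof (induction rule: mpoly_induct)
  case zero
  then show ?case using assms by (simp add: mpoly_mult_zero)
next
  case (add b u f)
  then show ?case
    using assms by (simp add: mpoly_r_distr const_eq_monom monom_mult_monom)
      (auto simp: mpoly_simps monom_def r_distr coeff_closed)
qed

lemma coeff_minus:
  assumes "f \<in> carrier (mpoly R)"
  shows "(\<ominus>\<^bsub>mpoly R\<^esub> f) t = \<ominus> f t"
proof -
  interpret M: cring "mpoly R" by (rule mpoly_cring)
  have "(\<ominus>\<^bsub>mpoly R\<^esub> f \<oplus>\<^bsub>mpoly R\<^esub> f) t = \<zero>"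
    using assms by (simp add: M.l_neg) (simp add: mpoly_simps)
  then show ?thesis
    using assms by (simp add: mpoly_simps coeff_closed minus_equality[symmetric])
qed

lemma coeff_finsum:
  assumes "\<And>i. i \<in> I \<Longrightarrow> F i \<in> carrier (mpoly R)"
  shows "(\<Oplus>\<^bsub>mpoly R\<^esub>i\<in>I. F i) t = (\<Oplus>i\<in>I. F i t)"
proof -
  interpret M: cring "mpoly R" by (rule mpoly_cring)
  show ?thesis
    using assms
  proof (induction I rule: infinite_finite_induct)
    case (infinite A)
    then show ?case by (simp add: mpoly_simps(2))
  next
    case empty
    then show ?case by (simp add: mpoly_simps(2))
  next
    case (insert x A)
    then have "F \<in> A \<rightarrow> carrier (mpoly R)" "(\<lambda>i. F i t) \<in> A \<rightarrow> carrier R" by (auto simp: coeff_closed)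
    with insert show ?case by (simp add: M.finsum_insert coeff_closed) (simp add: mpoly_simps)
  qed
qed

text \<open>An additive map is determined by its values on monomials, and multiplicativity spreads
  from monomials to all products by induction on each factor. This is the common criterion for
  changing coefficients, for setting z = 1 and for flattening.\<close>

lemma mpoly_ring_homI:
  assumes S: "cring S"
    and closed: "\<And>f. f \<in> carrier (mpoly R) \<Longrightarrow> \<psi> f \<in> carrier S"
    and add: "\<And>f g. f \<in> carrier (mpoly R) \<Longrightarrow> g \<in> carrier (mpoly R) \<Longrightarrow>
        \<psi> (f \<oplus>\<^bsub>mpoly R\<^esub> g) = \<psi> f \<oplus>\<^bsub>S\<^esub> \<psi> g"
    and mult: "\<And>a b s t. a \<in> carrier R \<Longrightarrow> b \<in> carrier R \<Longrightarrow>
        \<psi> (monom R (a \<otimes> b) (s + t)) = \<psi> (monom R a s) \<otimes>\<^bsub>S\<^esub> \<psi> (monom R b t)"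
    and one: "\<psi> (monom R \<one> 0) = \<one>\<^bsub>S\<^esub>"
  shows "\<psi> \<in> ring_hom (mpoly R) S"
proof -
  interpret S: cring S by fact
  interpret M: cring "mpoly R" by (rule mpoly_cring)
  \<comment> \<open>Preservation of zero is not among the assumptions; it follows by cancellation
    from 0 + 0 = 0.\<close>
  have "\<psi> \<zero>\<^bsub>mpoly R\<^esub> \<oplus>\<^bsub>S\<^esub> \<psi> \<zero>\<^bsub>mpoly R\<^esub> = \<psi> \<zero>\<^bsub>mpoly R\<^esub>"
    using add[of "\<zero>\<^bsub>mpoly R\<^esub>" "\<zero>\<^bsub>mpoly R\<^esub>"] by simp
  then have "\<psi> \<zero>\<^bsub>mpoly R\<^esub> = \<zero>\<^bsub>S\<^esub>"
    by (metis S.add.l_cancel_one closed M.zero_closed)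
  then have \<psi>_zero: "\<psi> (\<lambda>t. \<zero>) = \<zero>\<^bsub>S\<^esub>" by (simp add: mpoly_simps)
  have 1: "\<psi> (monom R a s \<otimes>\<^bsub>mpoly R\<^esub> g) = \<psi> (monom R a s) \<otimes>\<^bsub>S\<^esub> \<psi> g"
    if "g \<in> carrier (mpoly R)" "a \<in> carrier R" for a s g
    using that(1)
  proof (induction rule: mpoly_induct)
    case zero
    then show ?case using that \<psi>_zero by (simp add: mpoly_mult_zero closed)
  next
    case (add b u f)
    then show ?case
      using that by (simp add: mpoly_r_distr assms(3) S.r_distr closed mpoly_mult_closed monom_mult_monom mult)
  qed
  have 2: "\<psi> (f \<otimes>\<^bsub>mpoly R\<^esub> g) = \<psi> f \<otimes>\<^bsub>S\<^esub> \<psi> g"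
    if "f \<in> carrier (mpoly R)" "g \<in> carrier (mpoly R)" for f g
    using that(1)
  proof (induction rule: mpoly_induct)
    case zero
    then show ?case using that \<psi>_zero by (simp add: mpoly_mult_zero closed)
  next
    case (add b u f)
    then show ?case
      using that by (simp add: mpoly_l_distr assms(3) S.l_distr closed mpoly_mult_closed 1)
  qed
  show ?thesis
    using closed add 2 one by (intro ring_hom_memI) (auto simp: mpoly_simps const_eq_monom)
qed

end

section \<open>Residue fields\<close>

text \<open>The operations of \<open>Frac\<close> take the image of the set of all results over all
  representatives. Such an image is a single class as soon as the results are all equivalent to one
  of them, which is exactly well-definedness.\<close>

lemma Image_equiv_class:
  assumes "equiv A r" "x \<in> S" "\<And>y. y \<in> S \<Longrightarrow> (x, y) \<in> r"
  shows "r `` S = r `` {x}"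
proof -
  have "r `` {y} = r `` {x}" if "y \<in> S" for y
    using equiv_class_eq[OF assms(1) assms(3)[OF that]] by simp
  then show ?thesis using assms(2) by blast
qed

context domain
begin

abbreviation "fraction a b \<equiv> frac_rel R `` {(a, b)}"

lemma frac_rel_equiv: "equiv (carrier R \<times> (carrier R - {\<zero>})) (frac_rel R)"
proof (rule equivI)
  show "trans (frac_rel R)"
  proof (rule transI, clarsimp simp: frac_rel_def)
    fix a b c d e f
    assume *: "a \<in> carrier R" "b \<in> carrier R" "c \<in> carrier R" "d \<in> carrier R" "d \<noteq> \<zero>"
      "e \<in> carrier R" "f \<in> carrier R" "a \<otimes> d = c \<otimes> b" "c \<otimes> f = e \<otimes> d"
    \<comment> \<open>The identity is proved after multiplication by the middle denominator
      \<open>d\<close>; cancelling it afterwards is where integrality enters.\<close>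
    have "(a \<otimes> f) \<otimes> d = (a \<otimes> d) \<otimes> f" using *(1-7) by (simp add: m_ac)
    also have "\<dots> = (c \<otimes> f) \<otimes> b" unfolding *(8) using *(1-7) by (simp add: m_ac)
    also have "\<dots> = (e \<otimes> b) \<otimes> d" unfolding *(9) using *(1-7) by (simp add: m_ac)
    finally show "a \<otimes> f = e \<otimes> b" using * by (simp add: m_rcancel)
  qed
qed (auto simp: frac_rel_def refl_on_def sym_def)

lemma frac_eq_iff:
  assumes "a \<in> carrier R" "b \<in> carrier R" "b \<noteq> \<zero>" "c \<in> carrier R" "d \<in> carrier R" "d \<noteq> \<zero>"
  shows "fraction a b = fraction c d \<longleftrightarrow> a \<otimes> d = c \<otimes> b"
  using eq_equiv_class_iff[OF frac_rel_equiv, of "(a, b)" "(c, d)"] assms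
  by (auto simp: frac_rel_def)

lemma in_frac_iff: "(a', b') \<in> fraction a b \<longleftrightarrow> ((a, b), (a', b')) \<in> frac_rel R"
  by auto

lemma frac_mult:
  assumes *: "a \<in> carrier R" "b \<in> carrier R" "b \<noteq> \<zero>" "c \<in> carrier R" "d \<in> carrier R" "d \<noteq> \<zero>"
  shows "fraction a b \<otimes>\<^bsub>Frac R\<^esub> fraction c d = fraction (a \<otimes> c) (b \<otimes> d)"
proof -
  have "fraction a b \<otimes>\<^bsub>Frac R\<^esub> fraction c d =
    frac_rel R `` {(a' \<otimes> c', b' \<otimes> d') | a' b' c' d'. (a', b') \<in> fraction a b \<and> (c', d') \<in> fraction c d}"
    by (simp add: Frac_def)
  also have "\<dots> = fraction (a \<otimes> c) (b \<otimes> d)"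
  proof (rule Image_equiv_class[OF frac_rel_equiv])
    show "(a \<otimes> c, b \<otimes> d) \<in> {(a' \<otimes> c', b' \<otimes> d') | a' b' c' d'. (a', b') \<in> fraction a b \<and> (c', d') \<in> fraction c d}"
      using * unfolding in_frac_iff by (auto simp: frac_rel_def)
  next
    fix y assume "y \<in> {(a' \<otimes> c', b' \<otimes> d') | a' b' c' d'. (a', b') \<in> fraction a b \<and> (c', d') \<in> fraction c d}"
    then obtain a' b' c' d' where y: "y = (a' \<otimes> c', b' \<otimes> d')"
      and **: "a' \<in> carrier R" "b' \<in> carrier R" "b' \<noteq> \<zero>" "c' \<in> carrier R" "d' \<in> carrier R" "d' \<noteq> \<zero>"
      "a \<otimes> b' = a' \<otimes> b" "c \<otimes> d' = c' \<otimes> d"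
      unfolding in_frac_iff by (auto simp: frac_rel_def)
    have "(a \<otimes> c) \<otimes> (b' \<otimes> d') = (a \<otimes> b') \<otimes> (c \<otimes> d')" using * **(1-6) by (simp add: m_ac)
    also have "\<dots> = (a' \<otimes> c') \<otimes> (b \<otimes> d)" unfolding **(7,8) using * **(1-6) by (simp add: m_ac)
    finally show "((a \<otimes> c, b \<otimes> d), y) \<in> frac_rel R"
      using * ** y by (auto simp: frac_rel_def integral_iff)
  qed
  finally show ?thesis .
qed

lemma frac_add:
  assumes *: "a \<in> carrier R" "b \<in> carrier R" "b \<noteq> \<zero>" "c \<in> carrier R" "d \<in> carrier R" "d \<noteq> \<zero>"
  shows "fraction a b \<oplus>\<^bsub>Frac R\<^esub> fraction c d = fraction (a \<otimes> d \<oplus> c \<otimes> b) (b \<otimes> d)"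
proof -
  have "fraction a b \<oplus>\<^bsub>Frac R\<^esub> fraction c d =
    frac_rel R `` {(a' \<otimes> d' \<oplus> c' \<otimes> b', b' \<otimes> d') | a' b' c' d'. (a', b') \<in> fraction a b \<and> (c', d') \<in> fraction c d}"
    by (simp add: Frac_def)
  also have "\<dots> = fraction (a \<otimes> d \<oplus> c \<otimes> b) (b \<otimes> d)"
  proof (rule Image_equiv_class[OF frac_rel_equiv])
    show "(a \<otimes> d \<oplus> c \<otimes> b, b \<otimes> d) \<in> {(a' \<otimes> d' \<oplus> c' \<otimes> b', b' \<otimes> d') | a' b' c' d'. (a', b') \<in> fraction a b \<and> (c', d') \<in> fraction c d}"
      using * unfolding in_frac_iff by (auto simp: frac_rel_def)
  next
    fix y assume "y \<in> {(a' \<otimes> d' \<oplus> c' \<otimes> b', b' \<otimes> d') | a' b' c' d'. (a', b') \<in> fraction a b \<and> (c', d') \<in> fraction c d}"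
    then obtain a' b' c' d' where y: "y = (a' \<otimes> d' \<oplus> c' \<otimes> b', b' \<otimes> d')"
      and **: "a' \<in> carrier R" "b' \<in> carrier R" "b' \<noteq> \<zero>" "c' \<in> carrier R" "d' \<in> carrier R" "d' \<noteq> \<zero>"
      "a \<otimes> b' = a' \<otimes> b" "c \<otimes> d' = c' \<otimes> d"
      unfolding in_frac_iff by (auto simp: frac_rel_def)
    \<comment> \<open>The terms are grouped so that the products \<open>a \<otimes> b'\<close> and
      \<open>c \<otimes> d'\<close> appear as such and the two equivalences can be
      substituted.\<close>
    have "(a \<otimes> d \<oplus> c \<otimes> b) \<otimes> (b' \<otimes> d') = (a \<otimes> b') \<otimes> (d \<otimes> d') \<oplus> (c \<otimes> d') \<otimes> (b \<otimes> b')"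
      using * **(1-6) by (simp add: l_distr r_distr m_ac a_ac)
    also have "\<dots> = (a' \<otimes> d' \<oplus> c' \<otimes> b') \<otimes> (b \<otimes> d)"
      unfolding **(7,8) using * **(1-6) by (simp add: l_distr r_distr m_ac a_ac)
    finally show "((a \<otimes> d \<oplus> c \<otimes> b, b \<otimes> d), y) \<in> frac_rel R"
      using * ** y by (auto simp: frac_rel_def integral_iff)
  qed
  finally show ?thesis .
qed

lemma frac_closed:
  assumes "a \<in> carrier R" "b \<in> carrier R" "b \<noteq> \<zero>"
  shows "fraction a b \<in> carrier (Frac R)"
  using assms by (auto simp: Frac_def intro!: quotientI)

lemma frac_cases:
  assumes "X \<in> carrier (Frac R)"
  obtains a b where "a \<in> carrier R" "b \<in> carrier R" "b \<noteq> \<zero>" "X = fraction a b"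
  using assms by (auto simp: Frac_def quotient_def)

lemma Frac_zero_one: "\<zero>\<^bsub>Frac R\<^esub> = fraction \<zero> \<one>" "\<one>\<^bsub>Frac R\<^esub> = fraction \<one> \<one>"
  by (simp_all add: Frac_def)

lemma Frac_cring: "cring (Frac R)"
proof (rule cringI)
  show "abelian_group (Frac R)"
  proof (rule abelian_groupI)
    fix X Y assume "X \<in> carrier (Frac R)" "Y \<in> carrier (Frac R)"
    then obtain a b c d where *: "a \<in> carrier R" "b \<in> carrier R" "b \<noteq> \<zero>" "X = fraction a b"
      "c \<in> carrier R" "d \<in> carrier R" "d \<noteq> \<zero>" "Y = fraction c d"
      by (elim frac_cases)
    show "X \<oplus>\<^bsub>Frac R\<^esub> Y \<in> carrier (Frac R)"
      using * by (simp add: frac_add frac_closed integral_iff)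
    show "X \<oplus>\<^bsub>Frac R\<^esub> Y = Y \<oplus>\<^bsub>Frac R\<^esub> X"
      using * by (simp add: frac_add m_comm a_comm)
    fix Z assume "Z \<in> carrier (Frac R)"
    then obtain e f where **: "e \<in> carrier R" "f \<in> carrier R" "f \<noteq> \<zero>" "Z = fraction e f"
      by (elim frac_cases)
    have "(a \<otimes> d \<oplus> c \<otimes> b) \<otimes> f \<oplus> e \<otimes> (b \<otimes> d) = a \<otimes> (d \<otimes> f) \<oplus> (c \<otimes> f \<oplus> e \<otimes> d) \<otimes> b"
      using *(1-3,5-7) **(1-3) by (simp add: l_distr r_distr m_ac a_ac)
    then show "X \<oplus>\<^bsub>Frac R\<^esub> Y \<oplus>\<^bsub>Frac R\<^esub> Z = X \<oplus>\<^bsub>Frac R\<^esub> (Y \<oplus>\<^bsub>Frac R\<^esub> Z)"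
      using * ** by (simp add: frac_add integral_iff m_assoc)
  next
    show "\<zero>\<^bsub>Frac R\<^esub> \<in> carrier (Frac R)" by (simp add: Frac_zero_one frac_closed)
    fix X assume "X \<in> carrier (Frac R)"
    then obtain a b where *: "a \<in> carrier R" "b \<in> carrier R" "b \<noteq> \<zero>" "X = fraction a b"
      by (elim frac_cases)
    show "\<zero>\<^bsub>Frac R\<^esub> \<oplus>\<^bsub>Frac R\<^esub> X = X"
      using * by (simp add: Frac_zero_one frac_add)
    have "fraction (\<ominus> a) b \<oplus>\<^bsub>Frac R\<^esub> X = fraction ((\<ominus> a) \<otimes> b \<oplus> a \<otimes> b) (b \<otimes> b)"
      using * by (simp add: frac_add)
    also have "\<dots> = \<zero>\<^bsub>Frac R\<^esub>"
      using * by (simp add: Frac_zero_one frac_eq_iff integral_iff l_minus l_neg)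
    finally show "\<exists>Y\<in>carrier (Frac R). Y \<oplus>\<^bsub>Frac R\<^esub> X = \<zero>\<^bsub>Frac R\<^esub>"
      using * by (intro bexI[of _ "fraction (\<ominus> a) b"]) (auto simp: frac_closed)
  qed
  show "comm_monoid (Frac R)"
  proof (rule comm_monoidI)
    fix X Y assume "X \<in> carrier (Frac R)" "Y \<in> carrier (Frac R)"
    then obtain a b c d where *: "a \<in> carrier R" "b \<in> carrier R" "b \<noteq> \<zero>" "X = fraction a b"
      "c \<in> carrier R" "d \<in> carrier R" "d \<noteq> \<zero>" "Y = fraction c d"
      by (elim frac_cases)
    show "X \<otimes>\<^bsub>Frac R\<^esub> Y \<in> carrier (Frac R)"
      using * by (simp add: frac_mult frac_closed integral_iff)
    show "X \<otimes>\<^bsub>Frac R\<^esub> Y = Y \<otimes>\<^bsub>Frac R\<^esub> X"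
      using * by (simp add: frac_mult m_comm)
    fix Z assume "Z \<in> carrier (Frac R)"
    then obtain e f where **: "e \<in> carrier R" "f \<in> carrier R" "f \<noteq> \<zero>" "Z = fraction e f"
      by (elim frac_cases)
    show "X \<otimes>\<^bsub>Frac R\<^esub> Y \<otimes>\<^bsub>Frac R\<^esub> Z = X \<otimes>\<^bsub>Frac R\<^esub> (Y \<otimes>\<^bsub>Frac R\<^esub> Z)"
      using * ** by (simp add: frac_mult integral_iff m_assoc)
  next
    show "\<one>\<^bsub>Frac R\<^esub> \<in> carrier (Frac R)" by (simp add: Frac_zero_one frac_closed)
    fix X assume "X \<in> carrier (Frac R)"
    then show "\<one>\<^bsub>Frac R\<^esub> \<otimes>\<^bsub>Frac R\<^esub> X = X"
      by (elim frac_cases) (simp add: Frac_zero_one frac_mult)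
  qed
  fix X Y Z assume "X \<in> carrier (Frac R)" "Y \<in> carrier (Frac R)" "Z \<in> carrier (Frac R)"
  then obtain a b c d e f where *: "a \<in> carrier R" "b \<in> carrier R" "b \<noteq> \<zero>" "X = fraction a b"
      "c \<in> carrier R" "d \<in> carrier R" "d \<noteq> \<zero>" "Y = fraction c d"
      "e \<in> carrier R" "f \<in> carrier R" "f \<noteq> \<zero>" "Z = fraction e f"
    by (elim frac_cases)
  let ?x = "a \<otimes> d \<oplus> c \<otimes> b"
  have x: "?x \<in> carrier R" using * by simp
  \<comment> \<open>The two sides of distributivity have different denominators, b d f and (b f)(d
    f), so the numerators cannot simply be compared; the cross-multiplied identity is prepared
    instead.\<close>
  have "a \<otimes> e \<otimes> (d \<otimes> f) \<oplus> c \<otimes> e \<otimes> (b \<otimes> f) = ?x \<otimes> (e \<otimes> f)"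
    using *(1-3,5-7,9,10) by (simp add: l_distr r_distr m_ac a_ac)
  moreover have "?x \<otimes> (e \<otimes> f) \<otimes> (b \<otimes> d \<otimes> f) = (?x \<otimes> e) \<otimes> (b \<otimes> f \<otimes> (d \<otimes> f))"
    using *(1-3,5-7,9,10) x by (simp add: m_ac)
  ultimately have "?x \<otimes> e \<otimes> (b \<otimes> f \<otimes> (d \<otimes> f)) =
    (a \<otimes> e \<otimes> (d \<otimes> f) \<oplus> c \<otimes> e \<otimes> (b \<otimes> f)) \<otimes> (b \<otimes> d \<otimes> f)"
    by simp
  then show "(X \<oplus>\<^bsub>Frac R\<^esub> Y) \<otimes>\<^bsub>Frac R\<^esub> Z = X \<otimes>\<^bsub>Frac R\<^esub> Z \<oplus>\<^bsub>Frac R\<^esub> Y \<otimes>\<^bsub>Frac R\<^esub> Z"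
    using * by (simp add: frac_mult frac_add integral_iff frac_eq_iff)
qed

lemma frac_one_hom: "(\<lambda>a. fraction a \<one>) \<in> ring_hom R (Frac R)"
  by (rule ring_hom_memI) (auto simp: frac_closed frac_mult frac_add Frac_zero_one)

end

context primeideal
begin

lemma residue_field_cring: "cring (residue_field R I)"
  unfolding residue_field_def by (rule domain.Frac_cring) (rule quotient_is_domain)

lemma residue_hom: "residue R I \<in> ring_hom R (residue_field R I)"
proof -
  interpret D: domain "R Quot I" by (rule quotient_is_domain)
  have "residue R I = (\<lambda>a. D.fraction a \<one>\<^bsub>R Quot I\<^esub>) \<circ> ((+>) I)"
    by (auto simp: residue_def)
  then show ?thesis
    unfolding residue_field_def using ring_hom_trans[OF rcos_ring_hom D.frac_one_hom] by metis
qed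

lemma rcos_eq_zero_iff:
  assumes "c \<in> carrier R"
  shows "I +> c = \<zero>\<^bsub>R Quot I\<^esub> \<longleftrightarrow> c \<in> I"
  using assms rcos_const_imp_mem a_rcos_zero[OF is_ideal] by (auto simp: FactRing_def)

lemma residue_eq_zero_iff:
  assumes "c \<in> carrier R"
  shows "residue R I c = \<zero>\<^bsub>residue_field R I\<^esub> \<longleftrightarrow> c \<in> I"
proof -
  interpret D: domain "R Quot I" by (rule quotient_is_domain)
  have "I +> c \<in> carrier (R Quot I)" using assms by (auto simp: FactRing_def A_RCOSETS_def')
  then show ?thesis
    using assms by (simp add: residue_def residue_field_def D.Frac_zero_one D.frac_eq_iff rcos_eq_zero_iff)
qed

text \<open>A fraction is presented by the equation b X = a over the residue field rather than as a
  quotient of cosets, so that denominators can be cleared by multiplication alone.\<close>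

lemma residue_field_cases:
  assumes "X \<in> carrier (residue_field R I)"
  obtains a b where "a \<in> carrier R" "b \<in> carrier R" "b \<notin> I"
    "residue R I b \<otimes>\<^bsub>residue_field R I\<^esub> X = residue R I a"
proof -
  interpret D: domain "R Quot I" by (rule quotient_is_domain)
  have *: "\<exists>a\<in>carrier R. Y = I +> a" if "Y \<in> carrier (R Quot I)" for Y
    using that by (auto simp: FactRing_def A_RCOSETS_def')
  obtain a b where ab: "a \<in> carrier (R Quot I)" "b \<in> carrier (R Quot I)" "b \<noteq> \<zero>\<^bsub>R Quot I\<^esub>"
    and X: "X = D.fraction a b"
    using assms unfolding residue_field_def by (elim D.frac_cases)
  obtain a' where a': "a' \<in> carrier R" "a = I +> a'" using *[OF ab(1)] by blast
  obtain b' where b': "b' \<in> carrier R" "b = I +> b'" using *[OF ab(2)] by blast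
  have "D.fraction b \<one>\<^bsub>R Quot I\<^esub> \<otimes>\<^bsub>Frac (R Quot I)\<^esub> D.fraction a b = D.fraction (b \<otimes>\<^bsub>R Quot I\<^esub> a) (\<one>\<^bsub>R Quot I\<^esub> \<otimes>\<^bsub>R Quot I\<^esub> b)"
    using ab by (intro D.frac_mult) simp_all
  also have "\<dots> = D.fraction a \<one>\<^bsub>R Quot I\<^esub>"
    using ab by (subst D.frac_eq_iff) (simp_all add: D.m_comm[of b a])
  finally have "residue R I b' \<otimes>\<^bsub>residue_field R I\<^esub> X = residue R I a'"
    unfolding residue_def residue_field_def X a'(2)[symmetric] b'(2)[symmetric] .
  moreover have "b' \<notin> I" using rcos_eq_zero_iff[of b'] b' ab(3) by metis
  ultimately show thesis using a'(1) b'(1) that by metis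
qed

text \<open>The inverse is the fraction 1/b. Both the multipliers of pseudo-division and the cleared
  denominators lie outside the prime, hence become invertible after specialization.\<close>

lemma residue_Unit:
  assumes "b \<in> carrier R" "b \<notin> I"
  shows "residue R I b \<in> Units (residue_field R I)"
proof -
  interpret D: domain "R Quot I" by (rule quotient_is_domain)
  interpret F: cring "residue_field R I" by (rule residue_field_cring)
  let ?b = "I +> b"
  have *: "?b \<in> carrier (R Quot I)" "?b \<noteq> \<zero>\<^bsub>R Quot I\<^esub>"
    using assms by (auto simp: FactRing_def A_RCOSETS_def' rcos_eq_zero_iff[unfolded FactRing_def, simplified])
  have c: "D.fraction \<one>\<^bsub>R Quot I\<^esub> ?b \<in> carrier (residue_field R I)" "residue R I b \<in> carrier (residue_field R I)"
    using * D.frac_closed by (simp_all add: residue_field_def residue_def)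
  have "D.fraction \<one>\<^bsub>R Quot I\<^esub> ?b \<otimes>\<^bsub>residue_field R I\<^esub> residue R I b = \<one>\<^bsub>residue_field R I\<^esub>"
    using * by (simp add: residue_field_def residue_def D.frac_mult D.Frac_zero_one D.frac_eq_iff)
  then show ?thesis using c F.m_comm[OF c] unfolding Units_def by (intro CollectI conjI bexI[OF _ c(1)]) simp_all
qed

end

section \<open>Homomorphisms between polynomial rings\<close>

lemma map_coeff_hom:
  assumes "cring R" "cring S" "\<phi> \<in> ring_hom R S"
  shows "(\<lambda>(f :: 't::comm_monoid_add \<Rightarrow> 'a) t. \<phi> (f t)) \<in> ring_hom (mpoly R) (mpoly S)"
proof -
  interpret R: cring R by fact
  interpret S: cring S by fact
  interpret h: ring_hom_cring R S \<phi>
    using assms by unfold_locales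
  have monom: "(\<lambda>t. \<phi> (monom R a s t)) = monom S (\<phi> a) s" for a and s :: 't
    by (auto simp: monom_def)
  show ?thesis
  proof (rule R.mpoly_ring_homI)
    fix f :: "'t \<Rightarrow> 'a" assume "f \<in> carrier (mpoly R)"
    then show "(\<lambda>t. \<phi> (f t)) \<in> carrier (mpoly S)"
      by (intro mpoly_carrierI[of _ _ "supp R f"]) (auto simp: finite_supp coeff_closed in_supp_iff)
  next
    fix f g :: "'t \<Rightarrow> 'a" assume "f \<in> carrier (mpoly R)" "g \<in> carrier (mpoly R)"
    then show "(\<lambda>t. \<phi> ((f \<oplus>\<^bsub>mpoly R\<^esub> g) t)) = (\<lambda>t. \<phi> (f t)) \<oplus>\<^bsub>mpoly S\<^esub> (\<lambda>t. \<phi> (g t))"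
      by (simp add: mpoly_simps coeff_closed)
  qed (auto simp: monom S.monom_mult_monom S.mpoly_cring, simp add: mpoly_simps const_eq_monom)
qed

section \<open>The substitution z = 1\<close>

lemma dehomogenize_eq:
  assumes "cring R" "f \<in> carrier (mpoly R)" "finite S" "{k. (\<alpha>, k) \<in> supp R f} \<subseteq> S"
  shows "dehomogenize R f \<alpha> = (\<Oplus>\<^bsub>R\<^esub>k\<in>S. f (\<alpha>, k))"
proof -
  interpret R: cring R by fact
  show ?thesis
    unfolding dehomogenize_def using assms
    by (intro R.add.finprod_mono_neutral_cong_left) (auto simp: in_supp_iff coeff_closed)
qed

lemma dehomogenize_monom:
  assumes "cring R" "c \<in> carrier R"
  shows "dehomogenize R (monom R c (\<alpha>, k)) = monom R c \<alpha>"
proof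
  interpret R: cring R by fact
  fix \<beta> show "dehomogenize R (monom R c (\<alpha>, k)) \<beta> = monom R c \<alpha> \<beta>"
  proof -
    have "{j. (\<beta>, j) \<in> supp R (monom R c (\<alpha>, k))} \<subseteq> {k}"
      by (auto simp: in_supp_iff monom_def split: if_splits)
    then have "dehomogenize R (monom R c (\<alpha>, k)) \<beta> = (\<Oplus>\<^bsub>R\<^esub>j\<in>{k}. monom R c (\<alpha>, k) (\<beta>, j))"
      using assms by (intro dehomogenize_eq) simp_all
    also have "\<dots> = monom R c \<alpha> \<beta>" using assms(2) by (simp add: monom_def)
    finally show ?thesis .
  qed
qed

lemma dehomogenize_hom:
  assumes "cring R"
  shows "dehomogenize R \<in> ring_hom (mpoly R) (mpoly R)"
proof -
  interpret R: cring R by fact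
  have fin: "finite (snd ` supp R f)" "{k. (\<alpha>, k) \<in> supp R f} \<subseteq> snd ` supp R f"
    if "f \<in> carrier (mpoly R)" for f and \<alpha> :: "nat ^ 'n"
    using that by (auto simp: finite_supp image_iff intro!: bexI[of _ "(\<alpha>, _)"])
  show ?thesis
  proof (rule R.mpoly_ring_homI)
    fix f :: "(nat ^ 'n) \<times> nat \<Rightarrow> 'a" assume f: "f \<in> carrier (mpoly R)"
    show "dehomogenize R f \<in> carrier (mpoly R)"
    proof (rule mpoly_carrierI)
      show "finite (fst ` supp R f)" using f by (simp add: finite_supp)
      show "supp R (dehomogenize R f) \<subseteq> fst ` supp R f"
      proof
        fix \<alpha> assume a: "\<alpha> \<in> supp R (dehomogenize R f)"
        have "\<exists>k. (\<alpha>, k) \<in> supp R f"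
        proof (rule ccontr)
          assume "\<not> ?thesis"
          then have "dehomogenize R f \<alpha> = \<zero>\<^bsub>R\<^esub>"
            by (simp add: dehomogenize_def)
          then show False using a by (simp add: in_supp_iff)
        qed
        then show "\<alpha> \<in> fst ` supp R f" by force
      qed
      show "dehomogenize R f \<alpha> \<in> carrier R" for \<alpha>
        using f by (auto simp: dehomogenize_def coeff_closed intro!: R.finsum_closed)
    qed
  next
    fix f g :: "(nat ^ 'n) \<times> nat \<Rightarrow> 'a" assume fg: "f \<in> carrier (mpoly R)" "g \<in> carrier (mpoly R)"
    show "dehomogenize R (f \<oplus>\<^bsub>mpoly R\<^esub> g) = dehomogenize R f \<oplus>\<^bsub>mpoly R\<^esub> dehomogenize R g"
    proof
      fix \<alpha>
      \<comment> \<open>A set of z-exponents large enough for both summands, hence for their sum,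
        even where terms of \<open>f\<close> and \<open>g\<close> cancel.\<close>
      let ?S = "snd ` supp R f \<union> snd ` supp R g"
      have "supp R (f \<oplus>\<^bsub>mpoly R\<^esub> g) \<subseteq> supp R f \<union> supp R g" by (auto simp: in_supp_iff mpoly_simps)
      then have "{k. (\<alpha>, k) \<in> supp R (f \<oplus>\<^bsub>mpoly R\<^esub> g)} \<subseteq> ?S" using fin fg by blast
      moreover have "finite ?S" using fg by (simp add: finite_supp)
      moreover have "{k. (\<alpha>, k) \<in> supp R f} \<subseteq> ?S" "{k. (\<alpha>, k) \<in> supp R g} \<subseteq> ?S"
        using fin fg by blast+
      ultimately show "dehomogenize R (f \<oplus>\<^bsub>mpoly R\<^esub> g) \<alpha> = (dehomogenize R f \<oplus>\<^bsub>mpoly R\<^esub> dehomogenize R g) \<alpha>"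
        using fg R.mpoly_add_closed[OF fg]
        by (simp add: dehomogenize_eq[OF assms, where S = ?S] mpoly_simps(3) R.finsum_addf coeff_closed)
    qed
  next
    fix a b and s t :: "(nat ^ 'n) \<times> nat" assume "a \<in> carrier R" "b \<in> carrier R"
    then show "dehomogenize R (monom R (a \<otimes>\<^bsub>R\<^esub> b) (s + t)) =
      dehomogenize R (monom R a s) \<otimes>\<^bsub>mpoly R\<^esub> dehomogenize R (monom R b t)"
      by (cases s; cases t) (simp add: dehomogenize_monom assms R.monom_mult_monom)
  qed (simp_all add: R.mpoly_cring zero_prod_def dehomogenize_monom assms mpoly_simps const_eq_monom)
qed

text \<open>In degree \<open>d\<close> the exponent \<alpha> admits only one power of z, so setting
  z = 1 never adds up two coefficients. The case distinction guards against truncated subtraction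
  when the degree of \<alpha> exceeds \<open>d\<close>.\<close>

lemma dehomogenize_homogeneous:
  assumes "cring R" "f \<in> carrier (mpoly R)" "\<And>\<alpha> k. tdeg \<alpha> + k \<noteq> d \<Longrightarrow> f (\<alpha>, k) = \<zero>\<^bsub>R\<^esub>"
  shows "dehomogenize R f \<alpha> = (if tdeg \<alpha> \<le> d then f (\<alpha>, d - tdeg \<alpha>) else \<zero>\<^bsub>R\<^esub>)"
proof -
  interpret R: cring R by fact
  have "{k. (\<alpha>, k) \<in> supp R f} \<subseteq> (if tdeg \<alpha> \<le> d then {d - tdeg \<alpha>} else {})"
  proof
    fix k assume "k \<in> {k. (\<alpha>, k) \<in> supp R f}"
    then have "tdeg \<alpha> + k = d" using assms(3)[of \<alpha> k] by (auto simp: in_supp_iff)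
    then show "k \<in> (if tdeg \<alpha> \<le> d then {d - tdeg \<alpha>} else {})" by auto
  qed
  then have "dehomogenize R f \<alpha> = (\<Oplus>\<^bsub>R\<^esub>k\<in>(if tdeg \<alpha> \<le> d then {d - tdeg \<alpha>} else {}). f (\<alpha>, k))"
    using assms by (intro dehomogenize_eq) auto
  then show ?thesis using assms(2) by (simp add: coeff_closed)
qed

section \<open>Passage between k[a][x,z] and k[a,x,z]\<close>

lemma flatten_carrier:
  assumes "cring R" "f \<in> carrier (mpoly (mpoly R))"
  shows "flatten f \<in> carrier (mpoly R)"
proof (rule mpoly_carrierI)
  show "finite (Sigma (supp (mpoly R) f) (\<lambda>t. supp R (f t)))"
    using assms by (auto intro!: finite_SigmaI finite_supp intro: coeff_closed)
  show "supp R (flatten f) \<subseteq> Sigma (supp (mpoly R) f) (\<lambda>t. supp R (f t))"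
    by (auto simp: in_supp_iff flatten_def mpoly_simps)
  show "flatten f t \<in> carrier R" for t
    using coeff_closed[OF coeff_closed[OF assms(2)]] by (cases t) (auto simp: flatten_def)
qed

lemma flatten_monom: "flatten (monom (mpoly R) a s) = (\<lambda>(t, u). if t = s then a u else \<zero>\<^bsub>R\<^esub>)"
  by (auto simp: flatten_def monom_def mpoly_simps)

lemma flatten_monom_monom: "flatten (monom (mpoly R) (monom R c u) s) = monom R c (s, u)"
  unfolding flatten_monom by (auto simp: monom_def fun_eq_iff)

lemma flatten_add: "flatten (f \<oplus>\<^bsub>mpoly (mpoly R)\<^esub> g) = flatten f \<oplus>\<^bsub>mpoly R\<^esub> flatten g"
  by (auto simp: flatten_def mpoly_simps)

text \<open>A nested convolution has to match a single one. Monomials of the outer ring still have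
  arbitrary polynomials as coefficients, so multiplicativity on them is itself proved by induction
  on these coefficients: the left one is first a monomial, with induction on the right one, and is
  then built up in turn.\<close>

lemma flatten_hom:
  assumes "cring R"
  shows "flatten \<in> ring_hom (mpoly (mpoly R) :: ('t::comm_monoid_add \<Rightarrow> 's::comm_monoid_add \<Rightarrow> 'a) ring) (mpoly R)"
proof -
  interpret R: cring R by fact
  interpret A: cring "mpoly R :: ('s \<Rightarrow> 'a) ring" by (rule R.mpoly_cring)
  have flatten_zero: "flatten (monom (mpoly R) (\<lambda>t. \<zero>\<^bsub>R\<^esub>) s) = (\<lambda>t. \<zero>\<^bsub>R\<^esub>)" for s :: 't
    by (auto simp: flatten_monom)
  have monom_add: "monom (mpoly R) (a \<oplus>\<^bsub>mpoly R\<^esub> b) s =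
    monom (mpoly R) a s \<oplus>\<^bsub>mpoly (mpoly R)\<^esub> monom (mpoly R) b s"
    if "a \<in> carrier (mpoly R)" "b \<in> carrier (mpoly R)" for a b :: "'s \<Rightarrow> 'a" and s :: 't
    by (auto simp: mpoly_simps(3)[of "mpoly R"] monom_def)
  have 1: "flatten (monom (mpoly R) (monom R c u \<otimes>\<^bsub>mpoly R\<^esub> b) (s + t)) =
      flatten (monom (mpoly R) (monom R c u) s) \<otimes>\<^bsub>mpoly R\<^esub> flatten (monom (mpoly R) b t)"
    if "b \<in> carrier (mpoly R)" "c \<in> carrier R" for c u and b :: "'s \<Rightarrow> 'a" and s t :: 't
    using that(1)
  proof (induction rule: R.mpoly_induct)
    case zero
    then show ?case using that by (simp add: R.mpoly_mult_zero flatten_zero flatten_monom_monom)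
  next
    case (add c' v f)
    have cl: "flatten (monom (mpoly R) f t) \<in> carrier (mpoly R)"
      using add by (simp add: flatten_carrier assms)
    show ?case using that add cl
      by (simp add: R.mpoly_r_distr R.monom_mult_monom monom_add R.mpoly_mult_closed flatten_add flatten_monom_monom)
  qed
  have 2: "flatten (monom (mpoly R) (a \<otimes>\<^bsub>mpoly R\<^esub> b) (s + t)) =
      flatten (monom (mpoly R) a s) \<otimes>\<^bsub>mpoly R\<^esub> flatten (monom (mpoly R) b t)"
    if "a \<in> carrier (mpoly R)" "b \<in> carrier (mpoly R)" for a b :: "'s \<Rightarrow> 'a" and s t :: 't
    using that(1)
  proof (induction rule: R.mpoly_induct)
    case zero
    have cl: "flatten (monom (mpoly R) b t) \<in> carrier (mpoly R)"
      using that by (simp add: flatten_carrier assms)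
    show ?case using that cl by (simp add: R.mpoly_mult_zero flatten_zero)
  next
    case (add c' v f)
    have cl: "flatten (monom (mpoly R) f s) \<in> carrier (mpoly R)" "flatten (monom (mpoly R) b t) \<in> carrier (mpoly R)"
      using that add by (simp_all add: flatten_carrier assms)
    have "(monom R c' v \<oplus>\<^bsub>mpoly R\<^esub> f) \<otimes>\<^bsub>mpoly R\<^esub> b = monom R c' v \<otimes>\<^bsub>mpoly R\<^esub> b \<oplus>\<^bsub>mpoly R\<^esub> f \<otimes>\<^bsub>mpoly R\<^esub> b"
      using that add by (simp add: R.mpoly_l_distr)
    then have "flatten (monom (mpoly R) ((monom R c' v \<oplus>\<^bsub>mpoly R\<^esub> f) \<otimes>\<^bsub>mpoly R\<^esub> b) (s + t)) =
      flatten (monom (mpoly R) (monom R c' v \<otimes>\<^bsub>mpoly R\<^esub> b) (s + t)) \<oplus>\<^bsub>mpoly R\<^esub> flatten (monom (mpoly R) (f \<otimes>\<^bsub>mpoly R\<^esub> b) (s + t))"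
      using that add by (simp add: monom_add R.mpoly_mult_closed flatten_add)
    also have "\<dots> = (flatten (monom (mpoly R) (monom R c' v) s) \<oplus>\<^bsub>mpoly R\<^esub> flatten (monom (mpoly R) f s)) \<otimes>\<^bsub>mpoly R\<^esub> flatten (monom (mpoly R) b t)"
      using that add cl by (simp add: 1 R.mpoly_l_distr flatten_monom_monom)
    finally show ?case
      using that add by (simp add: monom_add flatten_add)
  qed
  show ?thesis
    using 2 by (intro A.mpoly_ring_homI R.mpoly_cring)
     (auto simp: flatten_carrier assms flatten_add, auto simp: mpoly_simps const_eq_monom flatten_monom_monom zero_prod_def)
qed

text \<open>Currying inverts flattening. It brings the quotients of a standard representation over
  K[a,x,z] back to k[a][x,z].\<close>

lemma curry_carrier:
  assumes "F \<in> carrier (mpoly R)"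
  shows "curry F \<in> carrier (mpoly (mpoly R))"
proof (rule mpoly_carrierI)
  show "finite (fst ` supp R F)" using assms by (simp add: finite_supp)
  show "supp (mpoly R) (curry F) \<subseteq> fst ` supp R F"
  proof
    fix t assume "t \<in> supp (mpoly R) (curry F)"
    then obtain u where "F (t, u) \<noteq> \<zero>\<^bsub>R\<^esub>" by (auto simp: in_supp_iff mpoly_simps fun_eq_iff)
    then show "t \<in> fst ` supp R F" by (force simp: in_supp_iff)
  qed
  show "curry F t \<in> carrier (mpoly R)" for t
    using assms
    by (intro mpoly_carrierI[of _ _ "snd ` supp R F"]) (force simp: finite_supp coeff_closed in_supp_iff)+
qed

lemma flatten_curry [simp]: "flatten (curry F) = F" and curry_flatten [simp]: "curry (flatten f) = f"
  by (auto simp: flatten_def)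

lemma inj_flatten: "inj flatten"
  by (metis injI curry_flatten)

section \<open>Leading exponents\<close>

lemma finite_maximum_exists:
  assumes "transp lt" "totalp lt" "finite S" "S \<noteq> {}"
  shows "\<exists>t\<in>S. \<forall>s\<in>S. lt s t \<or> s = t"
  using assms(3,4)
proof (induction S rule: finite_ne_induct)
  case (insert x F)
  then obtain t where t: "t \<in> F" "\<forall>s\<in>F. lt s t \<or> s = t" by blast
  show ?case
  proof (cases "lt t x")
    case True
    then show ?thesis using t assms(1) by (metis insert_iff transpD)
  next
    case False
    then show ?thesis using t assms(2) by (metis insert_iff totalpD)
  qed
qed auto

lemma lexp_eqI:
  assumes "monomial_order lt" "t \<in> supp R f" "\<And>s. s \<in> supp R f \<Longrightarrow> lt s t \<or> s = t"
  shows "lexp R lt f = t"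
  unfolding lexp_def
proof (rule the_equality)
  fix u assume "u \<in> supp R f \<and> (\<forall>s\<in>supp R f. lt s u \<or> s = u)"
  then show "u = t"
    using assms by (metis monomial_order_def transpD irreflpD)
qed (use assms in auto)

lemma lexp_in_supp_max:
  assumes "monomial_order lt" "finite (supp R f)" "supp R f \<noteq> {}"
  shows "lexp R lt f \<in> supp R f" "\<And>s. s \<in> supp R f \<Longrightarrow> lt s (lexp R lt f) \<or> s = lexp R lt f"
proof -
  obtain t where t: "t \<in> supp R f" "\<forall>s\<in>supp R f. lt s t \<or> s = t"
    using assms finite_maximum_exists[of lt] by (metis monomial_order_def)
  then have "lexp R lt f = t" using assms(1) by (intro lexp_eqI) auto
  then show "lexp R lt f \<in> supp R f" "\<And>s. s \<in> supp R f \<Longrightarrow> lt s (lexp R lt f) \<or> s = lexp R lt f"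
    using t by auto
qed

text \<open>Equality of the sums is possible only if both summands attain their bounds; hence the
  top exponent of a product comes from a single pair of exponents.\<close>

lemma monomial_order_add_mono:
  assumes "monomial_order lt" "lt s s' \<or> s = s'" "lt t t' \<or> t = t'"
  shows "lt (s + t) (s' + t') \<or> s = s' \<and> t = t'"
proof -
  have "lt (s + t) (s' + t) \<or> s = s'" using assms unfolding monomial_order_def by blast
  moreover have "lt (s' + t) (s' + t') \<or> t = t'"
    using assms unfolding monomial_order_def by (metis add.commute)
  ultimately show ?thesis using assms(1) unfolding monomial_order_def by (metis transpD)
qed

text \<open>Here \<open>s\<close> and \<open>t\<close> are mere upper bounds of the supports and
  need not occur in them, so the formula holds over any commutative ring; whether the coefficient
  vanishes is left to the place of use.\<close>

lemma (in cring) coeff_mult_max: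
  assumes lt: "monomial_order lt"
    and fg: "f \<in> carrier (mpoly R)" "g \<in> carrier (mpoly R)"
    and s: "\<And>u. u \<in> supp R f \<Longrightarrow> lt u s \<or> u = s"
    and t: "\<And>u. u \<in> supp R g \<Longrightarrow> lt u t \<or> u = t"
  shows "(f \<otimes>\<^bsub>mpoly R\<^esub> g) (s + t) = f s \<otimes> g t"
    and "u \<in> supp R (f \<otimes>\<^bsub>mpoly R\<^esub> g) \<Longrightarrow> lt u (s + t) \<or> u = s + t"
proof -
  \<comment> \<open>The bounds are inserted so that the pair (s, t) belongs to the box even if one
    of the two coefficients is zero.\<close>
  let ?S = "insert s (supp R f)" and ?T = "insert t (supp R g)"
  have *: "\<not> lt x x" for x using lt by (simp add: monomial_order_def irreflpD)
  have "(f \<otimes>\<^bsub>mpoly R\<^esub> g) (s + t) =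
    (\<Oplus>p\<in>?S\<times>?T. if fst p + snd p = s + t then f (fst p) \<otimes> g (snd p) else \<zero>)"
    using fg by (intro mpoly_mult_eq) (auto simp: finite_supp)
  also have "\<dots> = (\<Oplus>p\<in>{(s, t)}. f (fst p) \<otimes> g (snd p))"
  proof (rule add.finprod_mono_neutral_cong_right)
    fix p assume "p \<in> ?S \<times> ?T - {(s, t)}"
    then have "fst p \<in> ?S" "snd p \<in> ?T" "p \<noteq> (s, t)" by auto
    then have "lt (fst p) s \<or> fst p = s" "lt (snd p) t \<or> snd p = t" "p \<noteq> (s, t)"
      using s t by blast+
    then have "lt (fst p + snd p) (s + t)"
      using monomial_order_add_mono[OF lt] by (metis prod.collapse)
    then show "(if fst p + snd p = s + t then f (fst p) \<otimes> g (snd p) else \<zero>) = \<zero>"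
      using * by auto
  qed (use fg in \<open>auto simp: finite_supp coeff_closed\<close>)
  also have "\<dots> = f s \<otimes> g t" using fg by (simp add: coeff_closed)
  finally show "(f \<otimes>\<^bsub>mpoly R\<^esub> g) (s + t) = f s \<otimes> g t" .
next
  assume "u \<in> supp R (f \<otimes>\<^bsub>mpoly R\<^esub> g)"
  then obtain a b where "a \<in> supp R f" "b \<in> supp R g" "u = a + b"
    using supp_mult[OF fg] by blast
  then show "lt u (s + t) \<or> u = s + t"
    using s t monomial_order_add_mono[OF lt] by metis
qed

text \<open>The order is auxiliary: the product of two leading coefficients is a coefficient of the
  product and is nonzero over a domain.\<close>

lemma (in domain) mpoly_domain:
  assumes "monomial_order (lt :: 't::comm_monoid_add \<Rightarrow> 't \<Rightarrow> bool)"
  shows "domain (mpoly R :: ('t \<Rightarrow> 'a) ring)"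
proof -
  interpret M: cring "mpoly R :: ('t \<Rightarrow> 'a) ring" by (rule mpoly_cring)
  show ?thesis
  proof
    show "\<one>\<^bsub>mpoly R\<^esub> \<noteq> (\<zero>\<^bsub>mpoly R\<^esub> :: 't \<Rightarrow> 'a)"
      by (auto simp: mpoly_simps const_def fun_eq_iff intro!: exI[of _ 0])
    fix f g :: "'t \<Rightarrow> 'a"
    assume *: "f \<otimes>\<^bsub>mpoly R\<^esub> g = \<zero>\<^bsub>mpoly R\<^esub>" "f \<in> carrier (mpoly R)" "g \<in> carrier (mpoly R)"
    show "f = \<zero>\<^bsub>mpoly R\<^esub> \<or> g = \<zero>\<^bsub>mpoly R\<^esub>"
    proof (rule ccontr)
      assume "\<not> ?thesis"
      then have ne: "supp R f \<noteq> {}" "supp R g \<noteq> {}"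
        by (auto simp: mpoly_simps supp_def fun_eq_iff)
      note f = lexp_in_supp_max[OF assms finite_supp[OF *(2)] ne(1)]
      note g = lexp_in_supp_max[OF assms finite_supp[OF *(3)] ne(2)]
      have "f (lexp R lt f) \<otimes> g (lexp R lt g) = \<zero>"
        using coeff_mult_max(1)[OF assms *(2,3) f(2) g(2)] *(1) by (simp add: mpoly_simps)
      then show False
        using f(1) g(1) * by (auto simp: in_supp_iff integral_iff coeff_closed)
    qed
  qed
qed

section \<open>Pseudo-division\<close>

text \<open>Standard representations without named quotients: they are built one monomial multiple at a
  time, and \<open>B\<close> bounds the exponents that may occur.\<close>

inductive_set comb :: "('c, 'd) ring_scheme \<Rightarrow> ('t::comm_monoid_add \<Rightarrow> 'c) set \<Rightarrow> 't set \<Rightarrow> ('t \<Rightarrow> 'c) set"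
  for R :: "('c, 'd) ring_scheme" and G :: "('t::comm_monoid_add \<Rightarrow> 'c) set" and B :: "'t set" where
  zero: "(\<lambda>t. \<zero>\<^bsub>R\<^esub>) \<in> comb R G B"
| add: "p \<in> comb R G B \<Longrightarrow> a \<in> carrier R \<Longrightarrow> g \<in> G \<Longrightarrow> \<forall>s\<in>supp R g. u + s \<in> B \<Longrightarrow>
    monom R a u \<otimes>\<^bsub>mpoly R\<^esub> g \<oplus>\<^bsub>mpoly R\<^esub> p \<in> comb R G B"

context cring
begin

text \<open>All coefficients of the multiple are multiples of \<open>a\<close>. This is how a
  reduction step keeps coefficients inside a prime ideal once the eliminated coefficient lies
  there.\<close>

lemma coeff_monom_mult:
  assumes "a \<in> carrier R" "g \<in> carrier (mpoly R)"
  shows "(monom R a u \<otimes>\<^bsub>mpoly R\<^esub> g) t = a \<otimes> (monom R \<one> u \<otimes>\<^bsub>mpoly R\<^esub> g) t"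
proof -
  have "monom R a u = const R a \<otimes>\<^bsub>mpoly R\<^esub> monom R \<one> u"
    using assms by (simp add: const_eq_monom monom_mult_monom)
  then show ?thesis using assms by (simp add: mpoly_mult_assoc coeff_const_mult mpoly_mult_closed)
qed

lemma mpoly_mem_ideal:
  assumes I: "ideal I (mpoly R)" and Q: "const R ` Q \<subseteq> I" "\<zero> \<in> Q"
    and f: "f \<in> carrier (mpoly R)" "range f \<subseteq> Q"
  shows "f \<in> I"
  using f
proof (induction rule: mpoly_induct)
  case zero
  then show ?case using additive_subgroup.zero_closed[OF ideal.axioms(1)[OF I]] by (simp add: mpoly_simps)
next
  case (add c s f)
  have *: "(monom R c s \<oplus>\<^bsub>mpoly R\<^esub> f) t = (if t = s then c else f t)" for t
    using add by (auto simp: mpoly_simps monom_def coeff_closed)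
  have c: "c \<in> Q" using add.prems *[of s] by (metis range_subsetD)
  have "f t \<in> Q" for t
    using add.prems *[of t] Q(2) add.hyps(3) by (cases "t = s") (metis, metis range_subsetD)
  then have f: "f \<in> I" by (intro add.IH) auto
  have "monom R c s = const R c \<otimes>\<^bsub>mpoly R\<^esub> monom R \<one> s"
    using add by (simp add: const_eq_monom monom_mult_monom)
  also have "\<dots> \<in> I"
    using c Q add by (intro ideal.I_r_closed[OF I]) auto
  finally show ?case
    using f additive_subgroup.a_closed[OF ideal.axioms(1)[OF I]] by blast
qed

lemma comb_closed:
  assumes "G \<subseteq> carrier (mpoly R)" "p \<in> comb R G B"
  shows "p \<in> carrier (mpoly R)"
  using assms(2)
  by induction (use assms(1) mpoly_zero_closed in \<open>auto simp: mpoly_simps(2) intro!: mpoly_add_closed mpoly_mult_closed\<close>)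

text \<open>Scaling changes only the coefficients of the monomial multiples, not the exponents that
  \<open>B\<close> controls. With the inverse of a unit it turns a representation of a multiple into
  one of the polynomial itself.\<close>

lemma comb_const_mult:
  assumes "G \<subseteq> carrier (mpoly R)" "p \<in> comb R G B" "c \<in> carrier R"
  shows "const R c \<otimes>\<^bsub>mpoly R\<^esub> p \<in> comb R G B"
  using assms(2)
proof induction
  case zero
  then show ?case using assms by (simp add: mpoly_mult_zero comb.zero)
next
  case (add p a g u)
  interpret M: cring "mpoly R" by (rule mpoly_cring)
  have "g \<in> carrier (mpoly R)" "p \<in> carrier (mpoly R)"
    using add assms(1) comb_closed[OF assms(1)] by auto
  then have "const R c \<otimes>\<^bsub>mpoly R\<^esub> (monom R a u \<otimes>\<^bsub>mpoly R\<^esub> g \<oplus>\<^bsub>mpoly R\<^esub> p) =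
    monom R (c \<otimes> a) u \<otimes>\<^bsub>mpoly R\<^esub> g \<oplus>\<^bsub>mpoly R\<^esub> const R c \<otimes>\<^bsub>mpoly R\<^esub> p"
    using add assms(3) by (simp add: M.r_distr M.m_assoc[symmetric] const_eq_monom monom_mult_monom)
  then show ?case using add assms(3) by (simp add: comb.add)
qed

lemma comb_subset_ideal:
  assumes "ideal I (mpoly R)" "G \<subseteq> I"
  shows "comb R G B \<subseteq> I"
proof
  interpret M: cring "mpoly R" by (rule mpoly_cring)
  interpret I: ideal I "mpoly R" by fact
  fix p assume "p \<in> comb R G B"
  then show "p \<in> I"
  proof induction
    case zero
    show ?case using I.zero_closed unfolding mpoly_simps(2) .
  next
    case (add p a g u)
    then show ?case using assms(2) by (intro I.a_closed I.I_l_closed) auto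
  qed
qed

text \<open>Well-founded induction on the leading exponent: either it is a multiple of some leading
  exponent of \<open>G\<close> and is cancelled after multiplication by that leading coefficient, or
  its term moves to the remainder. The multipliers stay outside \<open>P\<close> because
  \<open>P\<close> is prime. The set \<open>B\<close> is kept abstract: once it contains the leading
  exponent of a shifted g, it must contain all exponents of the shifted g. This one condition serves
  both for a bound by an order and for confinement to a fixed degree.\<close>

lemma pseudo_division:
  assumes P: "primeideal P R"
    and lt: "monomial_order lt" "wfp lt"
    and G: "G \<subseteq> carrier (mpoly R)" "\<And>g. g \<in> G \<Longrightarrow> lc R lt g \<notin> P"
    and B: "\<And>g u. g \<in> G \<Longrightarrow> u + lexp R lt g \<in> B \<Longrightarrow> \<forall>s\<in>supp R g. u + s \<in> B"
    and F: "F \<in> carrier (mpoly R)" "supp R F \<subseteq> B"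
  shows "\<exists>c\<in>carrier R - P. \<exists>p\<in>comb R G B. \<exists>r\<in>carrier (mpoly R).
      const R c \<otimes>\<^bsub>mpoly R\<^esub> F = p \<oplus>\<^bsub>mpoly R\<^esub> r \<and> supp R r \<subseteq> B \<and>
      (\<forall>g\<in>G. \<forall>u. u + lexp R lt g \<notin> supp R r) \<and> (range F \<subseteq> P \<longrightarrow> range r \<subseteq> P)"
    (is "?D F")
proof -
  interpret M: cring "mpoly R" by (rule mpoly_cring)
  interpret P: primeideal P R by fact
  \<comment> \<open>The zero polynomial has no leading exponent to induct on, so it is settled
    beforehand, with multiplier one.\<close>
  have zero: "?D (\<lambda>t. \<zero>)"
  proof (intro bexI[of _ \<one>] bexI[of _ "\<lambda>t. \<zero>"])
    show "\<one> \<in> carrier R - P" using P.I_notcarr P.one_imp_carrier by auto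
    have "const R \<one> \<otimes>\<^bsub>mpoly R\<^esub> (\<lambda>t. \<zero>) = (\<lambda>t. \<zero>)" by (intro mpoly_mult_zero) auto
    then show "const R \<one> \<otimes>\<^bsub>mpoly R\<^esub> (\<lambda>t. \<zero>) = (\<lambda>t. \<zero>) \<oplus>\<^bsub>mpoly R\<^esub> (\<lambda>t. \<zero>) \<and>
      supp R (\<lambda>t. \<zero>) \<subseteq> B \<and> (\<forall>g\<in>G. \<forall>u. u + lexp R lt g \<notin> supp R (\<lambda>t. \<zero>)) \<and>
      (range (\<lambda>t. \<zero>) \<subseteq> P \<longrightarrow> range (\<lambda>t. \<zero>) \<subseteq> P)"
      by (simp add: mpoly_simps supp_def)
  qed (use mpoly_zero_closed in \<open>auto simp: comb.zero mpoly_simps\<close>)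
  have nonzero: "?D F" if "F \<in> carrier (mpoly R)" "supp R F \<subseteq> B" "supp R F \<noteq> {}" "lexp R lt F = t" for F t
    using lt(2) that
  proof (induction t arbitrary: F rule: wfp_induct_rule)
    case (less t)
    note lexpF = lexp_in_supp_max[OF lt(1) finite_supp[OF less.prems(1)] less.prems(3), unfolded less.prems(4)]
    \<comment> \<open>The induction hypothesis in the form in which it is used: all exponents lie
      below \<open>t\<close>, and the polynomial may be zero.\<close>
    have IH: "?D F'" if F': "F' \<in> carrier (mpoly R)" "\<And>s. s \<in> supp R F' \<Longrightarrow> s \<in> B \<and> lt s t" for F'
    proof (cases "supp R F' = {}")
      case True
      then have "F' = (\<lambda>t. \<zero>)" by (auto simp: supp_def)
      then show ?thesis using zero by simp
    next
      case False
      then have "lexp R lt F' \<in> supp R F'" using F'(1) lt(1) by (intro lexp_in_supp_max) (auto simp: finite_supp)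
      then show ?thesis using F' False by (intro less.IH[of "lexp R lt F'"]) auto
    qed
    have Ft: "F t \<in> carrier R" using less.prems by (simp add: coeff_closed)
    show ?case
    proof (cases "\<exists>g\<in>G. \<exists>u. u + lexp R lt g = t")
      case True
      then obtain g u where g: "g \<in> G" and u: "u + lexp R lt g = t" by blast
      define b where "b = lc R lt g"
      have gc: "g \<in> carrier (mpoly R)" using g G by blast
      have bP: "b \<notin> P" "b \<in> carrier R" using g G gc by (auto simp: b_def lc_def coeff_closed)
      have "g (lexp R lt g) \<noteq> \<zero>"
      proof
        assume "g (lexp R lt g) = \<zero>"
        then show False using bP(1) P.zero_closed unfolding b_def lc_def by simp
      qed
      then have "supp R g \<noteq> {}" by (auto simp: supp_def)
      note lexpg = lexp_in_supp_max[OF lt(1) finite_supp[OF gc] this]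
      define m where "m = monom R (F t) u \<otimes>\<^bsub>mpoly R\<^esub> g"
      \<comment> \<open>Multiplying \<open>F\<close> by \<open>b\<close> replaces the division by
        the leading coefficient: at \<open>t\<close> both terms have the coefficient b F(t), and
        they cancel.\<close>
      define F' where "F' = const R b \<otimes>\<^bsub>mpoly R\<^esub> F \<ominus>\<^bsub>mpoly R\<^esub> m"
      have mc: "m \<in> carrier (mpoly R)" using gc Ft by (simp add: m_def mpoly_mult_closed)
      have F'c: "F' \<in> carrier (mpoly R)" using gc less.prems bP mc by (simp add: F'_def)
      have F'_eq: "F' s = b \<otimes> F s \<ominus> m s" for s
        using mc bP less.prems unfolding F'_def a_minus_def
        by (simp add: mpoly_simps coeff_minus coeff_const_mult)
      have u_max: "lt v u \<or> v = u" if "v \<in> supp R (monom R (F t) u)" for v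
        using that supp_monom_subset by fastforce
      have "m (u + lexp R lt g) = monom R (F t) u u \<otimes> g (lexp R lt g)"
        unfolding m_def by (rule coeff_mult_max(1)[OF lt(1) monom_closed[OF Ft] gc]) (use u_max lexpg(2) in blast)+
      then have mt: "m t = F t \<otimes> b" by (simp add: u monom_def b_def lc_def)
      have m_max: "lt s (u + lexp R lt g) \<or> s = u + lexp R lt g" if "s \<in> supp R m" for s
        using that unfolding m_def by (intro coeff_mult_max(2)[OF lt(1) monom_closed[OF Ft] gc]) (use u_max lexpg(2) in blast)+
      have B': "\<forall>s\<in>supp R g. u + s \<in> B" using B[OF g] u lexpF(1) less.prems by auto
      have m_supp: "s \<in> B" if "s \<in> supp R m" for s
        using supp_mult[OF monom_closed[OF Ft] gc that[unfolded m_def]] B' supp_monom_subset by fastforce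
      have "?D F'"
      proof (rule IH[OF F'c])
        fix s assume s: "s \<in> supp R F'"
        have "s \<noteq> t" using s mt F'_eq[of t] Ft bP by (auto simp: in_supp_iff m_comm a_minus_def r_neg)
        moreover have "s \<in> supp R F \<or> s \<in> supp R m"
        proof (rule ccontr)
          assume "\<not> ?thesis"
          then have "F' s = \<zero>" unfolding F'_eq using bP by (simp add: in_supp_iff a_minus_def)
          then show False using s by (simp add: in_supp_iff)
        qed
        ultimately show "s \<in> B \<and> lt s t" using lexpF(2) m_max[unfolded u] m_supp less.prems(2) by blast
      qed
      then obtain c p r where c: "c \<in> carrier R - P" and p: "p \<in> comb R G B" and r: "r \<in> carrier (mpoly R)"
        and eq: "const R c \<otimes>\<^bsub>mpoly R\<^esub> F' = p \<oplus>\<^bsub>mpoly R\<^esub> r"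
        and r': "supp R r \<subseteq> B" "\<forall>g\<in>G. \<forall>u. u + lexp R lt g \<notin> supp R r" "range F' \<subseteq> P \<longrightarrow> range r \<subseteq> P"
        by blast
      have pc: "p \<in> carrier (mpoly R)" using comb_closed[OF G(1) p] .
      have "const R (c \<otimes> b) \<otimes>\<^bsub>mpoly R\<^esub> F = const R c \<otimes>\<^bsub>mpoly R\<^esub> (const R b \<otimes>\<^bsub>mpoly R\<^esub> F)"
        using c bP less.prems
        by (simp add: M.m_assoc[symmetric] const_eq_monom monom_mult_monom)
      also have "const R b \<otimes>\<^bsub>mpoly R\<^esub> F = m \<oplus>\<^bsub>mpoly R\<^esub> F'"
        unfolding F'_def using mc M.m_closed[OF const_closed[OF bP(2)] less.prems(1)] by algebra
      also have "const R c \<otimes>\<^bsub>mpoly R\<^esub> (m \<oplus>\<^bsub>mpoly R\<^esub> F') = const R c \<otimes>\<^bsub>mpoly R\<^esub> m \<oplus>\<^bsub>mpoly R\<^esub> (p \<oplus>\<^bsub>mpoly R\<^esub> r)"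
        using c mc F'c by (simp add: M.r_distr eq)
      also have "const R c \<otimes>\<^bsub>mpoly R\<^esub> m = monom R (c \<otimes> F t) u \<otimes>\<^bsub>mpoly R\<^esub> g"
        using c gc Ft by (simp add: m_def M.m_assoc[symmetric] const_eq_monom monom_mult_monom)
      finally have "const R (c \<otimes> b) \<otimes>\<^bsub>mpoly R\<^esub> F =
          (monom R (c \<otimes> F t) u \<otimes>\<^bsub>mpoly R\<^esub> g \<oplus>\<^bsub>mpoly R\<^esub> p) \<oplus>\<^bsub>mpoly R\<^esub> r"
        using c Ft gc pc r by (simp add: M.a_assoc)
      moreover have "monom R (c \<otimes> F t) u \<otimes>\<^bsub>mpoly R\<^esub> g \<oplus>\<^bsub>mpoly R\<^esub> p \<in> comb R G B"
        using p c Ft g B' by (intro comb.add) auto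
      moreover have "c \<otimes> b \<in> carrier R - P" using c bP P.I_prime by auto
      moreover have "range F' \<subseteq> P" if "range F \<subseteq> P"
      proof -
        have FP: "F s \<in> P" for s using that by auto
        have "m s \<in> P" for s
        proof -
          have "m s = F t \<otimes> (monom R \<one> u \<otimes>\<^bsub>mpoly R\<^esub> g) s"
            unfolding m_def by (rule coeff_monom_mult[OF Ft gc])
          then show ?thesis using FP gc by (simp add: P.I_r_closed coeff_closed mpoly_mult_closed)
        qed
        then have "F' s \<in> P" for s
          unfolding F'_eq a_minus_def using FP bP by (intro P.a_closed P.a_inv_closed P.I_l_closed) auto
        then show ?thesis by auto
      qed
      ultimately show ?thesis using r r' by blast
    next
      case False
      \<comment> \<open>No leading exponent of \<open>G\<close> divides \<open>t\<close>. The
        leading term joins the remainder, scaled by the multiplier \<open>c\<close> of the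
        rest.\<close>
      define F' where "F' = F(t := \<zero>)"
      have F'c: "F' \<in> carrier (mpoly R)"
        using less.prems by (intro mpoly_carrierI[of _ _ "supp R F"])
          (auto simp: F'_def in_supp_iff coeff_closed finite_supp split: if_splits)
      have F_eq: "F = monom R (F t) t \<oplus>\<^bsub>mpoly R\<^esub> F'"
        using less.prems by (auto simp: F'_def mpoly_simps monom_def coeff_closed)
      have "?D F'"
      proof (rule IH[OF F'c])
        fix s assume "s \<in> supp R F'"
        then have "s \<noteq> t" "s \<in> supp R F" by (auto simp: F'_def in_supp_iff split: if_splits)
        then show "s \<in> B \<and> lt s t" using lexpF(2) less.prems(2) by blast
      qed
      then obtain c p r where c: "c \<in> carrier R - P" and p: "p \<in> comb R G B" and r: "r \<in> carrier (mpoly R)"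
        and eq: "const R c \<otimes>\<^bsub>mpoly R\<^esub> F' = p \<oplus>\<^bsub>mpoly R\<^esub> r"
        and r': "supp R r \<subseteq> B" "\<forall>g\<in>G. \<forall>u. u + lexp R lt g \<notin> supp R r" "range F' \<subseteq> P \<longrightarrow> range r \<subseteq> P"
        by blast
      have pc: "p \<in> carrier (mpoly R)" using comb_closed[OF G(1) p] .
      let ?r = "monom R (c \<otimes> F t) t \<oplus>\<^bsub>mpoly R\<^esub> r"
      have "const R c \<otimes>\<^bsub>mpoly R\<^esub> F = const R c \<otimes>\<^bsub>mpoly R\<^esub> (monom R (F t) t \<oplus>\<^bsub>mpoly R\<^esub> F')"
        using F_eq by simp
      also have "\<dots> = monom R (c \<otimes> F t) t \<oplus>\<^bsub>mpoly R\<^esub> (p \<oplus>\<^bsub>mpoly R\<^esub> r)"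
        using c Ft F'c by (simp add: M.r_distr eq) (simp add: const_eq_monom monom_mult_monom)
      also have "\<dots> = p \<oplus>\<^bsub>mpoly R\<^esub> ?r"
        using c Ft pc r by (simp add: M.a_lcomm)
      finally have 1: "const R c \<otimes>\<^bsub>mpoly R\<^esub> F = p \<oplus>\<^bsub>mpoly R\<^esub> ?r" .
      \<comment> \<open>The new remainder gains at most the exponent \<open>t\<close>, which is
        irreducible by the case assumption.\<close>
      have 2: "supp R ?r \<subseteq> insert t (supp R r)"
        using r by (auto simp: in_supp_iff mpoly_simps monom_def split: if_splits)
      have 3: "range ?r \<subseteq> P" if "range F \<subseteq> P"
      proof -
        have FP: "F s \<in> P" for s using that by auto
        then have "range F' \<subseteq> P" using P.zero_closed by (auto simp: F'_def)
        then have rP: "r s \<in> P" for s using r'(3) by auto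
        have "monom R (c \<otimes> F t) t s \<in> P" for s
          using FP c P.I_l_closed P.zero_closed by (simp add: monom_def)
        then show ?thesis using rP by (auto simp: mpoly_simps intro!: P.a_closed)
      qed
      have 4: "?r \<in> carrier (mpoly R)" using c Ft r by simp
      have 5: "supp R ?r \<subseteq> B" using 2 r'(1) lexpF(1) less.prems(2) by blast
      have 6: "\<forall>g\<in>G. \<forall>u. u + lexp R lt g \<notin> supp R ?r" using 2 r'(2) False by blast
      show ?thesis
        by (intro bexI[OF _ c] bexI[OF _ p] bexI[OF _ 4]) (use 1 3 5 6 in blast)
    qed
  qed
  show ?thesis
  proof (cases "supp R F = {}")
    case True
    then have "F = (\<lambda>t. \<zero>)" by (auto simp: supp_def)
    then show ?thesis using zero by simp
  next
    case False
    show ?thesis using nonzero[OF F False refl] .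
  qed
qed

end

text \<open>The order \<open>lt\<close> compares the first components by \<open>ltx\<close> before
  anything else, so the bound of a standard representation over \<open>K\<close> projects to a bound
  for \<open>ltx\<close>. Some product p_g g must then contribute a coefficient outside
  \<open>Q\<close> at the leading exponent \<open>t\<close> of the trimmed remainder, and its own
  leading exponent is squeezed to \<open>t\<close>; thus the leading exponent of g divides
  \<open>t\<close>, although \<open>t\<close> was assumed irreducible.\<close>

lemma standard_basis_remainder:
  fixes K :: "('k, 'd) ring_scheme" and A :: "('s::comm_monoid_add \<Rightarrow> 'k) ring"
    and ltx :: "'t::comm_monoid_add \<Rightarrow> 't \<Rightarrow> bool"
  assumes K: "domain K" and A: "A = mpoly K"
    and lt0: "monomial_order lt0" and ltx: "monomial_order ltx"
    and lt: "monomial_order lt" "\<And>t \<gamma> t' \<gamma>'. lt (t, \<gamma>) (t', \<gamma>') \<longleftrightarrow> ltx t t' \<or> t = t' \<and> lt0 \<gamma> \<gamma>'"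
    and Q: "ideal Q A" and I: "ideal I (mpoly A)" "const A ` Q \<subseteq> I"
    and sb: "standard_basis K lt (flatten ` I) (flatten ` G)"
    and r: "r \<in> I" "\<forall>g\<in>G - const A ` Q. \<forall>u. u + lexp A ltx g \<notin> supp A r"
  shows "range r \<subseteq> Q"
proof (rule ccontr)
  assume nQ: "\<not> range r \<subseteq> Q"
  interpret K: domain K by fact
  interpret A: domain A unfolding A by (rule K.mpoly_domain[OF lt0])
  interpret M: cring "mpoly A" by (rule A.mpoly_cring)
  interpret MK: cring "mpoly K :: ('t \<times> 's \<Rightarrow> 'k) ring" by (rule K.mpoly_cring)
  interpret Q: ideal Q A by fact
  interpret I: ideal I "mpoly A" by fact
  have tr: "transp lt" "transp ltx" using lt(1) ltx by (simp_all add: monomial_order_def)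
  have A_zero: "\<zero>\<^bsub>A\<^esub> = (\<lambda>v. \<zero>\<^bsub>K\<^esub>)" by (simp add: A mpoly_simps)
  have irr: "\<not> ltx x x" for x using ltx by (simp add: monomial_order_def irreflpD)
  have G: "G \<subseteq> I" "finite G"
    using sb inj_flatten inj_image_subset_iff[OF inj_flatten, of G I]
      finite_imageD[OF _ inj_on_subset[OF inj_flatten subset_UNIV], of G]
    unfolding standard_basis_def by blast+
  have rc: "r \<in> carrier (mpoly A)" using r(1) I.a_subset by blast
  have gc: "g \<in> carrier (mpoly A)" if "g \<in> G" for g using that G(1) I.a_subset by blast
  txt \<open>Deleting the coefficients in \<open>Q\<close> makes the leading coefficient lie outside \<open>Q\<close>.\<close>
  define r' where "r' = (\<lambda>t. if r t \<in> Q then \<zero>\<^bsub>A\<^esub> else r t)"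
  have r'c: "r' \<in> carrier (mpoly A)"
    using rc by (intro mpoly_carrierI[of _ _ "supp A r"]) (auto simp: r'_def in_supp_iff coeff_closed finite_supp)
  have "r \<ominus>\<^bsub>mpoly A\<^esub> r' \<in> I"
  proof (rule A.mpoly_mem_ideal[OF I])
    have "(r \<ominus>\<^bsub>mpoly A\<^esub> r') t \<in> Q" for t
      using r'c rc unfolding a_minus_def
      by (auto simp: mpoly_simps(3)[of A] A.coeff_minus r'_def coeff_closed A.r_neg)
    then show "range (r \<ominus>\<^bsub>mpoly A\<^esub> r') \<subseteq> Q" by auto
  qed (use r'c rc in auto)
  then have "\<ominus>\<^bsub>mpoly A\<^esub> (r \<ominus>\<^bsub>mpoly A\<^esub> r') \<oplus>\<^bsub>mpoly A\<^esub> r \<in> I"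
    using r(1) by blast
  also have "\<ominus>\<^bsub>mpoly A\<^esub> (r \<ominus>\<^bsub>mpoly A\<^esub> r') \<oplus>\<^bsub>mpoly A\<^esub> r = r'"
    using rc r'c by algebra
  finally have r'I: "r' \<in> I" .
  have r'ne: "supp A r' \<noteq> {}" using nQ by (auto simp: r'_def supp_def Q.zero_closed)
  define t where "t = lexp A ltx r'"
  note t = lexp_in_supp_max[OF ltx finite_supp[OF r'c] r'ne, folded t_def]
  have "r' t \<noteq> \<zero>\<^bsub>A\<^esub>" using t(1) by (simp add: in_supp_iff)
  then have rt: "r' t \<notin> Q" "r t \<noteq> \<zero>\<^bsub>A\<^esub>" using Q.zero_closed by (auto simp: r'_def split: if_splits)
  let ?r = "flatten r'"
  have frc: "?r \<in> carrier (mpoly K)" using r'c A by (simp add: flatten_carrier K.cring_axioms)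
  obtain v where v: "r' t v \<noteq> \<zero>\<^bsub>K\<^esub>"
    using \<open>r' t \<noteq> \<zero>\<^bsub>A\<^esub>\<close> by (auto simp: A mpoly_simps fun_eq_iff)
  then have fr_ne: "supp K ?r \<noteq> {}" by (auto simp: supp_def flatten_def)
  then have r_ne: "?r \<noteq> \<zero>\<^bsub>mpoly K\<^esub>" by (auto simp: mpoly_simps supp_def)
  obtain q where qc: "\<forall>g\<in>flatten ` G. q g \<in> carrier (mpoly K)"
    and q_sum: "?r = (\<Oplus>\<^bsub>mpoly K\<^esub>g\<in>flatten ` G. q g \<otimes>\<^bsub>mpoly K\<^esub> g)"
    and q_le: "\<forall>g\<in>flatten ` G. q g \<otimes>\<^bsub>mpoly K\<^esub> g = \<zero>\<^bsub>mpoly K\<^esub> \<or>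
                lt (lexp K lt (q g \<otimes>\<^bsub>mpoly K\<^esub> g)) (lexp K lt ?r) \<or>
                lexp K lt (q g \<otimes>\<^bsub>mpoly K\<^esub> g) = lexp K lt ?r"
    using sb[unfolded standard_basis_def, THEN conjunct2, THEN conjunct2, THEN bspec, OF imageI[OF r'I], THEN mp, OF r_ne]
    by (elim exE conjE) (rule that)
  \<comment> \<open>The quotients of the flattened representation, read again as polynomials over
    \<open>A\<close>.\<close>
  define p where "p g = curry (q (flatten g))" for g
  have pc: "p g \<in> carrier (mpoly A)" if "g \<in> G" for g
    using that qc by (auto simp: p_def A intro!: curry_carrier)
  have fl: "flatten \<in> ring_hom (mpoly A :: ('t \<Rightarrow> 's \<Rightarrow> 'k) ring) (mpoly K)" unfolding A by (rule flatten_hom[OF K.cring_axioms])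
  interpret fl: ring_hom_cring "mpoly A :: ('t \<Rightarrow> 's \<Rightarrow> 'k) ring" "mpoly K" flatten
    by (intro ring_hom_cring.intro ring_hom_cring_axioms.intro M.cring_axioms MK.cring_axioms fl)
  have fl_pg: "flatten (p g \<otimes>\<^bsub>mpoly A\<^esub> g) = q (flatten g) \<otimes>\<^bsub>mpoly K\<^esub> flatten g" if "g \<in> G" for g
    using that pc gc by (simp add: p_def)
  have "flatten (\<Oplus>\<^bsub>mpoly A\<^esub>g\<in>G. p g \<otimes>\<^bsub>mpoly A\<^esub> g) = (\<Oplus>\<^bsub>mpoly K\<^esub>g\<in>G. flatten (p g \<otimes>\<^bsub>mpoly A\<^esub> g))"
    using pc gc fl.hom_finsum[of "\<lambda>g. p g \<otimes>\<^bsub>mpoly A\<^esub> g" G] by (simp add: Pi_iff comp_def)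
  also have "\<dots> = (\<Oplus>\<^bsub>mpoly K\<^esub>g\<in>G. q (flatten g) \<otimes>\<^bsub>mpoly K\<^esub> flatten g)"
    using fl_pg qc fl.hom_closed gc by (intro MK.finsum_cong') auto
  also have "\<dots> = ?r"
    unfolding q_sum using qc fl.hom_closed gc inj_flatten
    by (intro MK.finsum_reindex[symmetric]) (auto intro: inj_on_subset)
  finally have r'_sum: "r' = (\<Oplus>\<^bsub>mpoly A\<^esub>g\<in>G. p g \<otimes>\<^bsub>mpoly A\<^esub> g)"
    by (intro injD[OF inj_flatten]) (rule sym)
  have r't: "r' t = (\<Oplus>\<^bsub>A\<^esub>g\<in>G. (p g \<otimes>\<^bsub>mpoly A\<^esub> g) t)"
    unfolding r'_sum using pc gc by (intro A.coeff_finsum) auto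
  have sum_Q: "(\<Oplus>\<^bsub>A\<^esub>g\<in>H. F g) \<in> Q" if "finite H" "\<And>g. g \<in> H \<Longrightarrow> F g \<in> Q" for F and H :: "('t \<Rightarrow> 's \<Rightarrow> 'k) set"
    using that
  proof (induction H)
    case (insert x H)
    then have "F \<in> H \<rightarrow> carrier A" "F x \<in> carrier A" using Q.a_subset by auto
    with insert show ?case by (simp add: A.finsum_insert)
  qed simp
  \<comment> \<open>\<open>Q\<close> is closed under sums, so a coefficient outside \<open>Q\<close>
    requires a summand outside \<open>Q\<close>.\<close>
  have "\<exists>g\<in>G. (p g \<otimes>\<^bsub>mpoly A\<^esub> g) t \<notin> Q"
  proof (rule ccontr)
    assume "\<not> ?thesis"
    then have "(\<Oplus>\<^bsub>A\<^esub>g\<in>G. (p g \<otimes>\<^bsub>mpoly A\<^esub> g) t) \<in> Q" by (intro sum_Q[OF G(2)]) blast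
    then show False using rt(1) r't by simp
  qed
  then obtain g where g: "g \<in> G" and pg: "(p g \<otimes>\<^bsub>mpoly A\<^esub> g) t \<notin> Q" by blast
  \<comment> \<open>A constant from \<open>Q\<close> would push all coefficients of its multiples
    into \<open>Q\<close>.\<close>
  have "g \<notin> const A ` Q"
  proof
    assume "g \<in> const A ` Q"
    then obtain c where c: "c \<in> Q" "g = const A c" by blast
    then have "(p g \<otimes>\<^bsub>mpoly A\<^esub> g) t = c \<otimes>\<^bsub>A\<^esub> p g t"
      using pc[OF g] gc[OF g] Q.a_subset by (subst M.m_comm) (auto simp: A.coeff_const_mult)
    also have "\<dots> \<in> Q" using c coeff_closed[OF pc[OF g]] by (intro Q.I_r_closed)
    finally show False using pg by simp
  qed
  have pg_supp: "t \<in> supp A (p g \<otimes>\<^bsub>mpoly A\<^esub> g)" using pg Q.zero_closed by (auto simp: in_supp_iff)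
  have pgc: "p g \<otimes>\<^bsub>mpoly A\<^esub> g \<in> carrier (mpoly A)" using pc gc g by simp
  \<comment> \<open>The first component of the leading exponent of \<open>?r\<close> is an exponent
    of \<open>r'\<close>, hence at most \<open>t\<close>; the comparison under \<open>lt\<close>
    passes to first components.\<close>
  have le_t: "ltx s t \<or> s = t" if s: "s \<in> supp A (p g \<otimes>\<^bsub>mpoly A\<^esub> g)" for s
  proof -
    let ?h = "q (flatten g) \<otimes>\<^bsub>mpoly K\<^esub> flatten g"
    obtain v where v: "(p g \<otimes>\<^bsub>mpoly A\<^esub> g) s v \<noteq> \<zero>\<^bsub>K\<^esub>"
      using s by (auto simp: in_supp_iff A_zero fun_eq_iff)
    then have sv: "(s, v) \<in> supp K ?h"
      unfolding fl_pg[OF g, symmetric] by (simp add: in_supp_iff flatten_def)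
    have hc: "?h \<in> carrier (mpoly K)" using pgc fl_pg[OF g] fl.hom_closed by metis
    have "?h \<noteq> \<zero>\<^bsub>mpoly K\<^esub>" using sv by (auto simp: mpoly_simps in_supp_iff)
    then have "lt (lexp K lt ?h) (lexp K lt ?r) \<or> lexp K lt ?h = lexp K lt ?r"
      using bspec[OF q_le imageI[OF g]] by simp
    moreover have "lt (s, v) (lexp K lt ?h) \<or> (s, v) = lexp K lt ?h"
      by (rule lexp_in_supp_max(2)[OF lt(1) finite_supp[OF hc] _ sv]) (use sv in blast)
    ultimately have 1: "lt (s, v) (lexp K lt ?r) \<or> (s, v) = lexp K lt ?r"
      using transpD[OF tr(1), of "(s, v)" "lexp K lt ?h" "lexp K lt ?r"] by auto
    obtain t' v' where T: "lexp K lt ?r = (t', v')" by (cases "lexp K lt ?r")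
    have "(t', v') \<in> supp K ?r"
      using lexp_in_supp_max(1)[OF lt(1) finite_supp[OF frc] fr_ne] T by simp
    then have "t' \<in> supp A r'" by (auto simp: in_supp_iff flatten_def A mpoly_simps)
    then have "ltx t' t \<or> t' = t" using t(2) by blast
    moreover have "ltx s t' \<or> s = t'" using 1 T lt(2) by auto
    ultimately show ?thesis using transpD[OF tr(2), of s t' t] by auto
  qed
  have "supp A (p g) \<noteq> {}" "supp A g \<noteq> {}" using A.supp_mult[OF pc[OF g] gc[OF g] pg_supp] by auto
  note lp = lexp_in_supp_max[OF ltx finite_supp[OF pc[OF g]] this(1)]
    and lg = lexp_in_supp_max[OF ltx finite_supp[OF gc[OF g]] this(2)]
  let ?u = "lexp A ltx (p g)"
  note cm = A.coeff_mult_max[OF ltx pc[OF g] gc[OF g] lp(2) lg(2)]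
  \<comment> \<open>As \<open>A\<close> is a domain, the leading terms multiply to a nonzero term.
    Its exponent is at most \<open>t\<close> by the bound on the product, and at least
    \<open>t\<close> because \<open>t\<close> occurs in the product.\<close>
  have "p g ?u \<otimes>\<^bsub>A\<^esub> g (lexp A ltx g) \<noteq> \<zero>\<^bsub>A\<^esub>"
    using lp(1) lg(1) coeff_closed[OF pc[OF g]] coeff_closed[OF gc[OF g]]
    by (auto simp: in_supp_iff A.integral_iff)
  then have "?u + lexp A ltx g \<in> supp A (p g \<otimes>\<^bsub>mpoly A\<^esub> g)" using cm(1) by (simp add: in_supp_iff)
  then have "ltx (?u + lexp A ltx g) t \<or> ?u + lexp A ltx g = t" by (rule le_t)
  moreover have "ltx t (?u + lexp A ltx g) \<or> t = ?u + lexp A ltx g" using cm(2) pg_supp by blast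
  ultimately have "?u + lexp A ltx g = t"
    using irr transpD[OF tr(2), of t "?u + lexp A ltx g" t] by auto
  then show False
    using r(2) g \<open>g \<notin> const A ` Q\<close> rt(2) by (auto simp: in_supp_iff)
qed

text \<open>Negatives are multiples by -1, so closure under sums and multiples suffices. The lemma
  serves to show that the elements with a given property form an ideal; an ideal generated by such
  elements then consists of them.\<close>

lemma (in cring) ideal_of_closed:
  assumes "T \<subseteq> carrier R" "\<zero> \<in> T" "\<And>a b. a \<in> T \<Longrightarrow> b \<in> T \<Longrightarrow> a \<oplus> b \<in> T"
    and mult: "\<And>x a. x \<in> carrier R \<Longrightarrow> a \<in> T \<Longrightarrow> x \<otimes> a \<in> T"
  shows "ideal T R"
proof (rule idealI)
  show "subgroup T (add_monoid R)"
  proof (rule subgroup.intro)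
    fix a assume a: "a \<in> T"
    then have "\<ominus> a = (\<ominus> \<one>) \<otimes> a" using assms(1) by (auto simp: l_minus)
    also have "\<dots> \<in> T" using a by (intro mult) auto
    finally show "inv\<^bsub>add_monoid R\<^esub> a \<in> T" by (simp add: a_inv_def)
  qed (use assms in auto)
  show "a \<otimes> x \<in> T" if "a \<in> T" "x \<in> carrier R" for a x
    using mult[OF that(2,1)] that assms(1) m_comm[of a x] by auto
qed (use mult ring_axioms in auto)

section \<open>Graded terms\<close>

lemma tdeg_add: "tdeg (\<alpha> + \<beta>) = tdeg \<alpha> + tdeg \<beta>"
  by (simp add: tdeg_def sum.distrib)

lemma tdeg_zero [simp]: "tdeg 0 = 0"
  by (simp add: tdeg_def)

lemma finite_tdeg_le: "finite {\<alpha> :: nat ^ 'n. tdeg \<alpha> \<le> d}"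
proof (rule finite_imageD)
  show "inj_on vec_nth {\<alpha> :: nat ^ 'n. tdeg \<alpha> \<le> d}" by (simp add: inj_on_def vec_nth_inject)
  have "\<alpha> $ i \<le> tdeg \<alpha>" for \<alpha> :: "nat ^ 'n" and i
    unfolding tdeg_def by (rule member_le_sum) auto
  then have "vec_nth ` {\<alpha> :: nat ^ 'n. tdeg \<alpha> \<le> d} \<subseteq> Pi\<^sub>E UNIV (\<lambda>_. {..d})"
    by (auto intro: order_trans)
  moreover have "finite (Pi\<^sub>E (UNIV :: 'n set) (\<lambda>_. {..d}))" by (intro finite_PiE) auto
  ultimately show "finite (vec_nth ` {\<alpha> :: nat ^ 'n. tdeg \<alpha> \<le> d})" by (rule finite_subset)
qed

lemma lt_xz_iff: "lt_xz lt (\<alpha>, k) (\<alpha>', k') \<longleftrightarrow> tdeg \<alpha> + k < tdeg \<alpha>' + k' \<or>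
    tdeg \<alpha> + k = tdeg \<alpha>' + k' \<and> lt \<alpha> \<alpha>'"
  by (simp add: lt_xz_def)

text \<open>If the x-parts of two distinct terms agree, their powers of z differ and so do their
  total degrees; hence the order is total without ever comparing powers of z directly.\<close>

lemma monomial_order_lt_xz:
  assumes "monomial_order lt"
  shows "monomial_order (lt_xz lt)"
proof -
  have "irreflp lt" "transp lt" "totalp lt" and add: "\<And>s t u. lt s t \<Longrightarrow> lt (s + u) (t + u)"
    using assms by (auto simp: monomial_order_def)
  moreover have "totalp (lt_xz lt)"
  proof (rule totalpI)
    fix s t :: "(nat ^ 'a) \<times> nat" assume "s \<noteq> t"
    then show "lt_xz lt s t \<or> lt_xz lt t s"
      using totalpD[OF \<open>totalp lt\<close>, of "fst s" "fst t"]
      by (cases s; cases t; cases "fst s = fst t") (auto simp: lt_xz_iff)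
  qed
  ultimately show ?thesis
    unfolding monomial_order_def
    by (intro conjI allI impI irreflpI transpI)
      (auto simp: lt_xz_iff tdeg_add dest: irreflpD transpD)
qed

lemma lt_axz_iff: "lt_axz lt0 lt (t, \<gamma>) (t', \<gamma>') \<longleftrightarrow> lt_xz lt t t' \<or> t = t' \<and> lt0 \<gamma> \<gamma>'"
  by (simp add: lt_axz_def)

lemma monomial_order_lt_axz:
  assumes "monomial_order lt0" "monomial_order lt"
  shows "monomial_order (lt_axz lt0 lt)"
proof -
  have "irreflp lt0" "transp lt0" "totalp lt0" and add: "\<And>s t u. lt0 s t \<Longrightarrow> lt0 (s + u) (t + u)"
    using assms(1) by (auto simp: monomial_order_def)
  moreover have "irreflp (lt_xz lt)" "transp (lt_xz lt)" "totalp (lt_xz lt)"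
    "\<And>s t u. lt_xz lt s t \<Longrightarrow> lt_xz lt (s + u) (t + u)"
    using monomial_order_lt_xz[OF assms(2)] by (auto simp: monomial_order_def)
  ultimately show ?thesis
    unfolding monomial_order_def
    by (intro conjI allI impI irreflpI transpI totalpI)
      (auto simp: lt_axz_def split: prod.splits dest: irreflpD transpD totalpD)
qed

text \<open>The number of smaller terms is a decreasing measure: it is finite because smaller terms
  have no larger total degree, and it drops because \<open>s\<close> itself lies below
  \<open>t\<close> but not below \<open>s\<close>.\<close>

lemma wfp_lt_xz:
  assumes "monomial_order lt"
  shows "wfp (lt_xz lt :: (nat ^ 'n) \<times> nat \<Rightarrow> _)"
proof (rule wfp_if_convertible_to_nat)
  fix s t :: "(nat ^ 'n) \<times> nat" assume st: "lt_xz lt s t"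
  have o: "irreflp (lt_xz lt)" "transp (lt_xz lt)"
    using monomial_order_lt_xz[OF assms] by (auto simp: monomial_order_def)
  show "card {u. lt_xz lt u s} < card {u. lt_xz lt u t}"
  proof (rule psubset_card_mono)
    obtain \<alpha> k where t: "t = (\<alpha>, k)" by (cases t)
    have "{u. lt_xz lt u t} \<subseteq> {\<beta>. tdeg \<beta> \<le> tdeg \<alpha> + k} \<times> {..tdeg \<alpha> + k}"
      unfolding t by (auto simp: lt_xz_iff)
    then show "finite {u. lt_xz lt u t}"
      using finite_tdeg_le by (rule finite_subset[OF _ finite_cartesian_product]) auto
    have "{u. lt_xz lt u s} \<subseteq> {u. lt_xz lt u t}" using st o by (auto dest: transpD)
    moreover have "s \<in> {u. lt_xz lt u t} - {u. lt_xz lt u s}" using st o by (auto dest: irreflpD)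
    ultimately show "{u. lt_xz lt u s} \<subset> {u. lt_xz lt u t}" by blast
  qed
qed

section \<open>Homogenization of ideals\<close>

text \<open>Homogeneity with the degree as a parameter, so that degrees can be added and matched.
  Zero is graded in every degree.\<close>

definition graded :: "('c, 'd) ring_scheme \<Rightarrow> nat \<Rightarrow> ((nat ^ 'n) \<times> nat \<Rightarrow> 'c) \<Rightarrow> bool" where
  "graded R d f \<longleftrightarrow> (\<forall>\<alpha> k. tdeg \<alpha> + k \<noteq> d \<longrightarrow> f (\<alpha>, k) = \<zero>\<^bsub>R\<^esub>)"

text \<open>The target degree is free, which avoids carrying the maximum along. Terms of degree
  above \<open>d\<close> are dropped, so the map is faithful only if \<open>d\<close> bounds the
  degree of \<open>f\<close>.\<close>

definition homogenize_to :: "('c, 'd) ring_scheme \<Rightarrow> nat \<Rightarrow> (nat ^ 'n \<Rightarrow> 'c) \<Rightarrow> ((nat ^ 'n) \<times> nat \<Rightarrow> 'c)" where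
  "homogenize_to R d f = (\<lambda>(\<alpha>, k). if tdeg \<alpha> + k = d then f \<alpha> else \<zero>\<^bsub>R\<^esub>)"

lemma homogenize_eq: "homogenize R f = homogenize_to R (Max (tdeg ` supp R f)) f"
  by (simp add: homogenize_def homogenize_to_def)

lemma graded_homogenize_to: "graded R d (homogenize_to R d f)"
  by (simp add: graded_def homogenize_to_def)

context cring
begin

lemma homogenize_to_closed:
  assumes "f \<in> carrier (mpoly R)"
  shows "homogenize_to R d f \<in> carrier (mpoly R)"
proof (rule mpoly_carrierI)
  show "finite ((\<lambda>\<alpha>. (\<alpha>, d - tdeg \<alpha>)) ` supp R f)" using assms by (simp add: finite_supp)
  show "supp R (homogenize_to R d f) \<subseteq> (\<lambda>\<alpha>. (\<alpha>, d - tdeg \<alpha>)) ` supp R f"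
    by (auto simp: homogenize_to_def in_supp_iff image_iff split: if_splits)
  show "homogenize_to R d f t \<in> carrier R" for t
    using assms by (cases t) (simp add: homogenize_to_def coeff_closed)
qed

lemma dehomogenize_graded:
  assumes "f \<in> carrier (mpoly R)" "graded R d f"
  shows "dehomogenize R f \<alpha> = (if tdeg \<alpha> \<le> d then f (\<alpha>, d - tdeg \<alpha>) else \<zero>)"
  using assms by (intro dehomogenize_homogeneous cring_axioms) (auto simp: graded_def)

lemma dehomogenize_homogenize_to:
  assumes "f \<in> carrier (mpoly R)" "\<And>\<alpha>. \<alpha> \<in> supp R f \<Longrightarrow> tdeg \<alpha> \<le> d"
  shows "dehomogenize R (homogenize_to R d f) = f"
proof
  fix \<alpha> show "dehomogenize R (homogenize_to R d f) \<alpha> = f \<alpha>"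
    using assms(2)[of \<alpha>] dehomogenize_graded[OF homogenize_to_closed[OF assms(1)] graded_homogenize_to, of d \<alpha>]
    by (cases "f \<alpha> = \<zero>") (auto simp: homogenize_to_def in_supp_iff)
qed

lemma homogenize_closed:
  assumes "f \<in> carrier (mpoly R)"
  shows "homogenize R f \<in> carrier (mpoly R)"
  using assms by (simp add: homogenize_eq homogenize_to_closed)

lemma dehomogenize_homogenize:
  assumes "f \<in> carrier (mpoly R)"
  shows "dehomogenize R (homogenize R f) = f"
  unfolding homogenize_eq using assms by (intro dehomogenize_homogenize_to) (auto simp: finite_supp)

lemma graded_mult:
  assumes "f \<in> carrier (mpoly R)" "g \<in> carrier (mpoly R)" "graded R d f" "graded R e g"
  shows "graded R (d + e) (f \<otimes>\<^bsub>mpoly R\<^esub> g)"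
  unfolding graded_def
proof (intro allI impI, rule ccontr)
  fix \<alpha> k assume *: "tdeg \<alpha> + k \<noteq> d + e" "(f \<otimes>\<^bsub>mpoly R\<^esub> g) (\<alpha>, k) \<noteq> \<zero>"
  then obtain s u where su: "s \<in> supp R f" "u \<in> supp R g" "(\<alpha>, k) = s + u"
    using supp_mult[OF assms(1,2), of "(\<alpha>, k)"] by (auto simp: in_supp_iff)
  have "tdeg (fst s) + snd s = d" using assms(3) su(1) unfolding graded_def in_supp_iff by (metis prod.collapse)
  moreover have "tdeg (fst u) + snd u = e" using assms(4) su(2) unfolding graded_def in_supp_iff by (metis prod.collapse)
  moreover have "\<alpha> = fst s + fst u" "k = snd s + snd u" using su(3) by (simp_all add: plus_prod_def)
  ultimately show False using *(1) by (simp add: tdeg_add)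
qed

lemma graded_add:
  assumes "graded R d f" "graded R d g"
  shows "graded R d (f \<oplus>\<^bsub>mpoly R\<^esub> g)"
  using assms by (simp add: graded_def mpoly_simps)

text \<open>The elements having a homogeneous lift form an ideal that contains the generators. Lifts
  of two summands may have different degrees; powers of z, invisible after z = 1, bring them to a
  common degree before they are added.\<close>

lemma homogeneous_preimage:
  fixes f :: "'i \<Rightarrow> nat ^ 'n \<Rightarrow> 'a"
  assumes f: "\<And>i. i \<in> S \<Longrightarrow> f i \<in> carrier (mpoly R)"
    and x: "x \<in> Idl\<^bsub>mpoly R\<^esub> (f ` S)"
  shows "\<exists>F\<in>Idl\<^bsub>mpoly R\<^esub> ((\<lambda>i. homogenize R (f i)) ` S). (\<exists>d. graded R d F) \<and> dehomogenize R F = x"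
proof -
  interpret M: cring "mpoly R :: (nat ^ 'n \<Rightarrow> 'a) ring" by (rule mpoly_cring)
  interpret Z: cring "mpoly R :: ((nat ^ 'n) \<times> nat \<Rightarrow> 'a) ring" by (rule mpoly_cring)
  interpret deh: ring_hom_cring "mpoly R :: ((nat ^ 'n) \<times> nat \<Rightarrow> 'a) ring" "mpoly R" "dehomogenize R"
    using dehomogenize_hom[OF cring_axioms] by unfold_locales
  let ?H = "Idl\<^bsub>mpoly R\<^esub> ((\<lambda>i. homogenize R (f i)) ` S)"
  have Hsub: "(\<lambda>i. homogenize R (f i)) ` S \<subseteq> carrier (mpoly R)" using f by (auto intro: homogenize_closed)
  interpret H: ideal ?H "mpoly R" using Hsub by (rule Z.genideal_ideal)
  let ?z = "\<lambda>k. monom R \<one> (0 :: nat ^ 'n, k :: nat)"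
  have z: "?z k \<in> carrier (mpoly R)" "graded R k (?z k)" "dehomogenize R (?z k) = \<one>\<^bsub>mpoly R\<^esub>" for k
    by (simp, simp add: graded_def monom_def,
        simp add: dehomogenize_monom cring_axioms mpoly_simps const_eq_monom)
  have lift: "\<exists>F'\<in>?H. graded R (k + d) F' \<and> dehomogenize R F' = dehomogenize R F"
    if "F \<in> ?H" "graded R d F" for F d k
  proof (rule bexI[of _ "?z k \<otimes>\<^bsub>mpoly R\<^esub> F"])
    show "?z k \<otimes>\<^bsub>mpoly R\<^esub> F \<in> ?H" using that z by (intro H.I_l_closed)
    have "F \<in> carrier (mpoly R)" using that(1) H.a_subset by blast
    then show "graded R (k + d) (?z k \<otimes>\<^bsub>mpoly R\<^esub> F) \<and> dehomogenize R (?z k \<otimes>\<^bsub>mpoly R\<^esub> F) = dehomogenize R F"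
      using that z by (simp add: graded_mult)
  qed
  define T where "T = {x \<in> carrier (mpoly R). \<exists>F\<in>?H. (\<exists>d. graded R d F) \<and> dehomogenize R F = x}"
  have "ideal T (mpoly R)"
  proof (rule M.ideal_of_closed)
    show "\<zero>\<^bsub>mpoly R\<^esub> \<in> T"
      unfolding T_def using H.zero_closed
      by (auto intro!: bexI[of _ "\<zero>\<^bsub>mpoly R\<^esub>"] exI[of _ 0]) (simp add: graded_def mpoly_simps)
    fix x y assume "x \<in> T" "y \<in> T"
    then obtain F G d e where F: "F \<in> ?H" "graded R d F" "dehomogenize R F = x"
      and G: "G \<in> ?H" "graded R e G" "dehomogenize R G = y" and xy: "x \<in> carrier (mpoly R)" "y \<in> carrier (mpoly R)"
      by (auto simp: T_def)
    \<comment> \<open>Each lift is raised by the degree of the other, so that both reach the degree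
      d + e.\<close>
    obtain F' where F': "F' \<in> ?H" "graded R (e + d) F'" "dehomogenize R F' = x" using lift[OF F(1,2)] F(3) by auto
    obtain G' where G': "G' \<in> ?H" "graded R (d + e) G'" "dehomogenize R G' = y" using lift[OF G(1,2)] G(3) by auto
    have "F' \<oplus>\<^bsub>mpoly R\<^esub> G' \<in> ?H" using F' G' by (intro H.a_closed)
    moreover have "graded R (d + e) (F' \<oplus>\<^bsub>mpoly R\<^esub> G')" using F' G' by (intro graded_add) (simp_all add: add.commute)
    moreover have "dehomogenize R (F' \<oplus>\<^bsub>mpoly R\<^esub> G') = x \<oplus>\<^bsub>mpoly R\<^esub> y"
      using F' G' H.a_subset by (subst deh.hom_add) auto
    ultimately show "x \<oplus>\<^bsub>mpoly R\<^esub> y \<in> T" unfolding T_def using xy by blast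
  next
    fix r x :: "nat ^ 'n \<Rightarrow> 'a" assume r: "r \<in> carrier (mpoly R)" and "x \<in> T"
    then obtain F d where F: "F \<in> ?H" "graded R d F" "dehomogenize R F = x" and x: "x \<in> carrier (mpoly R)"
      by (auto simp: T_def)
    define e where "e = Max (tdeg ` supp R r)"
    have Fc: "F \<in> carrier (mpoly R)" using F H.a_subset by blast
    have "homogenize R r \<otimes>\<^bsub>mpoly R\<^esub> F \<in> ?H" using F r by (intro H.I_l_closed homogenize_closed)
    moreover have "graded R (e + d) (homogenize R r \<otimes>\<^bsub>mpoly R\<^esub> F)"
      using F r Fc by (intro graded_mult homogenize_closed) (simp_all add: homogenize_eq e_def graded_homogenize_to)
    moreover have "dehomogenize R (homogenize R r \<otimes>\<^bsub>mpoly R\<^esub> F) = r \<otimes>\<^bsub>mpoly R\<^esub> x"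
      using F r Fc by (simp add: homogenize_closed dehomogenize_homogenize)
    ultimately show "r \<otimes>\<^bsub>mpoly R\<^esub> x \<in> T" unfolding T_def using r x by blast
  qed (auto simp: T_def)
  moreover have "f ` S \<subseteq> T"
  proof
    fix y assume "y \<in> f ` S"
    then obtain i where i: "i \<in> S" "y = f i" by blast
    have "homogenize R (f i) \<in> ?H" using Z.genideal_self[OF Hsub] i by blast
    moreover have "\<exists>d. graded R d (homogenize R (f i))" unfolding homogenize_eq using graded_homogenize_to by blast
    ultimately show "y \<in> T" unfolding T_def using f i dehomogenize_homogenize by blast
  qed
  ultimately have "Idl\<^bsub>mpoly R\<^esub> (f ` S) \<subseteq> T" by (rule M.genideal_minimal)
  then show ?thesis using x by (auto simp: T_def)
qed

section \<open>Collecting monomial multiples into quotients\<close>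

lemma supp_add: "supp R (f \<oplus>\<^bsub>mpoly R\<^esub> g) \<subseteq> supp R f \<union> supp R g"
  by (auto simp: in_supp_iff mpoly_simps)

text \<open>The monomial factors attached to the same g are added up to the quotient q_g.
  Cancellation can only shrink the support, so the bound \<open>B\<close> holds for each product
  separately, as a standard representation demands.\<close>

lemma comb_representation:
  assumes G: "finite G" "G \<subseteq> carrier (mpoly R)" and p: "p \<in> comb R G B"
  shows "\<exists>q. (\<forall>g\<in>G. q g \<in> carrier (mpoly R)) \<and> p = (\<Oplus>\<^bsub>mpoly R\<^esub>g\<in>G. q g \<otimes>\<^bsub>mpoly R\<^esub> g) \<and>
    (\<forall>g\<in>G. supp R (q g \<otimes>\<^bsub>mpoly R\<^esub> g) \<subseteq> B)"
  using p
proof induction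
  case zero
  interpret M: cring "mpoly R" by (rule mpoly_cring)
  have *: "\<zero>\<^bsub>mpoly R\<^esub> \<otimes>\<^bsub>mpoly R\<^esub> g = \<zero>\<^bsub>mpoly R\<^esub>" if "g \<in> G" for g using that G by auto
  have "(\<Oplus>\<^bsub>mpoly R\<^esub>g\<in>G. \<zero>\<^bsub>mpoly R\<^esub> \<otimes>\<^bsub>mpoly R\<^esub> g) = \<zero>\<^bsub>mpoly R\<^esub>"
    using * by (intro M.add.finprod_one_eqI)
  then have "(\<lambda>t. \<zero>) = (\<Oplus>\<^bsub>mpoly R\<^esub>g\<in>G. \<zero>\<^bsub>mpoly R\<^esub> \<otimes>\<^bsub>mpoly R\<^esub> g)"
    by (simp add: mpoly_simps(2))
  moreover have "supp R (\<zero>\<^bsub>mpoly R\<^esub> \<otimes>\<^bsub>mpoly R\<^esub> g) \<subseteq> B" if "g \<in> G" for g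
    unfolding *[OF that] by (simp add: mpoly_simps supp_def)
  ultimately show ?case by (intro exI[of _ "\<lambda>g. \<zero>\<^bsub>mpoly R\<^esub>"]) simp
next
  case (add p a g u)
  interpret M: cring "mpoly R" by (rule mpoly_cring)
  from add.IH obtain q where q: "\<forall>g\<in>G. q g \<in> carrier (mpoly R)" "\<forall>g\<in>G. supp R (q g \<otimes>\<^bsub>mpoly R\<^esub> g) \<subseteq> B"
    and p: "p = (\<Oplus>\<^bsub>mpoly R\<^esub>g\<in>G. q g \<otimes>\<^bsub>mpoly R\<^esub> g)" by blast
  let ?m = "monom R a u"
  let ?q = "q(g := ?m \<oplus>\<^bsub>mpoly R\<^esub> q g)"
  have gc: "g \<in> carrier (mpoly R)" "q g \<in> carrier (mpoly R)" using add G q by auto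
  have m: "?m \<in> carrier (mpoly R)" using add by simp
  have qg: "?q g \<otimes>\<^bsub>mpoly R\<^esub> g = ?m \<otimes>\<^bsub>mpoly R\<^esub> g \<oplus>\<^bsub>mpoly R\<^esub> q g \<otimes>\<^bsub>mpoly R\<^esub> g"
    using gc m by (simp add: M.l_distr)
  have split: "(\<Oplus>\<^bsub>mpoly R\<^esub>g\<in>G. F g) = F g \<oplus>\<^bsub>mpoly R\<^esub> (\<Oplus>\<^bsub>mpoly R\<^esub>g\<in>G-{g}. F g)"
    if "\<And>g. g \<in> G \<Longrightarrow> F g \<in> carrier (mpoly R)" for F
  proof -
    have "(\<Oplus>\<^bsub>mpoly R\<^esub>g\<in>insert g (G - {g}). F g) = F g \<oplus>\<^bsub>mpoly R\<^esub> (\<Oplus>\<^bsub>mpoly R\<^esub>g\<in>G-{g}. F g)"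
      using that G add.hyps by (intro M.finsum_insert) auto
    then show ?thesis using add.hyps by (simp add: insert_absorb)
  qed
  have c: "?q g' \<otimes>\<^bsub>mpoly R\<^esub> g' \<in> carrier (mpoly R)" "q g' \<otimes>\<^bsub>mpoly R\<^esub> g' \<in> carrier (mpoly R)" if "g' \<in> G" for g'
    using that q G m gc by auto
  have rest: "(\<Oplus>\<^bsub>mpoly R\<^esub>g\<in>G-{g}. ?q g \<otimes>\<^bsub>mpoly R\<^esub> g) = (\<Oplus>\<^bsub>mpoly R\<^esub>g\<in>G-{g}. q g \<otimes>\<^bsub>mpoly R\<^esub> g)"
    using c by (intro M.finsum_cong') auto
  let ?rest = "\<Oplus>\<^bsub>mpoly R\<^esub>g\<in>G-{g}. q g \<otimes>\<^bsub>mpoly R\<^esub> g"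
  have "(\<Oplus>\<^bsub>mpoly R\<^esub>g\<in>G. ?q g \<otimes>\<^bsub>mpoly R\<^esub> g) = ?m \<otimes>\<^bsub>mpoly R\<^esub> g \<oplus>\<^bsub>mpoly R\<^esub> q g \<otimes>\<^bsub>mpoly R\<^esub> g \<oplus>\<^bsub>mpoly R\<^esub> ?rest"
    using split[of "\<lambda>g. ?q g \<otimes>\<^bsub>mpoly R\<^esub> g", OF c(1)] unfolding qg rest .
  also have "\<dots> = ?m \<otimes>\<^bsub>mpoly R\<^esub> g \<oplus>\<^bsub>mpoly R\<^esub> (q g \<otimes>\<^bsub>mpoly R\<^esub> g \<oplus>\<^bsub>mpoly R\<^esub> ?rest)"
    using c(2) m gc by (intro M.a_assoc M.finsum_closed) auto
  also have "q g \<otimes>\<^bsub>mpoly R\<^esub> g \<oplus>\<^bsub>mpoly R\<^esub> ?rest = p"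
    using split[of "\<lambda>g. q g \<otimes>\<^bsub>mpoly R\<^esub> g", OF c(2)] unfolding p by simp
  finally have "(\<Oplus>\<^bsub>mpoly R\<^esub>g\<in>G. ?q g \<otimes>\<^bsub>mpoly R\<^esub> g) = ?m \<otimes>\<^bsub>mpoly R\<^esub> g \<oplus>\<^bsub>mpoly R\<^esub> p" .
  moreover have "supp R (?q g' \<otimes>\<^bsub>mpoly R\<^esub> g') \<subseteq> B" if "g' \<in> G" for g'
  proof (cases "g' = g")
    case True
    have "supp R (?m \<otimes>\<^bsub>mpoly R\<^esub> g) \<subseteq> B"
    proof
      fix t assume "t \<in> supp R (?m \<otimes>\<^bsub>mpoly R\<^esub> g)"
      then obtain v s where "v \<in> supp R ?m" "s \<in> supp R g" "t = v + s"
        using supp_mult[OF m gc(1)] by blast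
      moreover from this have "v = u" by (auto dest: subsetD[OF supp_monom_subset])
      ultimately show "t \<in> B" using add.hyps(4) by blast
    qed
    moreover have "supp R (q g \<otimes>\<^bsub>mpoly R\<^esub> g) \<subseteq> B" using q add.hyps by blast
    ultimately show ?thesis unfolding True qg using supp_add by blast
  next
    case False
    then show ?thesis using q that by simp
  qed
  moreover have "\<forall>g\<in>G. ?q g \<in> carrier (mpoly R)" using q m gc by auto
  ultimately show ?case by (intro exI[of _ ?q]) simp
qed

end

section \<open>Specialization\<close>

context primeideal
begin

lemma specialize_hom:
  assumes "cring R"
  shows "specialize R I \<in> ring_hom (mpoly R) (mpoly (residue_field R I))"
  using map_coeff_hom[OF assms residue_field_cring residue_hom] unfolding specialize_def .

lemma specialize_monom:
  "specialize R I (monom R a s) = monom (residue_field R I) (residue R I a) s"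
  using residue_eq_zero_iff[OF zero_closed] additive_subgroup.zero_closed[OF additive_subgroup_axioms]
  by (auto simp: specialize_def monom_def fun_eq_iff)

lemma specialize_const:
  "specialize R I (const R a) = const (residue_field R I) (residue R I a)"
  by (simp add: const_eq_monom specialize_monom)

lemma specialize_eq_zero_iff:
  assumes "f \<in> carrier (mpoly R)"
  shows "specialize R I f = \<zero>\<^bsub>mpoly (residue_field R I)\<^esub> \<longleftrightarrow> range f \<subseteq> I"
  using assms by (auto simp: specialize_def mpoly_simps fun_eq_iff residue_eq_zero_iff coeff_closed)

text \<open>Denominators are multiplied as terms are added: \<open>b\<close> for the terms treated
  so far and \<open>b'\<close> for the new coefficient give \<open>b \<otimes> b'\<close>, outside
  \<open>I\<close> by primality, and each numerator is scaled by the denominator of the other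
  part.\<close>

lemma clear_denominators:
  fixes X :: "'t::comm_monoid_add \<Rightarrow> ('a set \<times> 'a set) set"
  assumes "X \<in> carrier (mpoly (residue_field R I))"
  shows "\<exists>b\<in>carrier R - I. \<exists>r\<in>carrier (mpoly R).
    const (residue_field R I) (residue R I b) \<otimes>\<^bsub>mpoly (residue_field R I)\<^esub> X = specialize R I r"
proof -
  interpret F: cring "residue_field R I" by (rule residue_field_cring)
  interpret MF: cring "mpoly (residue_field R I) :: ('t \<Rightarrow> _) ring" by (rule F.mpoly_cring)
  interpret M: cring "mpoly R :: ('t \<Rightarrow> _) ring" by (rule mpoly_cring)
  interpret \<phi>: ring_hom_cring R "residue_field R I" "residue R I"
    using residue_hom by unfold_locales
  interpret s: ring_hom_cring "mpoly R :: ('t \<Rightarrow> _) ring" "mpoly (residue_field R I)" "specialize R I"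
    using specialize_hom[OF is_cring] by unfold_locales
  show ?thesis
    using assms
  proof (induction rule: F.mpoly_induct)
    case zero
    have "specialize R I \<zero>\<^bsub>mpoly R\<^esub> = (\<lambda>t :: 't. \<zero>\<^bsub>residue_field R I\<^esub>)"
      using s.hom_zero unfolding mpoly_simps(2) .
    moreover have "\<one> \<in> carrier R - I" using I_notcarr one_imp_carrier by auto
    ultimately show ?case
      by (intro bexI[of _ \<one>] bexI[of _ "\<zero>\<^bsub>mpoly R\<^esub>"]) (auto simp: F.mpoly_mult_zero)
  next
    case (add c s f)
    then obtain b r where b: "b \<in> carrier R - I" and r: "r \<in> carrier (mpoly R)"
      and br: "const (residue_field R I) (residue R I b) \<otimes>\<^bsub>mpoly (residue_field R I)\<^esub> f = specialize R I r" by blast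
    obtain a b' where b': "a \<in> carrier R" "b' \<in> carrier R" "b' \<notin> I"
      "residue R I b' \<otimes>\<^bsub>residue_field R I\<^esub> c = residue R I a"
      using residue_field_cases[OF add(1)] by blast
    let ?\<phi> = "residue R I"
    have "const (residue_field R I) (?\<phi> (b \<otimes> b')) \<otimes>\<^bsub>mpoly (residue_field R I)\<^esub> monom (residue_field R I) c s =
      monom (residue_field R I) (?\<phi> b \<otimes>\<^bsub>residue_field R I\<^esub> (?\<phi> b' \<otimes>\<^bsub>residue_field R I\<^esub> c)) s"
      using add b b' by (simp add: const_eq_monom F.monom_mult_monom F.m_assoc)
    also have "\<dots> = specialize R I (monom R (b \<otimes> a) s)"
      using b b' by (simp add: specialize_monom)
    finally have 1: "const (residue_field R I) (?\<phi> (b \<otimes> b')) \<otimes>\<^bsub>mpoly (residue_field R I)\<^esub> monom (residue_field R I) c s =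
      specialize R I (monom R (b \<otimes> a) s)" .
    have "(const (residue_field R I) (?\<phi> (b \<otimes> b')) :: 't \<Rightarrow> _) = const (residue_field R I) (?\<phi> b') \<otimes>\<^bsub>mpoly (residue_field R I)\<^esub> const (residue_field R I) (?\<phi> b)"
      using b b' by (simp add: const_eq_monom F.monom_mult_monom F.m_comm)
    then have "const (residue_field R I) (?\<phi> (b \<otimes> b')) \<otimes>\<^bsub>mpoly (residue_field R I)\<^esub> f =
      const (residue_field R I) (?\<phi> b') \<otimes>\<^bsub>mpoly (residue_field R I)\<^esub> specialize R I r"
      using MF.m_assoc[of "const (residue_field R I) (?\<phi> b')" "const (residue_field R I) (?\<phi> b)" f] add.hyps(2) b b'
      by (simp del: \<phi>.hom_mult add: br)
    also have "\<dots> = specialize R I (const R b' \<otimes>\<^bsub>mpoly R\<^esub> r)"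
      using b' r by (simp add: specialize_const)
    finally have 2: "const (residue_field R I) (?\<phi> (b \<otimes> b')) \<otimes>\<^bsub>mpoly (residue_field R I)\<^esub> f =
      specialize R I (const R b' \<otimes>\<^bsub>mpoly R\<^esub> r)" .
    have "const (residue_field R I) (?\<phi> (b \<otimes> b')) \<otimes>\<^bsub>mpoly (residue_field R I)\<^esub>
       (monom (residue_field R I) c s \<oplus>\<^bsub>mpoly (residue_field R I)\<^esub> f) =
      specialize R I (monom R (b \<otimes> a) s) \<oplus>\<^bsub>mpoly (residue_field R I)\<^esub> specialize R I (const R b' \<otimes>\<^bsub>mpoly R\<^esub> r)"
      unfolding 1[symmetric] 2[symmetric] using add b b' by (intro MF.r_distr) auto
    also have "\<dots> = specialize R I (monom R (b \<otimes> a) s \<oplus>\<^bsub>mpoly R\<^esub> const R b' \<otimes>\<^bsub>mpoly R\<^esub> r)"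
      using b b' r by simp
    finally show ?case
      using b b' r I_prime by (intro bexI[of _ "b \<otimes> b'"] bexI[of _ "monom R (b \<otimes> a) s \<oplus>\<^bsub>mpoly R\<^esub> const R b' \<otimes>\<^bsub>mpoly R\<^esub> r"]) auto
  qed
qed

text \<open>The generated ideal also contains combinations with fractions as coefficients. The
  polynomials that become specializations from \<open>J\<close> after multiplication by a residue
  outside \<open>I\<close> form an ideal: a sum takes the product of the two denominators, and a
  multiple needs the denominators of its factor cleared as well.\<close>

lemma specialize_ideal_cases:
  fixes J :: "('t::comm_monoid_add \<Rightarrow> 'a) set"
  assumes J: "ideal J (mpoly R)" and X: "X \<in> specialize_ideal R I J"
  shows "\<exists>b\<in>carrier R - I. \<exists>r\<in>J.
    const (residue_field R I) (residue R I b) \<otimes>\<^bsub>mpoly (residue_field R I)\<^esub> X = specialize R I r"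
proof -
  interpret F: cring "residue_field R I" by (rule residue_field_cring)
  interpret MF: cring "mpoly (residue_field R I) :: ('t \<Rightarrow> _) ring" by (rule F.mpoly_cring)
  interpret M: cring "mpoly R :: ('t \<Rightarrow> _) ring" by (rule mpoly_cring)
  interpret \<phi>: ring_hom_cring R "residue_field R I" "residue R I"
    using residue_hom by unfold_locales
  interpret s: ring_hom_cring "mpoly R :: ('t \<Rightarrow> _) ring" "mpoly (residue_field R I)" "specialize R I"
    using specialize_hom[OF is_cring] by unfold_locales
  interpret J: ideal J "mpoly R" by fact
  let ?F = "residue_field R I" and ?\<phi> = "residue R I"
  let ?c = "\<lambda>b. const ?F (?\<phi> b) :: 't \<Rightarrow> _"
  have c_mult: "?c (a \<otimes> b) = ?c a \<otimes>\<^bsub>mpoly ?F\<^esub> ?c b" if "a \<in> carrier R" "b \<in> carrier R" for a b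
    using that by (simp add: const_eq_monom F.monom_mult_monom)
  have c_closed: "?c b \<in> carrier (mpoly ?F)" if "b \<in> carrier R" for b using that by simp
  have one: "\<one> \<in> carrier R - I" using I_notcarr one_imp_carrier by auto
  have c_one: "?c \<one> = \<one>\<^bsub>mpoly ?F\<^esub>" by (simp add: mpoly_simps)
  have Jc: "r \<in> carrier (mpoly R)" if "r \<in> J" for r using that J.a_subset by blast
  define T where "T = {X \<in> carrier (mpoly ?F). \<exists>b\<in>carrier R - I. \<exists>r\<in>J. ?c b \<otimes>\<^bsub>mpoly ?F\<^esub> X = specialize R I r}"
  have "ideal T (mpoly ?F)"
  proof (rule MF.ideal_of_closed)
    have "?c \<one> \<otimes>\<^bsub>mpoly ?F\<^esub> \<zero>\<^bsub>mpoly ?F\<^esub> = specialize R I \<zero>\<^bsub>mpoly R\<^esub>" by simp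
    then show "\<zero>\<^bsub>mpoly ?F\<^esub> \<in> T" unfolding T_def using one J.zero_closed MF.zero_closed by blast
    fix X Y :: "'t \<Rightarrow> ('a set \<times> 'a set) set" assume "X \<in> T" "Y \<in> T"
    then obtain a b r r' where X: "X \<in> carrier (mpoly ?F)" "a \<in> carrier R - I" "r \<in> J" "?c a \<otimes>\<^bsub>mpoly ?F\<^esub> X = specialize R I r"
      and Y: "Y \<in> carrier (mpoly ?F)" "b \<in> carrier R - I" "r' \<in> J" "?c b \<otimes>\<^bsub>mpoly ?F\<^esub> Y = specialize R I r'"
      unfolding T_def by blast
    have "?c (a \<otimes> b) \<otimes>\<^bsub>mpoly ?F\<^esub> X = ?c b \<otimes>\<^bsub>mpoly ?F\<^esub> (?c a \<otimes>\<^bsub>mpoly ?F\<^esub> X)"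
      using X(1,2) Y(1,2) c_closed by (simp add: c_mult MF.m_ac del: \<phi>.hom_mult)
    also have "\<dots> = specialize R I (const R b \<otimes>\<^bsub>mpoly R\<^esub> r)"
      unfolding X(4) using Jc[OF X(3)] Y by (simp add: specialize_const)
    finally have 1: "?c (a \<otimes> b) \<otimes>\<^bsub>mpoly ?F\<^esub> X = specialize R I (const R b \<otimes>\<^bsub>mpoly R\<^esub> r)" .
    have "?c (a \<otimes> b) \<otimes>\<^bsub>mpoly ?F\<^esub> Y = ?c a \<otimes>\<^bsub>mpoly ?F\<^esub> (?c b \<otimes>\<^bsub>mpoly ?F\<^esub> Y)"
      using X(1,2) Y(1,2) c_closed by (simp add: c_mult MF.m_ac del: \<phi>.hom_mult)
    also have "\<dots> = specialize R I (const R a \<otimes>\<^bsub>mpoly R\<^esub> r')"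
      unfolding Y(4) using Jc[OF Y(3)] X by (simp add: specialize_const)
    finally have 2: "?c (a \<otimes> b) \<otimes>\<^bsub>mpoly ?F\<^esub> Y = specialize R I (const R a \<otimes>\<^bsub>mpoly R\<^esub> r')" .
    have ab: "a \<otimes> b \<in> carrier R - I" using X Y I_prime by auto
    have "?c (a \<otimes> b) \<otimes>\<^bsub>mpoly ?F\<^esub> (X \<oplus>\<^bsub>mpoly ?F\<^esub> Y) = ?c (a \<otimes> b) \<otimes>\<^bsub>mpoly ?F\<^esub> X \<oplus>\<^bsub>mpoly ?F\<^esub> ?c (a \<otimes> b) \<otimes>\<^bsub>mpoly ?F\<^esub> Y"
      using X Y c_closed ab by (intro MF.r_distr) auto
    also have "\<dots> = specialize R I (const R b \<otimes>\<^bsub>mpoly R\<^esub> r \<oplus>\<^bsub>mpoly R\<^esub> const R a \<otimes>\<^bsub>mpoly R\<^esub> r')"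
      unfolding 1 2 using X Y Jc by (intro s.hom_add[symmetric]) auto
    finally have "?c (a \<otimes> b) \<otimes>\<^bsub>mpoly ?F\<^esub> (X \<oplus>\<^bsub>mpoly ?F\<^esub> Y) = \<dots>" .
    moreover have "const R b \<otimes>\<^bsub>mpoly R\<^esub> r \<oplus>\<^bsub>mpoly R\<^esub> const R a \<otimes>\<^bsub>mpoly R\<^esub> r' \<in> J"
      using X Y by (intro J.a_closed J.I_l_closed) auto
    moreover have "X \<oplus>\<^bsub>mpoly ?F\<^esub> Y \<in> carrier (mpoly ?F)" using X Y by simp
    ultimately show "X \<oplus>\<^bsub>mpoly ?F\<^esub> Y \<in> T" unfolding T_def using ab by blast
  next
    fix X Y :: "'t \<Rightarrow> ('a set \<times> 'a set) set" assume Y: "Y \<in> carrier (mpoly ?F)" and "X \<in> T"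
    then obtain a r where X: "X \<in> carrier (mpoly ?F)" "a \<in> carrier R - I" "r \<in> J" "?c a \<otimes>\<^bsub>mpoly ?F\<^esub> X = specialize R I r"
      unfolding T_def by blast
    obtain b r' where b: "b \<in> carrier R - I" "r' \<in> carrier (mpoly R)" "?c b \<otimes>\<^bsub>mpoly ?F\<^esub> Y = specialize R I r'"
      using clear_denominators[OF Y] by blast
    have "?c (b \<otimes> a) \<otimes>\<^bsub>mpoly ?F\<^esub> (Y \<otimes>\<^bsub>mpoly ?F\<^esub> X) = (?c b \<otimes>\<^bsub>mpoly ?F\<^esub> Y) \<otimes>\<^bsub>mpoly ?F\<^esub> (?c a \<otimes>\<^bsub>mpoly ?F\<^esub> X)"
      using X(1,2) Y b(1,2) c_closed by (simp add: c_mult MF.m_ac del: \<phi>.hom_mult)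
    also have "\<dots> = specialize R I (r' \<otimes>\<^bsub>mpoly R\<^esub> r)"
      unfolding X(4) b(3) using b Jc[OF X(3)] by simp
    finally have "?c (b \<otimes> a) \<otimes>\<^bsub>mpoly ?F\<^esub> (Y \<otimes>\<^bsub>mpoly ?F\<^esub> X) = \<dots>" .
    moreover have "b \<otimes> a \<in> carrier R - I" using X b I_prime by auto
    moreover have "r' \<otimes>\<^bsub>mpoly R\<^esub> r \<in> J" using X b by (intro J.I_l_closed)
    moreover have "Y \<otimes>\<^bsub>mpoly ?F\<^esub> X \<in> carrier (mpoly ?F)" using X Y by simp
    ultimately show "Y \<otimes>\<^bsub>mpoly ?F\<^esub> X \<in> T" unfolding T_def by blast
  qed (auto simp: T_def)
  moreover have "specialize R I ` J \<subseteq> T"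
  proof
    fix X assume "X \<in> specialize R I ` J"
    then obtain r where r: "r \<in> J" "X = specialize R I r" by blast
    then have "X \<in> carrier (mpoly ?F)" using Jc by simp
    moreover from this have "?c \<one> \<otimes>\<^bsub>mpoly ?F\<^esub> X = specialize R I r" using r by (simp add: c_one del: \<phi>.hom_one)
    ultimately show "X \<in> T" unfolding T_def using one r by blast
  qed
  ultimately have "specialize_ideal R I J \<subseteq> T"
    unfolding specialize_ideal_def by (rule MF.genideal_minimal)
  then show ?thesis using X by (auto simp: T_def)
qed

text \<open>Both maps are ring homomorphisms sending monomials to monomials, and exponents of an
  image are x-parts of old exponents. Distinct elements of \<open>G\<close> may get the same image;
  a combination without named quotients is not affected by this.\<close>

lemma comb_specialize_dehomogenize:
  fixes G :: "((nat ^ 'n) \<times> nat \<Rightarrow> 'a) set"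
  assumes G: "G \<subseteq> carrier (mpoly R)" and p: "p \<in> comb R G B" and B: "fst ` B \<subseteq> B'"
  shows "specialize R I (dehomogenize R p) \<in> comb (residue_field R I) (specialize R I ` dehomogenize R ` G) B'"
proof -
  interpret F: cring "residue_field R I" by (rule residue_field_cring)
  interpret MF: cring "mpoly (residue_field R I) :: (nat ^ 'n \<Rightarrow> _) ring" by (rule F.mpoly_cring)
  interpret M: cring "mpoly R :: (nat ^ 'n \<Rightarrow> _) ring" by (rule mpoly_cring)
  interpret Z: cring "mpoly R :: ((nat ^ 'n) \<times> nat \<Rightarrow> 'a) ring" by (rule mpoly_cring)
  interpret \<phi>: ring_hom_cring R "residue_field R I" "residue R I"
    using residue_hom by unfold_locales
  interpret s: ring_hom_cring "mpoly R :: (nat ^ 'n \<Rightarrow> _) ring" "mpoly (residue_field R I)" "specialize R I"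
    using specialize_hom[OF is_cring] by unfold_locales
  interpret deh: ring_hom_cring "mpoly R :: ((nat ^ 'n) \<times> nat \<Rightarrow> 'a) ring" "mpoly R" "dehomogenize R"
    using dehomogenize_hom[OF is_cring] by unfold_locales
  show ?thesis
    using p
  proof induction
    case zero
    have "specialize R I (dehomogenize R (\<zero>\<^bsub>mpoly R\<^esub> :: (nat ^ 'n) \<times> nat \<Rightarrow> 'a)) = \<zero>\<^bsub>mpoly (residue_field R I)\<^esub>"
      unfolding deh.hom_zero s.hom_zero ..
    then show ?case unfolding mpoly_simps(2) by (simp add: comb.zero)
  next
    case (add p a g u)
    have gc: "g \<in> carrier (mpoly R)" using add G by blast
    have pc: "p \<in> carrier (mpoly R)" using comb_closed[OF G add.hyps(1)] .
    let ?g = "specialize R I (dehomogenize R g)"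
    have "specialize R I (dehomogenize R (monom R a u)) = monom (residue_field R I) (residue R I a) (fst u)"
      using dehomogenize_monom[OF is_cring add.hyps(2), of "fst u" "snd u"] by (simp add: specialize_monom)
    then have eq: "specialize R I (dehomogenize R (monom R a u \<otimes>\<^bsub>mpoly R\<^esub> g \<oplus>\<^bsub>mpoly R\<^esub> p)) =
      monom (residue_field R I) (residue R I a) (fst u) \<otimes>\<^bsub>mpoly (residue_field R I)\<^esub> ?g
        \<oplus>\<^bsub>mpoly (residue_field R I)\<^esub> specialize R I (dehomogenize R p)"
      using add gc pc by simp
    show ?case
      unfolding eq
    proof (rule comb.add[OF add.IH])
      show "\<forall>s\<in>supp (residue_field R I) ?g. fst u + s \<in> B'"
      proof
        fix s assume s: "s \<in> supp (residue_field R I) ?g"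
        have "\<exists>k. (s, k) \<in> supp R g"
        proof (rule ccontr)
          assume "\<not> ?thesis"
          then have "dehomogenize R g s = \<zero>" by (simp add: dehomogenize_def)
          then show False using s by (simp add: specialize_def in_supp_iff)
        qed
        then obtain k where "u + (s, k) \<in> B" using add.hyps(4) by blast
        then show "fst u + s \<in> B'" using B by (force simp: plus_prod_def)
      qed
    qed (use add in auto)
  qed
qed

end

section \<open>The standard basis after specialization\<close>

text \<open>In a fixed degree the tie-break by \<open>lt\<close> is all that remains of
  \<open>lt_xz lt\<close>, and the x-part determines the power of z. Hence the leading terms before
  and after z = 1 correspond.\<close>

lemma graded_mono_lexp:
  assumes lt: "monomial_order lt"
    and R: "cring R" and g: "g \<in> carrier (mpoly R)" "graded R d g" "g \<noteq> \<zero>\<^bsub>mpoly R\<^esub>"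
  shows "tdeg (fst (lexp R (lt_xz lt) g)) + snd (lexp R (lt_xz lt) g) = d"
    and "s \<in> supp R g \<Longrightarrow> tdeg (fst s) + snd s = d"
    and "s \<in> supp R g \<Longrightarrow> lt (fst s) (fst (lexp R (lt_xz lt) g)) \<or> fst s = fst (lexp R (lt_xz lt) g)"
    and "lc R lt (dehomogenize R g) = lc R (lt_xz lt) g"
proof -
  interpret R: cring R by fact
  let ?m = "lexp R (lt_xz lt) g"
  have ne: "supp R g \<noteq> {}" using g(3) by (auto simp: supp_def mpoly_simps fun_eq_iff)
  note m = lexp_in_supp_max[OF monomial_order_lt_xz[OF lt] finite_supp[OF g(1)] ne]
  have deg: "tdeg (fst s) + snd s = d" if "s \<in> supp R g" for s
    using that g(2) unfolding graded_def in_supp_iff by (metis prod.collapse)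
  show "s \<in> supp R g \<Longrightarrow> tdeg (fst s) + snd s = d" by (rule deg)
  show degm: "tdeg (fst ?m) + snd ?m = d" using m(1) by (rule deg)
  have le: "lt (fst s) (fst ?m) \<or> fst s = fst ?m" if "s \<in> supp R g" for s
    using m(2)[OF that] deg[OF that] degm by (auto simp: lt_xz_def split: prod.splits)
  then show "s \<in> supp R g \<Longrightarrow> lt (fst s) (fst ?m) \<or> fst s = fst ?m" .
  have m_eq: "(fst ?m, d - tdeg (fst ?m)) = ?m" using degm by (metis add_diff_cancel_left' prod.collapse)
  have val: "dehomogenize R g (fst ?m) = g ?m"
    using R.dehomogenize_graded[OF g(1,2), of "fst ?m"] degm m_eq by (metis le_add1)
  have "lexp R lt (dehomogenize R g) = fst ?m"
  proof (rule lexp_eqI[OF lt])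
    show "fst ?m \<in> supp R (dehomogenize R g)" using val m(1) by (simp add: in_supp_iff)
    fix \<alpha> assume "\<alpha> \<in> supp R (dehomogenize R g)"
    then have "(\<alpha>, d - tdeg \<alpha>) \<in> supp R g"
      using R.dehomogenize_graded[OF g(1,2), of \<alpha>] by (auto simp: in_supp_iff split: if_splits)
    from le[OF this] show "lt \<alpha> (fst ?m) \<or> \<alpha> = fst ?m" by simp
  qed
  then show "lc R lt (dehomogenize R g) = lc R (lt_xz lt) g" by (simp add: lc_def val)
qed

text \<open>An ideal absorbs a product as soon as it contains one factor; this turns the avoidance
  of h into that of each leading coefficient.\<close>

lemma (in primeideal) finprod_notin:
  assumes "cring R" "finite S" "\<And>x. x \<in> S \<Longrightarrow> f x \<in> carrier R" "(\<Otimes>x\<in>S. f x) \<notin> I" "x \<in> S"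
  shows "f x \<notin> I"
proof
  assume "f x \<in> I"
  have "(\<Otimes>y\<in>insert x (S - {x}). f y) = f x \<otimes> (\<Otimes>y\<in>S - {x}. f y)"
    using assms by (intro finprod_insert) auto
  then have "(\<Otimes>x\<in>S. f x) = f x \<otimes> (\<Otimes>y\<in>S - {x}. f y)" using assms(5) by (simp add: insert_absorb)
  also have "\<dots> \<in> I" using \<open>f x \<in> I\<close> assms by (intro I_r_closed finprod_closed) auto
  finally show False using assms(4) by simp
qed

theorem theorem3p2p1:
  fixes K :: "('k, 'b) ring_scheme"
    and A :: "(nat ^ 'm \<Rightarrow> 'k) ring"
    and Ax :: "(nat ^ 'n \<Rightarrow> nat ^ 'm \<Rightarrow> 'k) ring"
    and Axz :: "((nat ^ 'n) \<times> nat \<Rightarrow> nat ^ 'm \<Rightarrow> 'k) ring"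
    and lt0 :: "nat ^ 'm \<Rightarrow> nat ^ 'm \<Rightarrow> bool"
    and lt :: "nat ^ 'n \<Rightarrow> nat ^ 'n \<Rightarrow> bool"
    and f :: "nat \<Rightarrow> nat ^ 'n \<Rightarrow> nat ^ 'm \<Rightarrow> 'k" and q :: nat
    and J :: "(nat ^ 'n \<Rightarrow> nat ^ 'm \<Rightarrow> 'k) set"
    and HJ J' G :: "((nat ^ 'n) \<times> nat \<Rightarrow> nat ^ 'm \<Rightarrow> 'k) set"
    and Q :: "(nat ^ 'm \<Rightarrow> 'k) set"
    and GG :: "(nat ^ 'n \<Rightarrow> nat ^ 'm \<Rightarrow> 'k) set"
    and h :: "nat ^ 'm \<Rightarrow> 'k"
  assumes "field K"
    and "A = mpoly K" and "Ax = mpoly A" and "Axz = mpoly A"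
    and "monomial_order lt0" and "wfp lt0"
    and "monomial_order lt" and "\<not> wfp lt"
    and "\<forall>i\<in>{1..q}. f i \<in> carrier Ax"
    and "J = Idl\<^bsub>Ax\<^esub> (f ` {1..q})"
    and "primeideal Q A"
    and "HJ = Idl\<^bsub>Axz\<^esub> ((\<lambda>i. homogenize A (f i)) ` {1..q})"
    and "J' = HJ <+>\<^bsub>Axz\<^esub> Idl\<^bsub>Axz\<^esub> (const A ` Q)"
    and "standard_basis K (lt_axz lt0 lt) (flatten ` J') (flatten ` G)"
    and "\<forall>g\<in>G. homogeneous A g"
    and "GG = dehomogenize A ` (G - const A ` Q)"
    and "h = (\<Otimes>\<^bsub>A\<^esub>g\<in>GG. lc A lt g)"
  shows "\<exists>h'\<in>carrier A - Q. \<forall>P \<in> V A Q - V A (PIdl\<^bsub>A\<^esub> (h \<otimes>\<^bsub>A\<^esub> h')).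
           standard_basis (residue_field A P) lt (specialize_ideal A P J) (specialize A P ` GG)"
proof -
  note A_eq = assms(2) and Ax_eq = assms(3) and Axz_eq = assms(4)
    and lt0 = assms(5) and lt = assms(7) and f = assms(9) and J_eq = assms(10)
    and Q = assms(11) and HJ_eq = assms(12) and J'_eq = assms(13) and sb = assms(14)
    and homog = assms(15) and GG_eq = assms(16) and h_eq = assms(17)
  interpret K: field K by fact
  interpret A: domain A unfolding A_eq by (rule K.mpoly_domain[OF lt0])
  interpret Ax: cring "mpoly A :: (nat ^ 'n \<Rightarrow> nat ^ 'm \<Rightarrow> 'k) ring" by (rule A.mpoly_cring)
  interpret Axz: cring "mpoly A :: ((nat ^ 'n) \<times> nat \<Rightarrow> nat ^ 'm \<Rightarrow> 'k) ring" by (rule A.mpoly_cring)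
  interpret Q: primeideal Q A by (rule Q)
  interpret deh: ring_hom_cring "mpoly A :: ((nat ^ 'n) \<times> nat \<Rightarrow> nat ^ 'm \<Rightarrow> 'k) ring" "mpoly A" "dehomogenize A"
    using dehomogenize_hom[OF A.is_cring] by unfold_locales
  have fc: "f ` {1..q} \<subseteq> carrier (mpoly A)" using f unfolding Ax_eq by blast
  then have Hfc: "(\<lambda>i. homogenize A (f i)) ` {1..q} \<subseteq> carrier (mpoly A)" by (auto intro: A.homogenize_closed)
  have Qc: "const A ` Q \<subseteq> (carrier (mpoly A) :: ((nat ^ 'n) \<times> nat \<Rightarrow> _) set)" using Q.a_subset by auto
  interpret J: ideal J "mpoly A" unfolding J_eq Ax_eq using fc by (rule Ax.genideal_ideal)
  interpret HJ: ideal HJ "mpoly A" unfolding HJ_eq Axz_eq using Hfc by (rule Axz.genideal_ideal)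
  let ?QI = "Idl\<^bsub>mpoly A\<^esub> (const A ` Q) :: ((nat ^ 'n) \<times> nat \<Rightarrow> _) set"
  interpret QI: ideal ?QI "mpoly A" using Qc by (rule Axz.genideal_ideal)
  have J'_sum: "J' = HJ <+>\<^bsub>mpoly A\<^esub> ?QI" unfolding J'_eq Axz_eq ..
  interpret J': ideal J' "mpoly A"
    unfolding J'_sum by (rule Axz.add_ideals[OF HJ.ideal_axioms QI.ideal_axioms])
  have HJ_J': "HJ \<subseteq> J'"
  proof
    fix x assume "x \<in> HJ"
    then have "x = x \<oplus>\<^bsub>mpoly A\<^esub> \<zero>\<^bsub>mpoly A\<^esub>" using HJ.a_subset by auto
    then show "x \<in> J'" unfolding J'_sum set_add_def' using \<open>x \<in> HJ\<close> QI.zero_closed by blast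
  qed
  have Q_J': "const A ` Q \<subseteq> J'"
  proof
    fix x :: "(nat ^ 'n) \<times> nat \<Rightarrow> _" assume "x \<in> const A ` Q"
    then have "x \<in> ?QI" using Axz.genideal_self[OF Qc] by blast
    moreover from this have "x = \<zero>\<^bsub>mpoly A\<^esub> \<oplus>\<^bsub>mpoly A\<^esub> x" using QI.a_subset by auto
    ultimately show "x \<in> J'" unfolding J'_sum set_add_def' using HJ.zero_closed by blast
  qed
  have G: "G \<subseteq> J'" "finite G"
    using sb inj_image_subset_iff[OF inj_flatten, of G J']
      finite_imageD[OF _ inj_on_subset[OF inj_flatten subset_UNIV], of G]
    unfolding standard_basis_def by blast+
  define G0 where "G0 = G - const A ` Q"
  have G0: "G0 \<subseteq> J'" "finite G0" "G0 \<subseteq> carrier (mpoly A)" using G J'.a_subset by (auto simp: G0_def)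
  have GG: "GG = dehomogenize A ` G0" using GG_eq by (simp add: G0_def)
  have G0_graded: "\<exists>d. graded A d g" if "g \<in> G0" for g
    using homog that by (auto simp: G0_def homogeneous_def graded_def)
  \<comment> \<open>Zero is the constant of an element of \<open>Q\<close>, so removing
    \<open>Q\<close> has removed it, and leading exponents are meaningful on
    \<open>G0\<close>.\<close>
  have G0_nonzero: "g \<noteq> \<zero>\<^bsub>mpoly A\<^esub>" if "g \<in> G0" for g
  proof
    assume "g = \<zero>\<^bsub>mpoly A\<^esub>"
    then have "g = const A \<zero>\<^bsub>A\<^esub>" by (auto simp: mpoly_simps const_def)
    then show False using that Q.zero_closed unfolding G0_def by blast
  qed
  show ?thesis
  proof (intro bexI[of _ "\<one>\<^bsub>A\<^esub>"] ballI)
    show "\<one>\<^bsub>A\<^esub> \<in> carrier A - Q" using Q.I_notcarr Q.one_imp_carrier by auto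
    fix P assume "P \<in> V A Q - V A (PIdl\<^bsub>A\<^esub> (h \<otimes>\<^bsub>A\<^esub> \<one>\<^bsub>A\<^esub>))"
    then have P: "primeideal P A" and QP: "Q \<subseteq> P" and hP': "\<not> PIdl\<^bsub>A\<^esub> (h \<otimes>\<^bsub>A\<^esub> \<one>\<^bsub>A\<^esub>) \<subseteq> P"
      by (auto simp: V_def)
    interpret P: primeideal P A by (rule P)
    let ?F = "residue_field A P"
    interpret F: cring ?F by (rule P.residue_field_cring)
    interpret Fx: cring "mpoly ?F :: (nat ^ 'n \<Rightarrow> _) ring" by (rule F.mpoly_cring)
    interpret \<phi>: ring_hom_cring A ?F "residue A P"
      using P.residue_hom by unfold_locales
    interpret sp: ring_hom_cring "mpoly A :: (nat ^ 'n \<Rightarrow> _) ring" "mpoly ?F" "specialize A P"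
      using P.specialize_hom[OF A.is_cring] by unfold_locales
    have GGc: "GG \<subseteq> carrier (mpoly A)" unfolding GG using G0 by auto
    have lc_closed: "lc A lt g \<in> carrier A" if "g \<in> GG" for g
      using that GGc by (auto simp: lc_def intro: coeff_closed)
    then have hc: "h \<in> carrier A" unfolding h_eq by (intro A.finprod_closed) auto
    then have hP: "h \<notin> P" using hP' A.cgenideal_minimal[OF P.ideal_axioms, of h] by auto
    \<comment> \<open>The product h is formed for \<open>lt\<close> after z = 1, while the division
      uses \<open>lt_xz lt\<close>; for homogeneous elements the leading coefficients
      coincide.\<close>
    have lcP: "lc A (lt_xz lt) g \<notin> P" if g: "g \<in> G0" for g
    proof -
      obtain d where "graded A d g" using G0_graded[OF g] by blast
      then have "lc A (lt_xz lt) g = lc A lt (dehomogenize A g)"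
        using graded_mono_lexp(4)[OF lt A.is_cring _ _ G0_nonzero[OF g]] g G0(3) by auto
      moreover have "lc A lt (dehomogenize A g) \<notin> P"
        using P.finprod_notin[OF A.is_cring, of GG "lc A lt"] hP lc_closed g G0(2)
        unfolding h_eq GG by blast
      ultimately show ?thesis by simp
    qed
    let ?I = "specialize_ideal A P J"
    have sJ: "specialize A P ` J \<subseteq> carrier (mpoly ?F)" using J.a_subset by auto
    interpret I: ideal ?I "mpoly ?F"
      unfolding specialize_ideal_def using sJ by (rule Fx.genideal_ideal)
    have J_I: "specialize A P x \<in> ?I" if "x \<in> J" for x
      unfolding specialize_ideal_def using Fx.genideal_self[OF sJ] that by blast
    let ?sd = "\<lambda>p. specialize A P (dehomogenize A p)"
    \<comment> \<open>The preimage of (J)_P under z = 1 followed by specialization. It contains the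
      H(f_i), which return to the f_i, and the constants from \<open>Q\<close>, which vanish since
      \<open>Q\<close> lies in \<open>P\<close>; hence all of \<open>J'\<close> and in particular
      the basis.\<close>
    define T where "T = {p \<in> carrier (mpoly A). ?sd p \<in> ?I}"
    have "ideal T (mpoly A)"
    proof (rule Axz.ideal_of_closed)
      show "\<zero>\<^bsub>mpoly A\<^esub> \<in> T" unfolding T_def using I.zero_closed by simp
      show "x \<oplus>\<^bsub>mpoly A\<^esub> y \<in> T" if "x \<in> T" "y \<in> T" for x y
        using that I.a_closed unfolding T_def by simp
      show "x \<otimes>\<^bsub>mpoly A\<^esub> y \<in> T" if "x \<in> carrier (mpoly A)" "y \<in> T" for x y
        using that I.I_l_closed[of "?sd y" "?sd x"] unfolding T_def by simp
    qed (auto simp: T_def)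
    then interpret T: ideal T "mpoly A" .
    have "HJ \<subseteq> T"
      unfolding HJ_eq Axz_eq
    proof (rule Axz.genideal_minimal[OF T.ideal_axioms], clarify)
      fix i assume i: "i \<in> {1..q}"
      then have "f i \<in> J" unfolding J_eq Ax_eq using Ax.genideal_self[OF fc] by blast
      then show "homogenize A (f i) \<in> T"
        unfolding T_def using J.a_subset J_I by (auto simp: A.homogenize_closed A.dehomogenize_homogenize)
    qed
    have "?QI \<subseteq> T"
    proof (rule Axz.genideal_minimal[OF T.ideal_axioms], clarify)
      fix c assume c: "c \<in> Q"
      then have cA: "c \<in> carrier A" using Q.a_subset by blast
      have "dehomogenize A (const A c :: (nat ^ 'n) \<times> nat \<Rightarrow> _) = const A c"
        using dehomogenize_monom[OF A.is_cring cA, of 0 0] by (simp add: const_eq_monom zero_prod_def)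
      moreover have "specialize A P (const A c) = (\<zero>\<^bsub>mpoly ?F\<^esub> :: nat ^ 'n \<Rightarrow> _)"
        using P.residue_eq_zero_iff[OF cA] c QP
        unfolding P.specialize_const by (auto simp: const_def mpoly_simps(2) fun_eq_iff)
      ultimately show "const A c \<in> T" unfolding T_def using cA I.zero_closed by simp
    qed
    have "J' \<subseteq> T"
    proof
      fix x assume "x \<in> J'"
      then obtain y z where "y \<in> HJ" "z \<in> ?QI" "x = y \<oplus>\<^bsub>mpoly A\<^esub> z"
        unfolding J'_sum set_add_def' by blast
      then show "x \<in> T" using T.a_closed[OF subsetD[OF \<open>HJ \<subseteq> T\<close>] subsetD[OF \<open>?QI \<subseteq> T\<close>]] by simp
    qed
    then have sd_I: "?sd g \<in> ?I" if "g \<in> J'" for g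
      using subsetD[OF _ that] unfolding T_def by blast
    have GI: "specialize A P ` GG \<subseteq> ?I"
    proof
      fix x assume "x \<in> specialize A P ` GG"
      then obtain g where g: "g \<in> G0" "x = ?sd g" unfolding GG by blast
      show "x \<in> ?I" unfolding g(2) by (rule sd_I[OF subsetD[OF G0(1) g(1)]])
    qed
    have sGGc: "specialize A P ` GG \<subseteq> carrier (mpoly ?F)" using GGc by auto
    have fin: "finite (specialize A P ` GG)" unfolding GG using G0(2) by simp
    show "standard_basis ?F lt ?I (specialize A P ` GG)"
      unfolding standard_basis_def
    proof (intro conjI fin GI ballI impI)
      fix X assume X: "X \<in> ?I" "X \<noteq> \<zero>\<^bsub>mpoly ?F\<^esub>"
      have Xc: "X \<in> carrier (mpoly ?F)" using X(1) I.a_subset by blast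
      define B' where "B' = {\<beta>. lt \<beta> (lexp ?F lt X) \<or> \<beta> = lexp ?F lt X}"
      obtain b r where b: "b \<in> carrier A" "b \<notin> P" and r: "r \<in> J"
        and br: "const ?F (residue A P b) \<otimes>\<^bsub>mpoly ?F\<^esub> X = specialize A P r"
        using P.specialize_ideal_cases[OF J.ideal_axioms X(1)] by blast
      \<comment> \<open>\<open>HJ\<close> is generated by the H(f_i) only, so H(r) need not belong
        to it; some homogeneous lift of \<open>r\<close> does.\<close>
      obtain R d where R: "R \<in> HJ" "graded A d R" "dehomogenize A R = r"
        using A.homogeneous_preimage[of "{1..q}" f r] fc r unfolding J_eq HJ_eq Ax_eq Axz_eq by blast
      have Rc: "R \<in> carrier (mpoly A)" using R(1) HJ.a_subset by blast
      txt \<open>The part of \<open>R\<close> that vanishes modulo \<open>P\<close> is divided separately, so that the quotients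
        of the remaining part \<open>R1\<close> are bounded by the leading exponent of \<open>X\<close>.\<close>
      define R1 where "R1 = (\<lambda>t. if R t \<in> P then \<zero>\<^bsub>A\<^esub> else R t)"
      define R2 where "R2 = (\<lambda>t. if R t \<in> P then R t else \<zero>\<^bsub>A\<^esub>)"
      have R12c: "R1 \<in> carrier (mpoly A)" "R2 \<in> carrier (mpoly A)"
        using Rc by (auto intro!: mpoly_carrierI[of _ _ "supp A R"]
            simp: R1_def R2_def in_supp_iff coeff_closed finite_supp split: if_splits)
      have R12: "R = R1 \<oplus>\<^bsub>mpoly A\<^esub> R2"
        using Rc by (auto simp: R1_def R2_def mpoly_simps(3)[of A] coeff_closed)
      have R2P: "range R2 \<subseteq> P" using P.zero_closed by (auto simp: R2_def)
      \<comment> \<open>Exponents of degree \<open>d\<close> whose x-part lies in \<open>C\<close>: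
        the set \<open>C\<close> is \<open>B'\<close> for \<open>R1\<close> and everything for
        \<open>R2\<close>, on which only the degree is imposed.\<close>
      define Bd where "Bd C = {t :: (nat ^ 'n) \<times> nat. tdeg (fst t) + snd t = d \<and> fst t \<in> C}" for C
      have B_closed: "\<forall>s\<in>supp A g. u + s \<in> Bd C"
        if g: "g \<in> G0" and u: "u + lexp A (lt_xz lt) g \<in> Bd C" and C: "\<And>\<alpha> \<beta>. \<beta> \<in> C \<Longrightarrow> lt \<alpha> \<beta> \<Longrightarrow> \<alpha> \<in> C"
        for g u and C :: "(nat ^ 'n) set"
      proof
        fix s assume s: "s \<in> supp A g"
        obtain e where e: "graded A e g" using G0_graded[OF g] by blast
        have gc: "g \<in> carrier (mpoly A)" using g G0 by blast
        note gl = graded_mono_lexp[OF lt A.is_cring gc e G0_nonzero[OF g]]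
        have "lt (fst u + fst s) (fst u + fst (lexp A (lt_xz lt) g)) \<or>
          fst u + fst s = fst u + fst (lexp A (lt_xz lt) g)"
          using monomial_order_add_mono[OF lt _ gl(3)[OF s], of "fst u" "fst u"] by auto
        then have "fst u + fst s \<in> C" using u C by (auto simp: Bd_def)
        moreover have "tdeg (fst u + fst s) + (snd u + snd s) = d"
          using u gl(1) gl(2)[OF s] by (simp add: Bd_def tdeg_add)
        ultimately show "u + s \<in> Bd C" by (simp add: Bd_def)
      qed
      have B'_down: "\<forall>\<alpha> \<beta>. \<beta> \<in> B' \<longrightarrow> lt \<alpha> \<beta> \<longrightarrow> \<alpha> \<in> B'"
        using lt unfolding B'_def monomial_order_def by (auto dest: transpD)
      have UNIV_down: "\<forall>\<alpha> \<beta>. \<beta> \<in> UNIV \<longrightarrow> lt \<alpha> \<beta> \<longrightarrow> \<alpha> \<in> UNIV" by simp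
      have R_deg: "tdeg (fst t) + snd t = d" if "t \<in> supp A R" for t
        using that R(2) unfolding graded_def in_supp_iff by (metis prod.collapse)
      \<comment> \<open>By homogeneity a coefficient of \<open>R\<close> is also the coefficient of
        \<open>r\<close> at the x-part. Outside \<open>P\<close> it stays nonzero in the
        specialization of \<open>r\<close>, a scalar multiple of \<open>X\<close>, so its x-part is
        an exponent of \<open>X\<close>.\<close>
      have R1_B: "supp A R1 \<subseteq> Bd B'"
      proof
        fix t assume "t \<in> supp A R1"
        then have t: "R t \<notin> P" "t \<in> supp A R" by (auto simp: R1_def in_supp_iff split: if_splits)
        have "(fst t, d - tdeg (fst t)) = t" "tdeg (fst t) \<le> d" using R_deg[OF t(2)] by (auto simp: prod_eq_iff)
        then have "r (fst t) = R t" using A.dehomogenize_graded[OF Rc R(2), of "fst t"] R(3) by simp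
        then have "specialize A P r (fst t) \<noteq> \<zero>\<^bsub>?F\<^esub>"
          using t(1) P.residue_eq_zero_iff[OF coeff_closed[OF Rc]] by (simp add: specialize_def)
        moreover have "specialize A P r (fst t) = residue A P b \<otimes>\<^bsub>?F\<^esub> X (fst t)"
          unfolding br[symmetric] using b Xc by (intro F.coeff_const_mult) auto
        ultimately have "fst t \<in> supp ?F X" using b by (auto simp: in_supp_iff)
        then have "fst t \<in> B'"
          unfolding B'_def using lexp_in_supp_max(2)[OF lt finite_supp[OF Xc]] by blast
        then show "t \<in> Bd B'" using R_deg[OF t(2)] by (simp add: Bd_def)
      qed
      have R2_B: "supp A R2 \<subseteq> Bd UNIV"
        using R_deg by (auto simp: Bd_def R2_def in_supp_iff split: if_splits)
      have division: "\<exists>c\<in>carrier A - P. \<exists>p\<in>comb A G0 (Bd C). \<exists>r\<in>carrier (mpoly A).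
          const A c \<otimes>\<^bsub>mpoly A\<^esub> D = p \<oplus>\<^bsub>mpoly A\<^esub> r \<and> supp A r \<subseteq> Bd C \<and>
          (\<forall>g\<in>G0. \<forall>u. u + lexp A (lt_xz lt) g \<notin> supp A r) \<and> (range D \<subseteq> P \<longrightarrow> range r \<subseteq> P)"
        if D: "D \<in> carrier (mpoly A)" "supp A D \<subseteq> Bd C" and C: "\<forall>\<alpha> \<beta>. \<beta> \<in> C \<longrightarrow> lt \<alpha> \<beta> \<longrightarrow> \<alpha> \<in> C" for C D
        by (rule A.pseudo_division[OF P monomial_order_lt_xz[OF lt] wfp_lt_xz[OF lt] G0(3) _ _ D])
          (erule lcP, erule (1) B_closed, erule (1) C[rule_format])
      obtain c1 p1 r1 where c1: "c1 \<in> carrier A - P" and p1: "p1 \<in> comb A G0 (Bd B')"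
        and r1: "r1 \<in> carrier (mpoly A)" and eq1: "const A c1 \<otimes>\<^bsub>mpoly A\<^esub> R1 = p1 \<oplus>\<^bsub>mpoly A\<^esub> r1"
        and r1': "supp A r1 \<subseteq> Bd B'" "\<forall>g\<in>G0. \<forall>u. u + lexp A (lt_xz lt) g \<notin> supp A r1"
        using division[OF R12c(1) R1_B B'_down] by (elim bexE conjE) (rule that; assumption)
      obtain c2 p2 r2 where c2: "c2 \<in> carrier A - P" and p2: "p2 \<in> comb A G0 (Bd UNIV)"
        and r2: "r2 \<in> carrier (mpoly A)" and eq2: "const A c2 \<otimes>\<^bsub>mpoly A\<^esub> R2 = p2 \<oplus>\<^bsub>mpoly A\<^esub> r2"
        and r2_off: "\<forall>g\<in>G0. \<forall>u. u + lexp A (lt_xz lt) g \<notin> supp A r2"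
        and "range R2 \<subseteq> P \<longrightarrow> range r2 \<subseteq> P"
        using division[OF R12c(2) R2_B UNIV_down] by (elim bexE conjE) (rule that; assumption)
      then have r2P: "range r2 \<subseteq> P" using R2P by blast
      have pc: "p1 \<in> carrier (mpoly A)" "p2 \<in> carrier (mpoly A)"
        using A.comb_closed[OF G0(3)] p1 p2 by blast+
      have pJ: "p1 \<in> J'" "p2 \<in> J'" using A.comb_subset_ideal[OF J'.ideal_axioms G0(1)] p1 p2 by blast+
      let ?c1 = "const A c1 :: (nat ^ 'n) \<times> nat \<Rightarrow> _" and ?c2 = "const A c2 :: (nat ^ 'n) \<times> nat \<Rightarrow> _"
      have cc: "?c1 \<in> carrier (mpoly A)" "?c2 \<in> carrier (mpoly A)" using c1 c2 by auto
      \<comment> \<open>The two divisions have different multipliers; each remainder is scaled by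
        the other multiplier so that together they belong to the division of c1 c2 R.\<close>
      define r12 where "r12 = ?c2 \<otimes>\<^bsub>mpoly A\<^esub> r1 \<oplus>\<^bsub>mpoly A\<^esub> ?c1 \<otimes>\<^bsub>mpoly A\<^esub> r2"
      have r12_eq: "r12 t = c2 \<otimes>\<^bsub>A\<^esub> r1 t \<oplus>\<^bsub>A\<^esub> c1 \<otimes>\<^bsub>A\<^esub> r2 t" for t
        using c1 c2 r1 r2 by (simp add: r12_def mpoly_simps(3)[of A] A.coeff_const_mult)
      have "?c1 \<otimes>\<^bsub>mpoly A\<^esub> ?c2 \<otimes>\<^bsub>mpoly A\<^esub> R =
        ?c2 \<otimes>\<^bsub>mpoly A\<^esub> (?c1 \<otimes>\<^bsub>mpoly A\<^esub> R1) \<oplus>\<^bsub>mpoly A\<^esub> ?c1 \<otimes>\<^bsub>mpoly A\<^esub> (?c2 \<otimes>\<^bsub>mpoly A\<^esub> R2)"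
        unfolding R12 using cc R12c by algebra
      also have "\<dots> = ?c2 \<otimes>\<^bsub>mpoly A\<^esub> p1 \<oplus>\<^bsub>mpoly A\<^esub> ?c1 \<otimes>\<^bsub>mpoly A\<^esub> p2 \<oplus>\<^bsub>mpoly A\<^esub> r12"
        unfolding eq1 eq2 r12_def using cc pc r1 r2 by algebra
      finally have "r12 = ?c1 \<otimes>\<^bsub>mpoly A\<^esub> ?c2 \<otimes>\<^bsub>mpoly A\<^esub> R \<oplus>\<^bsub>mpoly A\<^esub>
          \<ominus>\<^bsub>mpoly A\<^esub> (?c2 \<otimes>\<^bsub>mpoly A\<^esub> p1 \<oplus>\<^bsub>mpoly A\<^esub> ?c1 \<otimes>\<^bsub>mpoly A\<^esub> p2)"
        using cc pc r1 r2 unfolding r12_def by algebra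
      also have "\<dots> \<in> J'"
        using cc pJ R(1) HJ_J' by (intro J'.a_closed J'.a_inv_closed J'.I_l_closed) auto
      finally have r12J: "r12 \<in> J'" .
      have "supp A r12 \<subseteq> supp A r1 \<union> supp A r2"
        using c1 c2 by (auto simp: in_supp_iff r12_eq)
      then have "\<forall>g\<in>G - const A ` Q. \<forall>u. u + lexp A (lt_xz lt) g \<notin> supp A r12"
        using r1'(2) r2_off unfolding G0_def by blast
      then have "range r12 \<subseteq> Q"
        using standard_basis_remainder[OF K.domain_axioms A_eq lt0 monomial_order_lt_xz[OF lt]
            monomial_order_lt_axz[OF lt0 lt] lt_axz_iff Q.ideal_axioms J'.ideal_axioms Q_J' sb r12J] by blast
      \<comment> \<open>The term coming from \<open>r2\<close> lies in \<open>P\<close>, so c2 r1(t)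
        does too, and primality removes \<open>c2\<close>.\<close>
      have "r1 t \<in> P" for t
      proof -
        have r1t: "r1 t \<in> carrier A" "r2 t \<in> carrier A" using r1 r2 by (auto intro: coeff_closed)
        have "r12 t \<in> P" "c1 \<otimes>\<^bsub>A\<^esub> r2 t \<in> P"
          using \<open>range r12 \<subseteq> Q\<close> QP r2P c1 by (auto intro!: P.I_l_closed)
        then have "r12 t \<oplus>\<^bsub>A\<^esub> \<ominus>\<^bsub>A\<^esub> (c1 \<otimes>\<^bsub>A\<^esub> r2 t) \<in> P" by (intro P.a_closed P.a_inv_closed)
        also have "r12 t \<oplus>\<^bsub>A\<^esub> \<ominus>\<^bsub>A\<^esub> (c1 \<otimes>\<^bsub>A\<^esub> r2 t) = c2 \<otimes>\<^bsub>A\<^esub> r1 t"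
          unfolding r12_eq using c1 c2 r1t by (simp add: A.a_assoc A.r_neg)
        finally show ?thesis using P.I_prime[of c2 "r1 t"] c2 r1t by blast
      qed
      moreover have "graded A d r1" using r1'(1) by (auto simp: graded_def Bd_def in_supp_iff)
      ultimately have "range (dehomogenize A r1) \<subseteq> P"
        using A.dehomogenize_graded[OF r1] P.zero_closed by auto
      then have sd_r1: "?sd r1 = \<zero>\<^bsub>mpoly ?F\<^esub>" using r1 by (simp add: P.specialize_eq_zero_iff)
      have "graded A d R2" using R2_B by (auto simp: graded_def Bd_def in_supp_iff)
      then have "range (dehomogenize A R2) \<subseteq> P"
        using A.dehomogenize_graded[OF R12c(2)] P.zero_closed R2P by auto
      then have sd_R2: "?sd R2 = \<zero>\<^bsub>mpoly ?F\<^esub>" using R12c by (simp add: P.specialize_eq_zero_iff)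
      have "?sd R = ?sd R1" unfolding R12 using R12c sd_R2 by simp
      then have sd_R1: "?sd R1 = const ?F (residue A P b) \<otimes>\<^bsub>mpoly ?F\<^esub> X" using R(3) br by simp
      have sd_c1: "?sd ?c1 = const ?F (residue A P c1)"
        using dehomogenize_monom[OF A.is_cring, of c1 "0 :: nat ^ 'n" 0] c1
        by (simp add: const_eq_monom zero_prod_def P.specialize_monom)
      have "?sd p1 = ?sd (?c1 \<otimes>\<^bsub>mpoly A\<^esub> R1)" unfolding eq1 using pc r1 sd_r1 by simp
      also have "\<dots> = const ?F (residue A P c1) \<otimes>\<^bsub>mpoly ?F\<^esub> (const ?F (residue A P b) \<otimes>\<^bsub>mpoly ?F\<^esub> X)"
        using cc R12c sd_c1 sd_R1 by simp
      finally have sd_p1: "?sd p1 = \<dots>" .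
      \<comment> \<open>Undoes the two scalings of \<open>X\<close>, by the denominator
        \<open>b\<close> and by the multiplier \<open>c1\<close>; both are units in the residue
        field.\<close>
      define w where "w = inv\<^bsub>?F\<^esub> (residue A P c1 \<otimes>\<^bsub>?F\<^esub> residue A P b)"
      have U: "residue A P c1 \<otimes>\<^bsub>?F\<^esub> residue A P b \<in> Units ?F"
        using P.residue_Unit c1 b by (intro F.Units_m_closed) auto
      have w: "w \<in> carrier ?F" "w \<otimes>\<^bsub>?F\<^esub> (residue A P c1 \<otimes>\<^bsub>?F\<^esub> residue A P b) = \<one>\<^bsub>?F\<^esub>"
        using U unfolding w_def by auto
      have "const ?F w \<otimes>\<^bsub>mpoly ?F\<^esub> ?sd p1 = X"
      proof
        fix t
        have "(const ?F w \<otimes>\<^bsub>mpoly ?F\<^esub> ?sd p1) t = w \<otimes>\<^bsub>?F\<^esub> (residue A P c1 \<otimes>\<^bsub>?F\<^esub> (residue A P b \<otimes>\<^bsub>?F\<^esub> X t))"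
          unfolding sd_p1 using w b c1 Xc by (simp add: F.coeff_const_mult)
        also have "\<dots> = w \<otimes>\<^bsub>?F\<^esub> (residue A P c1 \<otimes>\<^bsub>?F\<^esub> residue A P b) \<otimes>\<^bsub>?F\<^esub> X t"
          using w(1) b c1 coeff_closed[OF Xc] by (simp add: F.m_assoc del: \<phi>.hom_mult)
        finally show "(const ?F w \<otimes>\<^bsub>mpoly ?F\<^esub> ?sd p1) t = X t" using w(2) coeff_closed[OF Xc] by simp
      qed
      moreover have "?sd p1 \<in> comb ?F (specialize A P ` GG) B'"
        unfolding GG by (rule P.comb_specialize_dehomogenize[OF G0(3) p1]) (auto simp: Bd_def)
      ultimately have "X \<in> comb ?F (specialize A P ` GG) B'"
        using F.comb_const_mult[OF sGGc _ w(1)] by metis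
      then obtain qq where qq: "\<forall>g\<in>specialize A P ` GG. qq g \<in> carrier (mpoly ?F)"
        "X = (\<Oplus>\<^bsub>mpoly ?F\<^esub>g\<in>specialize A P ` GG. qq g \<otimes>\<^bsub>mpoly ?F\<^esub> g)"
        and qq_B: "\<forall>g\<in>specialize A P ` GG. supp ?F (qq g \<otimes>\<^bsub>mpoly ?F\<^esub> g) \<subseteq> B'"
        using F.comb_representation[OF fin sGGc] by blast
      \<comment> \<open>A nonzero product attains its leading exponent in its support, where the
        bound \<open>B'\<close> applies; a zero product is the exception allowed in the
        definition.\<close>
      have "qq g \<otimes>\<^bsub>mpoly ?F\<^esub> g = \<zero>\<^bsub>mpoly ?F\<^esub> \<or> lexp ?F lt (qq g \<otimes>\<^bsub>mpoly ?F\<^esub> g) \<in> B'"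
        if g: "g \<in> specialize A P ` GG" for g
      proof (cases "supp ?F (qq g \<otimes>\<^bsub>mpoly ?F\<^esub> g) = {}")
        case True
        then show ?thesis by (auto simp: supp_def mpoly_simps(2))
      next
        case False
        have "qq g \<otimes>\<^bsub>mpoly ?F\<^esub> g \<in> carrier (mpoly ?F)" using qq(1) g sGGc by blast
        from lexp_in_supp_max(1)[OF lt finite_supp[OF this] False] show ?thesis using qq_B g by blast
      qed
      then have "\<forall>g\<in>specialize A P ` GG. qq g \<otimes>\<^bsub>mpoly ?F\<^esub> g = \<zero>\<^bsub>mpoly ?F\<^esub> \<or>
          lt (lexp ?F lt (qq g \<otimes>\<^bsub>mpoly ?F\<^esub> g)) (lexp ?F lt X) \<or>
          lexp ?F lt (qq g \<otimes>\<^bsub>mpoly ?F\<^esub> g) = lexp ?F lt X"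
        unfolding B'_def by blast
      with qq show "\<exists>q. (\<forall>g\<in>specialize A P ` GG. q g \<in> carrier (mpoly ?F)) \<and>
             X = (\<Oplus>\<^bsub>mpoly ?F\<^esub>g\<in>specialize A P ` GG. q g \<otimes>\<^bsub>mpoly ?F\<^esub> g) \<and>
             (\<forall>g\<in>specialize A P ` GG. q g \<otimes>\<^bsub>mpoly ?F\<^esub> g = \<zero>\<^bsub>mpoly ?F\<^esub> \<or>
                lt (lexp ?F lt (q g \<otimes>\<^bsub>mpoly ?F\<^esub> g)) (lexp ?F lt X) \<or>
                lexp ?F lt (q g \<otimes>\<^bsub>mpoly ?F\<^esub> g) = lexp ?F lt X)"
        by (intro exI[of _ qq] conjI)
    qed
  qed
qed

end
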